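(* Let $(S_i(j))_{i\ge 1,j\ge 1}$ be i.i.d. non-negative random variables distributed as $S$, and let $(A(j))_{j\ge 1}$ be i.i.d. non-negative random variables distributed as $A$, independent of $(S_i(j))_{i,j\ge1}$, with $\mathbb{E}[A]=1/\lambda$, $\operatorname{Var}(A)=\sigma_A^2<\infty$ and $\mathbb{E}[S-A]=-\mu$ for some $\mu>0$. Let $\Lambda(\theta)=\log \mathbb{E}[\exp(\theta(S-1/\lambda))]$ and assume there exists $\gamma>0$ such that $\Lambda(\gamma)=0$ and $\gamma$ lies in the interior of $\{\theta:\Lambda(\theta)<\infty\}$. Let $W_1(\infty),\dots,W_N(\infty)$ be the steady-state waiting times in the $N$-server fork-join queue with these interarrival and service times. Then, as $N\to\infty$, $$\frac{\max_{i\le N}W_i(\infty)-\frac{1}{\gamma}\log N}{\sqrt{\log N}}\ \xrightarrow{d}\ \frac{\sigma_A}{\sqrt{\Lambda'(\gamma)\gamma}}\,X,$$ where $X\sim\mathcal{N}(0,1)$.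
   Context: Fork-join queue with $N$ servers: tasks arrive, with $A(j)$ the interarrival time between the $(j-1)$-st and $j$-th task. On arrival, each task places one subtask at each of the $N$ single-server FCFS queues; $S_i(j)$ is the service time of the $j$-th subtask in queue $i$. The waiting times (time until start of service) satisfy Lindley's recursion with $W_i(1)=0$ and $W_i(n+1)=\max(0,W_i(n)+S_i(n)-A(n+1))$. The vector $(W_1(\infty),\dots,W_N(\infty))$ denotes the limit in distribution of $(W_1(n),\dots,W_N(n))$ as $n\to\infty$. Equivalently, $\max_{i\le N}W_i(\infty)$ has the same distribution as $\max_{i\le N}\sup_{k\ge 0}\sum_{j=1}^k(S_i(j)-A(j))$ (the empty sum being $0$), where the sequence $(A(j))$ is common to all $i$. *)

theory Defs
  imports "HOL-Probability.Probability"
begin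

text \<open>
  Waiting times in a single-server FCFS queue by Lindley's recursion, from the service times
  \<open>s 1, s 2, \<dots>\<close> and the interarrival times \<open>a 1, a 2, \<dots>\<close>. Tasks are numbered from \<open>1\<close>;
  the value at \<open>0\<close> is a dummy.
\<close>

fun waiting_time :: "(nat \<Rightarrow> real) \<Rightarrow> (nat \<Rightarrow> real) \<Rightarrow> nat \<Rightarrow> real" where
  "waiting_time s a 0 = 0"
| "waiting_time s a (Suc 0) = 0"
| "waiting_time s a (Suc (Suc n)) =
     max 0 (waiting_time s a (Suc n) + s (Suc n) - a (Suc (Suc n)))"

text \<open>
  Convergence in distribution of random elements of a topological space. The library's
  \<^const>\<open>weak_conv_m\<close> covers real-valued random variables only.
\<close>

definition conv_in_distribution ::
  "(nat \<Rightarrow> 'a measure) \<Rightarrow> (nat \<Rightarrow> 'a \<Rightarrow> 'c::topological_space) \<Rightarrow> 'b measure \<Rightarrow> ('b \<Rightarrow> 'c) \<Rightarrow> bool"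
  where
  "conv_in_distribution M X Q Y \<longleftrightarrow>
     (\<forall>f :: 'c \<Rightarrow> real. continuous_on UNIV f \<and> bounded (range f) \<longrightarrow>
        (\<lambda>n. \<integral>\<omega>. f (X n \<omega>) \<partial>M n) \<longlonglongrightarrow> (\<integral>\<omega>. f (Y \<omega>) \<partial>Q))"

text \<open>
  The random vector \<open>(W 1, \<dots>, W N)\<close> on \<open>Q\<close> is the limit in distribution of the vectors of
  waiting times of the \<open>n\<close>-th task in the queues \<open>1, \<dots>, N\<close>, which all share the interarrival
  times \<open>As\<close>. A vector indexed by \<open>{1..N}\<close> is a function on \<open>nat\<close> that is constant outside
  \<open>{1..N}\<close>, and \<open>nat \<Rightarrow> real\<close> carries the product topology, which on these vectors is the
  Euclidean one.
\<close>

definition steady_state_waiting_times ::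
  "'a measure \<Rightarrow> (nat \<Rightarrow> nat \<Rightarrow> 'a \<Rightarrow> real) \<Rightarrow> (nat \<Rightarrow> 'a \<Rightarrow> real) \<Rightarrow> nat \<Rightarrow>
   'b measure \<Rightarrow> (nat \<Rightarrow> 'b \<Rightarrow> real) \<Rightarrow> bool"
  where
  "steady_state_waiting_times M Ss As N Q W \<longleftrightarrow>
     prob_space Q \<and> (\<forall>i\<in>{1..N}. W i \<in> borel_measurable Q) \<and>
     conv_in_distribution (\<lambda>_. M)
       (\<lambda>n \<omega>. \<lambda>i\<in>{1..N}. waiting_time (\<lambda>j. Ss i j \<omega>) (\<lambda>j. As j \<omega>) n)
       Q (\<lambda>\<omega>. \<lambda>i\<in>{1..N}. W i \<omega>)"

text \<open>
  The logarithmic moment generating function with values in the extended reals. The case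
  distinction is needed because the Bochner integral of a non-integrable function is \<open>0\<close>.
\<close>

definition log_mgf :: "'a measure \<Rightarrow> ('a \<Rightarrow> real) \<Rightarrow> real \<Rightarrow> ereal" where
  "log_mgf M X \<theta> =
     (if integrable M (\<lambda>\<omega>. exp (\<theta> * X \<omega>)) then ereal (ln (\<integral>\<omega>. exp (\<theta> * X \<omega>) \<partial>M)) else \<infinity>)"

end

theory Submission
  imports Defs "HOL-Real_Asymp.Real_Asymp"
begin

text \<open>
  Write \<open>Y = S - 1/\<lambda>\<close> and split the walk that drives queue \<open>i\<close> as \<open>X i k + R k\<close>, where
  \<open>X i k\<close> sums the centred service times and \<open>R k\<close> the negated centred interarrival
  times; all queues share \<open>R\<close>. Reversing time in Lindley's recursion, the maximal stationary waiting
  time is distributed as the maximum over \<open>i \<le> N\<close> and \<open>k \<ge> 0\<close> of \<open>X i k + R k\<close>.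

  Put \<open>L = ln N\<close> and \<open>v = \<Lambda>'(\<gamma>)\<close>. Since \<open>E exp (\<gamma> Y) = 1\<close>, one has
  \<open>P (X i k \<ge> y) \<le> exp (-\<gamma> y)\<close> for every \<open>k\<close>, so that among \<open>N\<close> queues and polynomially many (in
  \<open>L\<close>) times no \<open>X i k\<close> exceeds \<open>L/\<gamma>\<close> by a multiple of \<open>sqrt L\<close>. Under the law of
  \<open>Y\<close> tilted by \<open>exp (\<gamma> y)\<close> the mean is \<open>v\<close>, so the level \<open>L/\<gamma>\<close> is reached, if at all, near the
  time \<open>k = L/(\<gamma> v)\<close>. On that time scale \<open>R\<close> is of order \<open>sqrt L\<close> and nearly constant over the range
  of relevant times. Hence the maximum is \<open>L/\<gamma> + R (L/(\<gamma> v))\<close> up to \<open>o(sqrt L)\<close>, and the central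
  limit theorem for \<open>R\<close> gives the normal limit with standard deviation \<open>\<sigma>\<^sub>A / sqrt (\<gamma> v)\<close>.

  Upper bound (\<open>upper_deviation\<close>). Outside a window of width of order \<open>L\<close> to the power \<open>9/10\<close> around
  \<open>L/(\<gamma> v)\<close>, tilting by \<open>\<gamma> \<plusminus> h\<close> with a small \<open>h\<close> shows that every \<open>X i k\<close> stays below \<open>L/\<gamma>\<close> by
  more than \<open>R\<close> can compensate (\<open>service_walk_off_window\<close>); times beyond a large multiple of
  \<open>L\<close> are excluded by the negative drift (\<open>late_crossings_negligible\<close>). Inside the window \<open>R\<close> does
  not rise above its value at the left end by more than a small multiple of \<open>sqrt L\<close>
  (\<open>arrival_walk_flat_on_window\<close>). Only upward deviations of \<open>R\<close> matter here, and they have Gaussian tails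
  because the interarrival times are non-negative and square integrable (\<open>exp_neg_centered_le\<close>). This
  makes union bounds over the times affordable. The thresholds for \<open>X\<close> are deterministic, so that no
  conditioning on the arrivals occurs.

  Lower bound (\<open>lower_deviation\<close>). At the single time \<open>k = \<lfloor>L/(\<gamma> v)\<rfloor>\<close> the \<open>X i k\<close> are independent
  over \<open>i\<close>, and it remains to see that \<open>N\<close> times the probability that \<open>X i k\<close> is above
  \<open>L/\<gamma> - \<eta> sqrt L\<close> tends to infinity. Chernoff's bound must therefore be reversed with an error
  \<open>exp (o(sqrt L))\<close>, which the central limit theorem under the tilted law provides
  (\<open>tilted_large_deviation_lower_bound\<close>).
\<close>

section \<open>Second-order expansion of moment generating functions\<close>

lemma abs_exp_minus_one_minus_le:
  fixes t :: real
  shows "\<bar>exp t - 1 - t\<bar> \<le> t\<^sup>2 * exp \<bar>t\<bar>"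
proof -
  obtain s where s: "\<bar>s\<bar> \<le> \<bar>t\<bar>" "exp t = (\<Sum>m<2. t ^ m / fact m) + exp s / fact 2 * t ^ 2"
    using Maclaurin_exp_le[of t 2] by blast
  have "exp t - 1 - t = exp s / 2 * t\<^sup>2"
    using s(2) by (simp add: numeral_2_eq_2)
  moreover have "exp s \<le> exp \<bar>t\<bar>" using s(1) by simp
  moreover have "exp s / 2 \<le> exp \<bar>t\<bar>"
    using \<open>exp s \<le> exp \<bar>t\<bar>\<close> exp_gt_zero[of s] by linarith
  ultimately have le: "exp s / 2 \<le> exp \<bar>t\<bar>" and eq: "exp t - 1 - t = exp s / 2 * t\<^sup>2"
    by blast+
  have "\<bar>exp t - 1 - t\<bar> = exp s / 2 * t\<^sup>2" unfolding eq by (rule abs_of_nonneg) simp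
  also have "\<dots> \<le> exp \<bar>t\<bar> * t\<^sup>2" using le by (rule mult_right_mono) simp
  finally show ?thesis by (simp only: mult.commute)
qed

lemma square_le_two_exp_abs:
  fixes t :: real
  shows "t\<^sup>2 \<le> 2 * exp \<bar>t\<bar>"
  using exp_lower_Taylor_quadratic[of "\<bar>t\<bar>"] by simp

text \<open>
  One of the two exponentials dominates, according to the sign of \<open>y\<close>; their sum is the integrable
  majorant in all estimates of this section.
\<close>

lemma exp_tilt_le:
  fixes g r t y :: real
  assumes "\<bar>t\<bar> \<le> r * \<bar>y\<bar>"
  shows "exp (g * y + t) \<le> exp ((g + r) * y) + exp ((g - r) * y)"
proof (cases "0 \<le> y")
  case True
  then have "exp (g * y + t) \<le> exp ((g + r) * y)"
    using assms by (simp add: distrib_right)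
  then show ?thesis by (smt (verit) exp_gt_zero)
next
  case False
  then have "exp (g * y + t) \<le> exp ((g - r) * y)"
    using assms by (simp add: left_diff_distrib)
  then show ?thesis by (smt (verit) exp_gt_zero)
qed

context prob_space
begin

context
  fixes Y :: "'a \<Rightarrow> real" and g r :: real
  assumes Y[measurable]: "Y \<in> borel_measurable M"
    and r: "0 < r"
    and int_r: "integrable M (\<lambda>x. exp ((g + r) * Y x))" "integrable M (\<lambda>x. exp ((g - r) * Y x))"
begin

lemma integrable_exp_tilt:
  assumes "\<bar>h\<bar> \<le> r"
  shows "integrable M (\<lambda>x. exp ((g + h) * Y x))"
proof (rule Bochner_Integration.integrable_bound[OF Bochner_Integration.integrable_add[OF int_r]])
  show "AE x in M. norm (exp ((g + h) * Y x)) \<le> norm (exp ((g + r) * Y x) + exp ((g - r) * Y x))"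
  proof (intro AE_I2)
    fix x
    have "\<bar>h * Y x\<bar> \<le> r * \<bar>Y x\<bar>" using assms by (simp add: abs_mult mult_right_mono)
    from exp_tilt_le[OF this, of g]
    show "norm (exp ((g + h) * Y x)) \<le> norm (exp ((g + r) * Y x) + exp ((g - r) * Y x))"
      by (simp add: distrib_right)
  qed
qed simp

lemma square_times_exp_tilt_le:
  "y\<^sup>2 * (exp (g * y) * exp (r / 2 * \<bar>y\<bar>)) \<le> 8 / r\<^sup>2 * (exp ((g + r) * y) + exp ((g - r) * y))"
proof -
  have "y\<^sup>2 \<le> 8 / r\<^sup>2 * exp (r / 2 * \<bar>y\<bar>)"
    using square_le_two_exp_abs[of "r / 2 * y"] r
    by (simp add: abs_mult power_mult_distrib field_simps power2_eq_square)
  then have "y\<^sup>2 * (exp (g * y) * exp (r / 2 * \<bar>y\<bar>))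
      \<le> (8 / r\<^sup>2 * exp (r / 2 * \<bar>y\<bar>)) * (exp (g * y) * exp (r / 2 * \<bar>y\<bar>))"
    by (rule mult_right_mono) simp
  also have "\<dots> = 8 / r\<^sup>2 * exp (g * y + r * \<bar>y\<bar>)"
    by (simp add: exp_add[symmetric] field_simps)
  also have "\<dots> \<le> 8 / r\<^sup>2 * (exp ((g + r) * y) + exp ((g - r) * y))"
    using r by (intro mult_left_mono exp_tilt_le) (auto simp: abs_mult)
  finally show ?thesis .
qed

lemma integrable_square_times_exp_tilt:
  "integrable M (\<lambda>x. (Y x)\<^sup>2 * exp (g * Y x))"
proof (rule Bochner_Integration.integrable_bound)
  show "integrable M (\<lambda>x. 8 / r\<^sup>2 * (exp ((g + r) * Y x) + exp ((g - r) * Y x)))"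
    using int_r by simp
  show "AE x in M. norm ((Y x)\<^sup>2 * exp (g * Y x))
      \<le> norm (8 / r\<^sup>2 * (exp ((g + r) * Y x) + exp ((g - r) * Y x)))"
  proof (intro AE_I2)
    fix x
    have "(Y x)\<^sup>2 * exp (g * Y x) * 1 \<le> (Y x)\<^sup>2 * exp (g * Y x) * exp (r / 2 * \<bar>Y x\<bar>)"
      using r by (intro mult_left_mono) auto
    also have "\<dots> \<le> 8 / r\<^sup>2 * (exp ((g + r) * Y x) + exp ((g - r) * Y x))"
      using square_times_exp_tilt_le[of "Y x"] by (simp add: mult.assoc)
    finally show "norm ((Y x)\<^sup>2 * exp (g * Y x))
      \<le> norm (8 / r\<^sup>2 * (exp ((g + r) * Y x) + exp ((g - r) * Y x)))"
      by (simp add: abs_mult)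
  qed
qed simp

lemma integrable_times_exp_tilt:
  "integrable M (\<lambda>x. Y x * exp (g * Y x))"
proof (rule Bochner_Integration.integrable_bound)
  show "integrable M (\<lambda>x. exp (g * Y x) + (Y x)\<^sup>2 * exp (g * Y x))"
    using integrable_exp_tilt[of 0] integrable_square_times_exp_tilt r by simp
  show "AE x in M. norm (Y x * exp (g * Y x)) \<le> norm (exp (g * Y x) + (Y x)\<^sup>2 * exp (g * Y x))"
  proof (intro AE_I2)
    fix x
    have "\<bar>Y x\<bar> \<le> 1 + (Y x)\<^sup>2"
      using sum_squares_bound[of "\<bar>Y x\<bar>" 1] by simp
    then have "\<bar>Y x\<bar> * exp (g * Y x) \<le> (1 + (Y x)\<^sup>2) * exp (g * Y x)"
      by (intro mult_right_mono) auto
    then show "norm (Y x * exp (g * Y x)) \<le> norm (exp (g * Y x) + (Y x)\<^sup>2 * exp (g * Y x))"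
      by (simp add: abs_mult distrib_right)
  qed
qed simp

text \<open>
  Integrability of \<open>exp ((g \<plusminus> r) Y)\<close> leaves room for a factor \<open>Y\<^sup>2\<close>, so Taylor's formula may be
  integrated. One estimate yields both the derivative of the moment generating function and the
  quadratic upper bounds on it that enter the exponential tail bounds.
\<close>

lemma mgf_quadratic_bound:
  "\<exists>C>0. \<forall>h. \<bar>h\<bar> \<le> r / 2 \<longrightarrow>
     \<bar>expectation (\<lambda>x. exp ((g + h) * Y x)) - expectation (\<lambda>x. exp (g * Y x))
       - h * expectation (\<lambda>x. Y x * exp (g * Y x))\<bar> \<le> C * h\<^sup>2"
proof -
  define D where "D x = 8 / r\<^sup>2 * (exp ((g + r) * Y x) + exp ((g - r) * Y x))" for x
  have D: "integrable M D" "\<And>x. 0 \<le> D x" unfolding D_def using int_r by auto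
  have "\<bar>expectation (\<lambda>x. exp ((g + h) * Y x)) - expectation (\<lambda>x. exp (g * Y x))
       - h * expectation (\<lambda>x. Y x * exp (g * Y x))\<bar> \<le> (expectation D + 1) * h\<^sup>2"
    if h: "\<bar>h\<bar> \<le> r / 2" for h
  proof -
    let ?f = "\<lambda>x. exp ((g + h) * Y x) - exp (g * Y x) - h * (Y x * exp (g * Y x))"
    have i: "integrable M (\<lambda>x. exp ((g + h) * Y x))" "integrable M (\<lambda>x. exp (g * Y x))"
      "integrable M (\<lambda>x. h * (Y x * exp (g * Y x)))"
      using integrable_exp_tilt[of h] integrable_exp_tilt[of 0] integrable_times_exp_tilt h r by auto
    have "\<bar>expectation (\<lambda>x. exp ((g + h) * Y x)) - expectation (\<lambda>x. exp (g * Y x))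
       - h * expectation (\<lambda>x. Y x * exp (g * Y x))\<bar> = \<bar>expectation ?f\<bar>"
      using i by simp
    also have "\<dots> \<le> expectation (\<lambda>x. \<bar>?f x\<bar>)" by (rule integral_abs_bound)
    also have "\<dots> \<le> expectation (\<lambda>x. h\<^sup>2 * D x)"
    proof (rule integral_mono)
      show "integrable M (\<lambda>x. \<bar>?f x\<bar>)"
        by (intro integrable_abs Bochner_Integration.integrable_diff i)
      show "integrable M (\<lambda>x. h\<^sup>2 * D x)" using D by simp
      fix x
      let ?y = "Y x"
      have "?f x = exp (g * ?y) * (exp (h * ?y) - 1 - h * ?y)"
        by (simp add: distrib_right exp_add algebra_simps)
      then have "\<bar>?f x\<bar> = exp (g * ?y) * \<bar>exp (h * ?y) - 1 - h * ?y\<bar>" by (simp add: abs_mult)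
      also have "\<dots> \<le> exp (g * ?y) * ((h * ?y)\<^sup>2 * exp \<bar>h * ?y\<bar>)"
        by (intro mult_left_mono abs_exp_minus_one_minus_le) auto
      also have "\<dots> \<le> exp (g * ?y) * ((h * ?y)\<^sup>2 * exp (r / 2 * \<bar>?y\<bar>))"
        using mult_right_mono[OF h, of "\<bar>?y\<bar>"] by (intro mult_left_mono) (auto simp: abs_mult)
      also have "\<dots> = h\<^sup>2 * (?y\<^sup>2 * (exp (g * ?y) * exp (r / 2 * \<bar>?y\<bar>)))"
        by (simp add: power_mult_distrib mult_ac)
      also have "\<dots> \<le> h\<^sup>2 * D x"
        unfolding D_def by (intro mult_left_mono square_times_exp_tilt_le) auto
      finally show "\<bar>?f x\<bar> \<le> h\<^sup>2 * D x" .
    qed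
    also have "\<dots> \<le> (expectation D + 1) * h\<^sup>2" by (simp add: algebra_simps)
    finally show ?thesis .
  qed
  moreover have "0 \<le> expectation D" using D by simp
  ultimately show ?thesis by (intro exI[of _ "expectation D + 1"]) auto
qed

lemma mgf_has_derivative:
  "((\<lambda>\<theta>. expectation (\<lambda>x. exp (\<theta> * Y x))) has_field_derivative
     expectation (\<lambda>x. Y x * exp (g * Y x))) (at g)"
proof -
  let ?m = "\<lambda>\<theta>. expectation (\<lambda>x. exp (\<theta> * Y x))" and ?d = "expectation (\<lambda>x. Y x * exp (g * Y x))"
  obtain C where C: "\<And>h. \<bar>h\<bar> \<le> r / 2 \<Longrightarrow> \<bar>?m (g + h) - ?m g - h * ?d\<bar> \<le> C * h\<^sup>2"
    using mgf_quadratic_bound by blast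
  have "((\<lambda>h. (?m (g + h) - ?m g) / h - ?d) \<longlongrightarrow> 0) (at 0)"
  proof (rule Lim_null_comparison)
    show "((\<lambda>h. C * \<bar>h\<bar>) \<longlongrightarrow> 0) (at 0)" by (auto intro!: tendsto_eq_intros)
    have "\<forall>\<^sub>F h in at 0. \<bar>h\<bar> < r / 2 \<and> h \<noteq> 0"
      unfolding eventually_at using r by (intro exI[of _ "r / 2"]) auto
    then show "\<forall>\<^sub>F h in at 0. norm ((?m (g + h) - ?m g) / h - ?d) \<le> C * \<bar>h\<bar>"
    proof eventually_elim
      case (elim h)
      then have "norm ((?m (g + h) - ?m g) / h - ?d) = \<bar>?m (g + h) - ?m g - h * ?d\<bar> / \<bar>h\<bar>"
        by (simp add: field_simps flip: abs_divide)
      also have "\<dots> \<le> C * h\<^sup>2 / \<bar>h\<bar>" using C[of h] elim by (intro divide_right_mono) auto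
      also have "\<dots> = C * \<bar>h\<bar>" using elim by (simp add: power2_eq_square abs_if)
      finally show ?case .
    qed
  qed
  then show ?thesis
    unfolding DERIV_def by (rule LIM_zero_cancel)
qed

end

text \<open>
  Convexity: \<open>t \<mapsto> E exp (t Y)\<close> takes the value \<open>1\<close> at \<open>0\<close> and at \<open>g\<close>, so its slope at \<open>g\<close> is not
  negative, and it vanishes only for \<open>Y = 0\<close>. Pointwise this is the tangent inequality
  \<open>t exp t - exp t + 1 \<ge> 0\<close>, which is strict for \<open>t \<noteq> 0\<close>.
\<close>

lemma tilted_mean_pos:
  fixes Y :: "'a \<Rightarrow> real"
  assumes [measurable]: "Y \<in> borel_measurable M"
    and g: "0 < g" and e: "expectation (\<lambda>x. exp (g * Y x)) = 1"
    and i: "integrable M (\<lambda>x. Y x * exp (g * Y x))"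
    and neg: "expectation Y < 0"
  shows "0 < expectation (\<lambda>x. Y x * exp (g * Y x))"
proof -
  let ?f = "\<lambda>x. g * (Y x * exp (g * Y x)) - exp (g * Y x) + 1"
  have ie: "integrable M (\<lambda>x. exp (g * Y x))"
    using e not_integrable_integral_eq by fastforce
  have if': "integrable M ?f" using i ie by simp
  have gt: "0 < t * exp t - exp t + 1" if "t \<noteq> 0" for t :: real
  proof -
    have "1 - t < exp (- t)"
      using exp_minus_greater[of t] that by simp
    then have "(1 - t) * exp t < exp (- t) * exp t" by simp
    then show ?thesis by (simp add: exp_add[symmetric] algebra_simps)
  qed
  have fpos: "0 \<le> ?f x" "?f x = 0 \<longleftrightarrow> Y x = 0" for x
    using gt[of "g * Y x"] g by (cases "Y x = 0"; simp add: mult.assoc)+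
  have "expectation ?f = g * expectation (\<lambda>x. Y x * exp (g * Y x))"
    using i ie e by (simp add: prob_space)
  moreover have "0 \<le> expectation ?f" using fpos by (intro integral_nonneg_AE) auto
  moreover have "expectation ?f \<noteq> 0"
  proof
    assume "expectation ?f = 0"
    then have "AE x in M. ?f x = 0"
      using integral_nonneg_eq_0_iff_AE[OF if'] fpos by auto
    then have "AE x in M. Y x = 0" using fpos(2) by simp
    then have "expectation Y = expectation (\<lambda>_. 0)" by (intro integral_cong_AE) auto
    then show False using neg by simp
  qed
  ultimately have "0 < g * expectation (\<lambda>x. Y x * exp (g * Y x))" by linarith
  then show ?thesis using g by (simp add: zero_less_mult_iff)
qed

end

section \<open>Exponential tail bounds for independent sums\<close>

lemma (in prob_space) distr_indep_vars_eq_PiM: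
  assumes "I \<noteq> {}" "indep_vars (\<lambda>_. N) X I" "\<And>i. i \<in> I \<Longrightarrow> distr M N (X i) = \<nu> i"
  shows "distr M (PiM I (\<lambda>_. N)) (\<lambda>\<omega>. \<lambda>i\<in>I. X i \<omega>) = PiM I \<nu>"
proof -
  have "distr M (PiM I (\<lambda>_. N)) (\<lambda>\<omega>. \<lambda>i\<in>I. X i \<omega>) = PiM I (\<lambda>i. distr M N (X i))"
    using assms by (subst indep_vars_iff_distr_eq_PiM'[symmetric]) (auto simp: indep_vars_def)
  also have "\<dots> = PiM I \<nu>" using assms by (intro PiM_cong) auto
  finally show ?thesis .
qed

text \<open>
  Each variable of the new family is a coordinate of a singleton block of the old one, and the
  blocks are disjoint because \<open>f\<close> is injective.
\<close>

lemma (in prob_space) indep_vars_reindex: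
  assumes "indep_vars N X K" "inj_on f I" "f ` I \<subseteq> K"
  shows "indep_vars (\<lambda>i. N (f i)) (\<lambda>i. X (f i)) I"
proof -
  have "indep_vars (\<lambda>j. PiM {f j} N) (\<lambda>j \<omega>. \<lambda>i\<in>{f j}. X i \<omega>) I"
    using assms by (intro indep_vars_restrict[OF assms(1)]) (auto simp: disjoint_family_on_def inj_on_def)
  then have "indep_vars (\<lambda>i. N (f i)) (\<lambda>j \<omega>. (\<lambda>i\<in>{f j}. X i \<omega>) (f j)) I"
    by (rule indep_vars_compose2) (auto intro: measurable_component_singleton)
  then show ?thesis by simp
qed

lemma (in prob_space) chernoff_bound_indep_sum:
  fixes Z :: "'j \<Rightarrow> 'a \<Rightarrow> real"
  assumes fin: "finite J" and ind: "indep_vars (\<lambda>_. borel) Z J" and "0 \<le> \<theta>"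
    and int: "\<And>j. j \<in> J \<Longrightarrow> integrable M (\<lambda>x. exp (\<theta> * Z j x))"
    and m: "\<And>j. j \<in> J \<Longrightarrow> expectation (\<lambda>x. exp (\<theta> * Z j x)) \<le> m"
  shows "prob {x \<in> space M. y \<le> (\<Sum>j\<in>J. Z j x)} \<le> exp (- \<theta> * y) * m ^ card J"
proof -
  have [measurable]: "Z j \<in> borel_measurable M" if "j \<in> J" for j
    using ind that by (auto simp: indep_vars_def)
  have ind': "indep_vars (\<lambda>_. borel) (\<lambda>j x. exp (\<theta> * Z j x)) J"
    by (rule indep_vars_compose2[OF ind]) simp
  have eq: "(\<Prod>j\<in>J. exp (\<theta> * Z j x)) = exp (\<theta> * (\<Sum>j\<in>J. Z j x))" for x
    using fin by (simp add: exp_sum sum_distrib_left)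
  have i: "integrable M (\<lambda>x. exp (\<theta> * (\<Sum>j\<in>J. Z j x)))"
    using indep_vars_integrable[OF fin ind' int] by (simp add: eq)
  have "expectation (\<lambda>x. exp (\<theta> * (\<Sum>j\<in>J. Z j x))) = (\<Prod>j\<in>J. expectation (\<lambda>x. exp (\<theta> * Z j x)))"
    using indep_vars_lebesgue_integral[OF fin ind' int] by (simp add: eq)
  also have "\<dots> \<le> (\<Prod>j\<in>J. m)" using m by (intro prod_mono) auto
  finally have E: "expectation (\<lambda>x. exp (\<theta> * (\<Sum>j\<in>J. Z j x))) \<le> m ^ card J" by simp
  have "prob {x \<in> space M. y \<le> (\<Sum>j\<in>J. Z j x)}
      \<le> prob {x \<in> space M. exp (\<theta> * y) \<le> exp (\<theta> * (\<Sum>j\<in>J. Z j x))}"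
    using \<open>0 \<le> \<theta>\<close> by (intro finite_measure_mono) (auto simp: mult_left_mono)
  also have "\<dots> \<le> expectation (\<lambda>x. exp (\<theta> * (\<Sum>j\<in>J. Z j x))) / exp (\<theta> * y)"
    by (rule integral_Markov_inequality_measure[OF i, of "{}"]) auto
  also have "\<dots> \<le> m ^ card J / exp (\<theta> * y)" using E by (intro divide_right_mono) auto
  finally show ?thesis by (simp add: exp_minus field_simps)
qed

text \<open>
  For a non-negative square integrable variable the lower tail is sub-Gaussian,
  since \<open>exp (-t) \<le> 1 - t + t\<^sup>2\<close> for every \<open>t \<ge> 0\<close>.
\<close>

lemma (in prob_space) exp_neg_centered_le:
  fixes A :: "'a \<Rightarrow> real"
  assumes [measurable]: "A \<in> borel_measurable M" and nn: "AE x in M. 0 \<le> A x"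
    and i2: "integrable M (\<lambda>x. (A x)\<^sup>2)" and "0 \<le> \<theta>"
  shows "integrable M (\<lambda>x. exp (- \<theta> * (A x - expectation A)))"
    and "expectation (\<lambda>x. exp (- \<theta> * (A x - expectation A))) \<le> exp (\<theta>\<^sup>2 * expectation (\<lambda>x. (A x)\<^sup>2))"
proof -
  have i1: "integrable M A" by (rule square_integrable_imp_integrable[OF _ i2]) simp
  have le1: "AE x in M. exp (- \<theta> * A x) \<le> 1 - \<theta> * A x + \<theta>\<^sup>2 * (A x)\<^sup>2"
    using nn
  proof eventually_elim
    case (elim x)
    have "exp (- \<theta> * A x) \<le> 1 - \<theta> * A x + (\<theta> * A x)\<^sup>2"
    proof -
      let ?t = "\<theta> * A x"
      have "0 \<le> ?t" using elim \<open>0 \<le> \<theta>\<close> by simp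
      have "(1 + ?t) * exp (- ?t) \<le> exp ?t * exp (- ?t)"
        using exp_ge_add_one_self[of ?t] by (intro mult_right_mono) auto
      then have "exp (- ?t) \<le> 1 / (1 + ?t)" using \<open>0 \<le> ?t\<close>
        by (simp add: exp_add[symmetric] field_simps)
      also have "\<dots> \<le> 1 - ?t + ?t\<^sup>2"
      proof -
        have "(1 - ?t + ?t\<^sup>2) * (1 + ?t) = 1 + ?t ^ 3" by algebra
        then show ?thesis using \<open>0 \<le> ?t\<close> by (simp add: divide_le_eq)
      qed
      finally show ?thesis by simp
    qed
    then show ?case by (simp add: power_mult_distrib)
  qed
  have ie: "integrable M (\<lambda>x. exp (- \<theta> * A x))"
  proof (rule integrable_const_bound[where B = 1])
    show "AE x in M. norm (exp (- \<theta> * A x)) \<le> 1"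
      using nn by eventually_elim (simp add: \<open>0 \<le> \<theta>\<close>)
  qed simp
  have eq: "exp (- \<theta> * (A x - expectation A)) = exp (\<theta> * expectation A) * exp (- \<theta> * A x)" for x
    by (simp add: exp_add[symmetric] algebra_simps)
  show "integrable M (\<lambda>x. exp (- \<theta> * (A x - expectation A)))"
    unfolding eq using ie by simp
  have "expectation (\<lambda>x. exp (- \<theta> * A x)) \<le> expectation (\<lambda>x. 1 - \<theta> * A x + \<theta>\<^sup>2 * (A x)\<^sup>2)"
    using ie i1 i2 le1 by (intro integral_mono_AE) auto
  also have "\<dots> = 1 + (- \<theta> * expectation A + \<theta>\<^sup>2 * expectation (\<lambda>x. (A x)\<^sup>2))"
    using i1 i2 by (simp add: prob_space)
  also have "\<dots> \<le> exp (- \<theta> * expectation A + \<theta>\<^sup>2 * expectation (\<lambda>x. (A x)\<^sup>2))"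
    by (rule exp_ge_add_one_self)
  finally have "exp (\<theta> * expectation A) * expectation (\<lambda>x. exp (- \<theta> * A x))
     \<le> exp (\<theta> * expectation A) * exp (- \<theta> * expectation A + \<theta>\<^sup>2 * expectation (\<lambda>x. (A x)\<^sup>2))"
    by (intro mult_left_mono) auto
  also have "\<dots> = exp (\<theta>\<^sup>2 * expectation (\<lambda>x. (A x)\<^sup>2))"
    by (simp add: exp_add[symmetric])
  finally show "expectation (\<lambda>x. exp (- \<theta> * (A x - expectation A))) \<le> exp (\<theta>\<^sup>2 * expectation (\<lambda>x. (A x)\<^sup>2))"
    unfolding eq by simp
qed

section \<open>Exponential tilting and a sharp lower tail bound\<close>

text \<open>
  The density of a product of tilted laws factorises over measurable rectangles.
\<close>

lemma PiM_density_exp: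
  fixes \<nu> :: "real measure"
  assumes "prob_space \<nu>" and sets_\<nu>[measurable_cong]: "sets \<nu> = sets borel"
    and "prob_space (density \<nu> (\<lambda>y. ennreal (exp (g * y))))" and fin: "finite I"
  shows "PiM I (\<lambda>_. density \<nu> (\<lambda>y. ennreal (exp (g * y)))) =
    density (PiM I (\<lambda>_. \<nu>)) (\<lambda>z. ennreal (exp (g * (\<Sum>i\<in>I. z i))))"
proof -
  let ?T = "density \<nu> (\<lambda>y. ennreal (exp (g * y)))"
  interpret N: prob_space \<nu> by fact
  interpret T: prob_space ?T by fact
  interpret PN: product_sigma_finite "\<lambda>_. \<nu>" by standard
  interpret PT: product_sigma_finite "\<lambda>_. ?T" by standard
  show ?thesis
  proof (rule PT.PiM_eqI[symmetric, OF fin])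
    show "sets (density (PiM I (\<lambda>_. \<nu>)) (\<lambda>z. ennreal (exp (g * (\<Sum>i\<in>I. z i))))) = sets (PiM I (\<lambda>_. ?T))"
      by (simp cong: sets_PiM_cong)
    fix A assume A: "\<And>i. i \<in> I \<Longrightarrow> A i \<in> sets ?T"
    then have A'[measurable]: "\<And>i. i \<in> I \<Longrightarrow> A i \<in> sets \<nu>" by simp
    have "Pi\<^sub>E I A \<in> sets (PiM I (\<lambda>_. \<nu>))" using fin A' by (intro sets_PiM_I_finite) auto
    moreover have "(\<lambda>z. ennreal (exp (g * (\<Sum>i\<in>I. z i)))) \<in> borel_measurable (PiM I (\<lambda>_. \<nu>))"
      by measurable
    ultimately have "emeasure (density (PiM I (\<lambda>_. \<nu>)) (\<lambda>z. ennreal (exp (g * (\<Sum>i\<in>I. z i))))) (Pi\<^sub>E I A)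
        = (\<integral>\<^sup>+z. ennreal (exp (g * (\<Sum>i\<in>I. z i))) * indicator (Pi\<^sub>E I A) z \<partial>PiM I (\<lambda>_. \<nu>))"
      by (intro emeasure_density)
    also have "\<dots> = (\<integral>\<^sup>+z. (\<Prod>i\<in>I. ennreal (exp (g * z i)) * indicator (A i) (z i)) \<partial>PiM I (\<lambda>_. \<nu>))"
    proof (rule nn_integral_cong)
      fix z assume z: "z \<in> space (PiM I (\<lambda>_. \<nu>))"
      have "ennreal (exp (g * (\<Sum>i\<in>I. z i))) = (\<Prod>i\<in>I. ennreal (exp (g * z i)))"
        using fin by (simp add: prod_ennreal exp_sum sum_distrib_left)
      moreover have "(indicator (Pi\<^sub>E I A) z :: ennreal) = (\<Prod>i\<in>I. indicator (A i) (z i))"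
      proof (cases "\<forall>i\<in>I. z i \<in> A i")
        case True
        then show ?thesis using z by (auto simp: space_PiM PiE_iff)
      next
        case False
        then obtain i where "i \<in> I" "z i \<notin> A i" by auto
        then have "(\<Prod>i\<in>I. indicator (A i) (z i) :: ennreal) = 0" using fin
            by (intro prod_zero) (auto intro!: bexI[of _ i])
        moreover have "z \<notin> Pi\<^sub>E I A" using \<open>i \<in> I\<close> \<open>z i \<notin> A i\<close> by auto
        ultimately show ?thesis by simp
      qed
      ultimately show "ennreal (exp (g * (\<Sum>i\<in>I. z i))) * indicator (Pi\<^sub>E I A) z =
        (\<Prod>i\<in>I. ennreal (exp (g * z i)) * indicator (A i) (z i))" by (simp add: prod.distrib)
    qed
    also have "\<dots> = (\<Prod>i\<in>I. \<integral>\<^sup>+y. ennreal (exp (g * y)) * indicator (A i) y \<partial>\<nu>)"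
      using fin by (intro PN.product_nn_integral_prod) auto
    also have "\<dots> = (\<Prod>i\<in>I. emeasure ?T (A i))"
      by (intro prod.cong refl) (simp add: emeasure_density)
    finally show "emeasure (density (PiM I (\<lambda>_. \<nu>)) (\<lambda>z. ennreal (exp (g * (\<Sum>i\<in>I. z i))))) (Pi\<^sub>E I A)
      = (\<Prod>i\<in>I. emeasure ?T (A i))" .
  qed
qed

lemma std_normal_interval_pos:
  assumes "c < (d::real)"
  shows "0 < measure std_normal_distribution {c<..d}"
proof -
  interpret real_distribution std_normal_distribution by (rule real_dist_normal_dist)
  have "emeasure std_normal_distribution {c<..d} \<noteq> 0"
  proof
    assume "emeasure std_normal_distribution {c<..d} = 0"
    then have "(\<integral>\<^sup>+x. ennreal (std_normal_density x) * indicator {c<..d} x \<partial>lborel) = 0"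
      by (simp add: emeasure_density)
    then have "AE x in lborel. ennreal (std_normal_density x) * indicator {c<..d} x = 0"
      by (subst (asm) nn_integral_0_iff_AE) auto
    then have "AE x in lborel. x \<notin> {c<..d}"
    proof eventually_elim
      case (elim x)
      then show ?case using normal_density_pos[of 1 0 x] by (auto split: split_indicator_asm)
    qed
    then have "{c<..d} \<in> null_sets lborel"
      by (subst AE_iff_null_sets) auto
    then have "emeasure lborel {c<..d} = 0" by auto
    then show False using assms by simp
  qed
  then show ?thesis by (simp add: emeasure_eq_measure zero_less_measure_iff)
qed

lemma isCont_cdf_std_normal: "isCont (cdf std_normal_distribution) x"
proof -
  interpret real_distribution std_normal_distribution by (rule real_dist_normal_dist)
  have "AE y in lborel. y \<noteq> x" by (rule AE_lborel_singleton)
  then have "AE y in lborel. y \<in> {x} \<longrightarrow> ennreal (std_normal_density y) = 0"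
    by eventually_elim simp
  then have "{x} \<in> null_sets std_normal_distribution"
    by (subst null_sets_density_iff) simp_all
  then have "emeasure std_normal_distribution {x} = 0" by auto
  then show ?thesis by (simp add: isCont_cdf measure_def)
qed

text \<open>
  The shift reconciles walks whose first step has index \<open>1\<close> with the central limit theorem, whose sums
  start at index \<open>0\<close>.
\<close>

lemma indep_vars_PiM_shifted_coordinates:
  assumes "prob_space T" and [measurable_cong]: "sets T = sets borel"
  shows "prob_space.indep_vars (PiM UNIV (\<lambda>_::nat. T)) (\<lambda>_. borel) (\<lambda>i z. z (Suc i)) UNIV"
    and "distr (PiM UNIV (\<lambda>_::nat. T)) borel (\<lambda>z. z i) = T"
proof -
  interpret T: prob_space T by fact
  let ?Z = "PiM UNIV (\<lambda>_::nat. T)"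
  interpret Z: prob_space ?Z by (intro prob_space_PiM) (rule assms)
  have comp: "distr ?Z borel (\<lambda>z. z i) = T" for i
  proof -
    have "distr ?Z borel (\<lambda>z. z i) = distr ?Z T (\<lambda>z. z i)"
      by (intro distr_cong) (auto simp: assms)
    also have "\<dots> = T" by (intro distr_PiM_component assms) auto
    finally show ?thesis .
  qed
  then show "distr ?Z borel (\<lambda>z. z i) = T" .
  have "distr ?Z (PiM UNIV (\<lambda>_. borel)) (\<lambda>z. \<lambda>i\<in>UNIV. z (Suc i))
      = distr ?Z ?Z (\<lambda>z. \<lambda>i\<in>UNIV. z (Suc i))"
    by (intro distr_cong refl sets_PiM_cong) (auto simp: assms)
  also have "\<dots> = ?Z"
    using distr_PiM_reindex[of UNIV "\<lambda>_. T" Suc UNIV] assms by simp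
  finally show "Z.indep_vars (\<lambda>_. borel) (\<lambda>i z. z (Suc i)) UNIV"
    by (subst Z.indep_vars_iff_distr_eq_PiM) (auto simp: comp)
qed

text \<open>
  Chernoff's bound \<open>exp (-g y)\<close> is sharp up to a factor \<open>exp (O(sqrt k))\<close> with an arbitrarily small
  constant. Under the tilted law the sum has mean \<open>k v\<close> and is asymptotically normal, so it lies in
  the strip between \<open>k v - b sqrt k\<close> and \<open>k v - a sqrt k\<close> with a probability bounded away from
  \<open>0\<close>; on the strip the density of the tilted law is at most \<open>exp (g (k v - a sqrt k))\<close>. A strip below
  the mean is used because there the loss \<open>b sqrt k\<close> in level pays for a gain
  \<open>exp (g a sqrt k)\<close> in probability.
\<close>

lemma tilted_large_deviation_lower_bound:
  fixes \<nu> :: "real measure" and g v :: real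
  assumes "prob_space \<nu>" and sets_\<nu>[measurable_cong]: "sets \<nu> = sets borel"
    and g: "0 < g" and e1: "integral\<^sup>L \<nu> (\<lambda>y. exp (g * y)) = 1"
    and i1: "integrable \<nu> (\<lambda>y. y * exp (g * y))" and v: "v = integral\<^sup>L \<nu> (\<lambda>y. y * exp (g * y))"
    and i2: "integrable \<nu> (\<lambda>y. y\<^sup>2 * exp (g * y))"
    and nondeg: "\<not> (AE y in \<nu>. y = v)"
    and ab: "0 < a" "a < (b::real)"
  shows "\<exists>p>0. \<forall>\<^sub>F k in sequentially. p * exp (- g * (k * v - a * sqrt k)) \<le>
     measure (PiM {1..k} (\<lambda>_. \<nu>)) {z \<in> space (PiM {1..k} (\<lambda>_. \<nu>)). k * v - b * sqrt k \<le> (\<Sum>j=1..k. z j)}"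
proof -
  interpret N: prob_space \<nu> by fact
  \<comment> \<open>The tilted law; it has total mass \<open>1\<close> by the choice of \<open>g\<close>.\<close>
  define T where "T = density \<nu> (\<lambda>y. ennreal (exp (g * y)))"
  have i0: "integrable \<nu> (\<lambda>y. exp (g * y))"
    using e1 not_integrable_integral_eq by fastforce
  have "emeasure T (space T) = 1"
    unfolding T_def using i0 e1
    by (simp add: emeasure_density nn_integral_eq_integral cong: nn_integral_cong_simp)
  then interpret T: prob_space T by (rule prob_spaceI)
  have sets_T[measurable_cong]: "sets T = sets borel" by (simp add: T_def sets_\<nu>)
  have int_T: "integral\<^sup>L T f = integral\<^sup>L \<nu> (\<lambda>y. exp (g * y) * f y)"
    if [measurable]: "f \<in> borel_measurable borel" for f :: "real \<Rightarrow> real"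
    unfolding T_def by (subst integral_density) auto
  have integrable_T: "integrable T f \<longleftrightarrow> integrable \<nu> (\<lambda>y. exp (g * y) * f y)"
    if [measurable]: "f \<in> borel_measurable borel" for f :: "real \<Rightarrow> real"
    unfolding T_def by (subst integrable_density) auto
  have T1: "integrable T (\<lambda>y. y)" and T2: "integrable T (\<lambda>y. y\<^sup>2)" and Tv: "integral\<^sup>L T (\<lambda>y. y) = v"
    using i1 i2 v by (simp_all add: int_T integrable_T mult.commute)
  have T2': "integrable T (\<lambda>y. (y - v)\<^sup>2)"
    using T1 T2 by (simp add: power2_diff)
  define s where "s = sqrt (integral\<^sup>L T (\<lambda>y. (y - v)\<^sup>2))"
  have "integral\<^sup>L T (\<lambda>y. (y - v)\<^sup>2) \<noteq> 0"
  proof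
    assume "integral\<^sup>L T (\<lambda>y. (y - v)\<^sup>2) = 0"
    then have "AE y in T. (y - v)\<^sup>2 = 0"
      using integral_nonneg_eq_0_iff_AE[OF T2'] by simp
    then have "AE y in T. y = v" by simp
    then have "AE y in \<nu>. y = v" unfolding T_def by (subst (asm) AE_density) auto
    then show False using nondeg by simp
  qed
  then have var: "integral\<^sup>L T (\<lambda>y. (y - v)\<^sup>2) = s\<^sup>2" and s: "0 < s"
    by (simp_all add: s_def order_less_le)
  define Z where "Z = PiM UNIV (\<lambda>_::nat. T)"
  interpret Z: prob_space Z unfolding Z_def by (intro prob_space_PiM) (rule T.prob_space_axioms)
  have sets_Z[measurable_cong]: "sets Z = sets (PiM UNIV (\<lambda>_. borel))"
    unfolding Z_def by (intro sets_PiM_cong) (auto simp: sets_T)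
  have comp: "distr Z borel (\<lambda>z. z i) = T" for i
    unfolding Z_def by (rule indep_vars_PiM_shifted_coordinates) (rule T.prob_space_axioms sets_T)+
  have tr: "integral\<^sup>L Z (\<lambda>z. f (z i)) = integral\<^sup>L T f"
    if [measurable]: "f \<in> borel_measurable borel" for f :: "real \<Rightarrow> real" and i
    by (subst comp[symmetric, of i]) (simp add: integral_distr)
  have "integrable Z (\<lambda>z. (z i)\<^sup>2)" for i
    using T2 by (subst (asm) comp[symmetric, of i]) (simp add: integrable_distr_eq)
  moreover have "Z.expectation (\<lambda>z. z i) = v" for i using tr[of "\<lambda>y. y" i] Tv by simp
  moreover have "Z.expectation (\<lambda>z. (z i - v)\<^sup>2) = s\<^sup>2" for i using tr[of "\<lambda>y. (y - v)\<^sup>2" i] var by simp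
  ultimately have clt: "weak_conv_m (\<lambda>n. distr Z borel (\<lambda>z. (\<Sum>i<n. z (Suc i) - v) / sqrt (n * s\<^sup>2)))
      std_normal_distribution"
    by (intro Z.central_limit_theorem[where m = v and \<mu> = T, OF _ _ s])
       (auto simp: comp intro!: indep_vars_PiM_shifted_coordinates(1)[of T, folded Z_def] T.prob_space_axioms sets_T)
  define F where "F n = cdf (distr Z borel (\<lambda>z. (\<Sum>i<n. z (Suc i) - v) / sqrt (n * s\<^sup>2)))" for n
  interpret SN: real_distribution std_normal_distribution by (rule real_dist_normal_dist)
  interpret D: real_distribution "distr Z borel (\<lambda>z. (\<Sum>i<n. z (Suc i) - v) / sqrt (n * s\<^sup>2))" for n
    by (rule Z.real_distribution_distr) simp
  have lim: "(\<lambda>n. F n x) \<longlonglongrightarrow> cdf std_normal_distribution x" for x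
    using clt unfolding weak_conv_m_def weak_conv_def F_def by (auto simp: isCont_cdf_std_normal)
  define q where "q = measure std_normal_distribution {- b / s<..- a / s}"
  have le: "- b / s < - a / s" using ab s by (simp add: divide_strict_right_mono)
  have q: "0 < q" unfolding q_def by (rule std_normal_interval_pos[OF le])
  have "(\<lambda>n. F n (- a / s) - F n (- b / s)) \<longlonglongrightarrow> q"
    unfolding q_def SN.cdf_diff_eq[OF le, symmetric] by (intro tendsto_diff lim)
  then have "\<forall>\<^sub>F n in sequentially. q / 2 < F n (- a / s) - F n (- b / s)"
    using q by (intro order_tendstoD(1)) auto
  moreover have "\<forall>\<^sub>F n::nat in sequentially. 0 < n" by (rule eventually_gt_at_top)
  ultimately have "\<forall>\<^sub>F k in sequentially. q / 2 * exp (- g * (k * v - a * sqrt k)) \<le>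
     measure (PiM {1..k} (\<lambda>_. \<nu>)) {z \<in> space (PiM {1..k} (\<lambda>_. \<nu>)). k * v - b * sqrt k \<le> (\<Sum>j=1..k. z j)}"
  proof eventually_elim
    case (elim k)
    let ?PN = "PiM {1..k} (\<lambda>_. \<nu>)" and ?PT = "PiM {1..k} (\<lambda>_. T)"
    interpret PN: prob_space ?PN by (intro prob_space_PiM) (rule N.prob_space_axioms)
    interpret PT: prob_space ?PT by (intro prob_space_PiM) (rule T.prob_space_axioms)
    have sets_PN[measurable_cong]: "sets ?PN = sets (PiM {1..k} (\<lambda>_. borel))"
      by (intro sets_PiM_cong) (auto simp: sets_\<nu>)
    have sets_PT[measurable_cong]: "sets ?PT = sets (PiM {1..k} (\<lambda>_. borel))"
      by (intro sets_PiM_cong) (auto simp: sets_T)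
    have sp: "space ?PT = space ?PN"
      using sets_PN sets_PT sets_eq_imp_space_eq by metis
    define B where "B = {z \<in> space ?PN. k * v - b * sqrt k \<le> (\<Sum>j=1..k. z j) \<and> (\<Sum>j=1..k. z j) \<le> k * v - a * sqrt k}"
    have BN[measurable]: "B \<in> sets ?PN"
      unfolding B_def by measurable
    have "sets ?PT = sets ?PN" unfolding sets_PT sets_PN ..
    with BN have BT[measurable]: "B \<in> sets ?PT" by blast
    have Z_B: "(\<lambda>z. \<lambda>j\<in>{1..k}. z j) -` B \<inter> space Z \<in> sets Z"
      by measurable
    have "F k (- a / s) - F k (- b / s) = measure (distr Z borel (\<lambda>z. (\<Sum>i<k. z (Suc i) - v) / sqrt (k * s\<^sup>2))) {- b / s<..- a / s}"
      unfolding F_def by (rule D.cdf_diff_eq[OF le])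
    also have "\<dots> = Z.prob {z \<in> space Z. (\<Sum>i<k. z (Suc i) - v) / sqrt (k * s\<^sup>2) \<in> {- b / s<..- a / s}}"
      by (subst measure_distr) (auto intro!: arg_cong[where f = "measure Z"])
    also have "\<dots> \<le> Z.prob ((\<lambda>z. \<lambda>j\<in>{1..k}. z j) -` B \<inter> space Z)"
    proof (rule Z.finite_measure_mono[OF _ Z_B], rule subsetI)
      fix z assume "z \<in> {z \<in> space Z. (\<Sum>i<k. z (Suc i) - v) / sqrt (k * s\<^sup>2) \<in> {- b / s<..- a / s}}"
      then have z: "(\<Sum>i<k. z (Suc i) - v) / sqrt (k * s\<^sup>2) \<in> {- b / s<..- a / s}" "z \<in> space Z" by auto
      have "(\<Sum>i<k. z (Suc i) - v) = (\<Sum>j=1..k. z j) - k * v"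
        by (simp add: sum_subtractf sum.atLeast1_atMost_eq)
      moreover have "sqrt (k * s\<^sup>2) = sqrt k * s" using s by (simp add: real_sqrt_mult)
      ultimately have "- b / s < ((\<Sum>j=1..k. z j) - k * v) / (sqrt k * s)"
        "((\<Sum>j=1..k. z j) - k * v) / (sqrt k * s) \<le> - a / s" using z by auto
      moreover have "0 < sqrt k * s" using elim(2) s by simp
      ultimately have "- b / s * (sqrt k * s) < (\<Sum>j=1..k. z j) - k * v"
        "(\<Sum>j=1..k. z j) - k * v \<le> - a / s * (sqrt k * s)"
        by (simp_all only: pos_less_divide_eq pos_divide_le_eq)
      then have "(\<lambda>j\<in>{1..k}. z j) \<in> B"
        using s unfolding B_def
        by (auto simp: space_PiM sets_eq_imp_space_eq[OF sets_\<nu>])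
      with z(2) show "z \<in> (\<lambda>z. \<lambda>j\<in>{1..k}. z j) -` B \<inter> space Z" by simp
    qed
    also have "\<dots> = measure (distr Z ?PT (\<lambda>z. \<lambda>j\<in>{1..k}. z j)) B"
      by (rule measure_distr[symmetric, OF _ BT]) measurable
    also have "distr Z ?PT (\<lambda>z. \<lambda>j\<in>{1..k}. z j) = ?PT"
      unfolding Z_def by (intro distr_PiM_reindex T.prob_space_axioms) auto
    also have "measure ?PT B \<le> exp (g * (k * v - a * sqrt k)) * measure ?PN B"
    proof -
      have PT: "?PT = density ?PN (\<lambda>z. ennreal (exp (g * (\<Sum>j\<in>{1..k}. z j))))"
        unfolding T_def by (intro PiM_density_exp N.prob_space_axioms sets_\<nu> T.prob_space_axioms[unfolded T_def]) auto
      have "emeasure ?PT B = (\<integral>\<^sup>+z. ennreal (exp (g * (\<Sum>j\<in>{1..k}. z j))) * indicator B z \<partial>?PN)"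
        unfolding PT by (rule emeasure_density) measurable
      also have "\<dots> \<le> (\<integral>\<^sup>+z. ennreal (exp (g * (k * v - a * sqrt k))) * indicator B z \<partial>?PN)"
        using g by (intro nn_integral_mono) (auto simp: B_def intro!: ennreal_leI split: split_indicator)
      also have "\<dots> = ennreal (exp (g * (k * v - a * sqrt k))) * emeasure ?PN B"
        by (rule nn_integral_cmult_indicator[OF BN])
      finally show ?thesis
        by (simp add: PT.emeasure_eq_measure PN.emeasure_eq_measure ennreal_mult[symmetric] del: One_nat_def)
    qed
    finally have "q / 2 \<le> exp (g * (k * v - a * sqrt k)) * measure ?PN B"
      using elim(1) by linarith
    moreover have "exp (- g * (k * v - a * sqrt k)) = 1 / exp (g * (k * v - a * sqrt k))"
      by (simp add: exp_minus inverse_eq_divide)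
    ultimately have "q / 2 * exp (- g * (k * v - a * sqrt k)) \<le> measure ?PN B"
      by (simp add: pos_divide_le_eq mult.commute del: One_nat_def)
    also have "\<dots> \<le> measure ?PN {z \<in> space ?PN. k * v - b * sqrt k \<le> (\<Sum>j=1..k. z j)}"
      by (intro PN.finite_measure_mono) (auto simp: B_def)
    finally show ?case .
  qed
  then show ?thesis using q by (intro exI[of _ "q / 2"]) auto
qed

section \<open>Weak convergence from distribution functions\<close>

text \<open>
  Pointwise convergence of monotone functions to a function that is continuous at \<open>y\<close> tolerates
  arguments that converge to \<open>y\<close>; this absorbs the normalisation by \<open>sqrt (l N)\<close> in place of
  \<open>sqrt (k N)\<close> below.
\<close>

lemma tendsto_mono_moving_argument:
  fixes F :: "nat \<Rightarrow> real \<Rightarrow> real"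
  assumes mono: "\<And>n. mono (F n)" and lim: "\<And>x. (\<lambda>n. F n x) \<longlonglongrightarrow> G x" and cont: "isCont G y"
    and k: "filterlim k sequentially sequentially" and yN: "yN \<longlonglongrightarrow> y"
  shows "(\<lambda>N. F (k N) (yN N)) \<longlonglongrightarrow> G y"
proof (rule LIMSEQ_I)
  fix e :: real assume "0 < e"
  then obtain d where "0 < d" and d: "\<And>x. \<bar>x - y\<bar> < d \<Longrightarrow> \<bar>G x - G y\<bar> < e / 2"
    using cont unfolding isCont_def LIM_eq by (force simp: dest: spec[of _ "e / 2"])
  have lim': "(\<lambda>N. F (k N) x) \<longlonglongrightarrow> G x" for x
    by (rule filterlim_compose[OF lim k])
  have "\<forall>\<^sub>F N in sequentially. \<bar>yN N - y\<bar> < d / 2"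
    using tendstoD[OF yN, of "d / 2"] \<open>0 < d\<close> by (simp add: dist_real_def)
  moreover have "\<forall>\<^sub>F N in sequentially. F (k N) (y + d / 2) < G (y + d / 2) + e / 2"
    using \<open>0 < e\<close> by (intro order_tendstoD(2)[OF lim']) auto
  moreover have "\<forall>\<^sub>F N in sequentially. G (y - d / 2) - e / 2 < F (k N) (y - d / 2)"
    using \<open>0 < e\<close> by (intro order_tendstoD(1)[OF lim']) auto
  ultimately have "\<forall>\<^sub>F N in sequentially. norm (F (k N) (yN N) - G y) < e"
  proof eventually_elim
    case (elim N)
    have "F (k N) (y - d / 2) \<le> F (k N) (yN N)" "F (k N) (yN N) \<le> F (k N) (y + d / 2)"
      using elim(1) by (intro monoD[OF mono]; simp only: abs_if field_simps split: if_splits; linarith)+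
    moreover have "\<bar>G (y + d / 2) - G y\<bar> < e / 2" "\<bar>G (y - d / 2) - G y\<bar> < e / 2"
      using d[of "y + d / 2"] d[of "y - d / 2"] \<open>0 < d\<close> by auto
    ultimately show ?case using elim by (auto simp: abs_if split: if_splits)
  qed
  then show "\<exists>no. \<forall>n\<ge>no. norm (F (k n) (yN n) - G y) < e"
    by (simp add: eventually_sequentially)
qed

text \<open>
  A shift \<open>\<eta>\<close> is harmless in the limit because \<open>x - \<eta>\<close> and \<open>x + \<eta>\<close> are continuity points for all
  but countably many \<open>\<eta>\<close>. The two bounding sequences may differ, as they do for the two deviation
  bounds of the queue.
\<close>

lemma weak_conv_m_sandwich:
  assumes D: "real_distribution D" and "weak_conv_m F1 D" "weak_conv_m F2 D"
    and lower: "\<And>x \<eta>. 0 < \<eta> \<Longrightarrow> \<exists>e. e \<longlonglongrightarrow> 0 \<and>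
        (\<forall>\<^sub>F N in sequentially. cdf (F1 N) (x - \<eta>) - e N \<le> cdf (G N) x)"
    and upper: "\<And>x \<eta>. 0 < \<eta> \<Longrightarrow> \<exists>e. e \<longlonglongrightarrow> 0 \<and>
        (\<forall>\<^sub>F N in sequentially. cdf (G N) x \<le> cdf (F2 N) (x + \<eta>) + e N)"
  shows "weak_conv_m G D"
  unfolding weak_conv_m_def weak_conv_def
proof (intro allI impI LIMSEQ_I)
  fix x e :: real assume cont: "isCont (cdf D) x" and "0 < e"
  interpret D: real_distribution D by (rule D)
  obtain d where "0 < d" and d: "\<And>z. \<bar>z - x\<bar> < d \<Longrightarrow> \<bar>cdf D z - cdf D x\<bar> < e / 2"
    using cont \<open>0 < e\<close> unfolding isCont_def LIM_eq by (force simp: dest: spec[of _ "e / 2"])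
  \<comment> \<open>The atoms of the limit, which are to be avoided by both shifted arguments.\<close>
  define B where "B = {z. measure D {z} > 0}"
  have "countable ((\<lambda>z. x - z) ` B \<union> (\<lambda>z. z - x) ` B)"
    using D.countable_atoms by (auto simp: B_def)
  moreover have "{0<..<d} \<noteq> {}" "open {0<..<d}" using \<open>0 < d\<close> by auto
  ultimately obtain \<eta> where \<eta>: "\<eta> \<in> {0<..<d}" "\<eta> \<notin> (\<lambda>z. x - z) ` B \<union> (\<lambda>z. z - x) ` B"
    using open_minus_countable by blast
  have "x - \<eta> \<notin> B"
  proof
    assume "x - \<eta> \<in> B"
    then have "x - (x - \<eta>) \<in> (\<lambda>z. x - z) ` B" by (rule imageI)
    then show False using \<eta>(2) by simp
  qed
  moreover have "x + \<eta> \<notin> B"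
  proof
    assume "x + \<eta> \<in> B"
    then have "(x + \<eta>) - x \<in> (\<lambda>z. z - x) ` B" by (rule imageI)
    then show False using \<eta>(2) by simp
  qed
  ultimately have c: "isCont (cdf D) (x - \<eta>)" "isCont (cdf D) (x + \<eta>)"
    by (auto simp: D.isCont_cdf B_def order_less_le)
  have near: "\<bar>cdf D (x - \<eta>) - cdf D x\<bar> < e / 2" "\<bar>cdf D (x + \<eta>) - cdf D x\<bar> < e / 2"
    using d[of "x - \<eta>"] d[of "x + \<eta>"] \<eta>(1) by auto
  obtain e1 where e1: "e1 \<longlonglongrightarrow> 0"
    "\<forall>\<^sub>F N in sequentially. cdf (F1 N) (x - \<eta>) - e1 N \<le> cdf (G N) x" using lower \<eta> by force
  obtain e2 where e2: "e2 \<longlonglongrightarrow> 0"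
    "\<forall>\<^sub>F N in sequentially. cdf (G N) x \<le> cdf (F2 N) (x + \<eta>) + e2 N" using upper \<eta> by force
  have "(\<lambda>N. cdf (F1 N) (x - \<eta>) - e1 N) \<longlonglongrightarrow> cdf D (x - \<eta>) - 0"
    using assms(2) c(1) unfolding weak_conv_m_def weak_conv_def by (intro tendsto_diff e1) auto
  then have "\<forall>\<^sub>F N in sequentially. cdf D (x - \<eta>) - e / 2 < cdf (F1 N) (x - \<eta>) - e1 N"
    using \<open>0 < e\<close> by (intro order_tendstoD(1)) auto
  moreover have "(\<lambda>N. cdf (F2 N) (x + \<eta>) + e2 N) \<longlonglongrightarrow> cdf D (x + \<eta>) + 0"
    using assms(3) c(2) unfolding weak_conv_m_def weak_conv_def by (intro tendsto_add e2) auto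
  then have "\<forall>\<^sub>F N in sequentially. cdf (F2 N) (x + \<eta>) + e2 N < cdf D (x + \<eta>) + e / 2"
    using \<open>0 < e\<close> by (intro order_tendstoD(2)) auto
  ultimately have "\<forall>\<^sub>F N in sequentially. norm (cdf (G N) x - cdf D x) < e"
    using e1(2) e2(2)
    by eventually_elim (use near in \<open>auto simp: abs_if split: if_splits\<close>)
  then show "\<exists>no. \<forall>n\<ge>no. norm (cdf (G n) x - cdf D x) < e"
    by (simp add: eventually_sequentially)
qed

text \<open>
  The factor \<open>sqrt \<kappa>\<close> is the limit of the ratio of the two normalisations \<open>sqrt (k N)\<close> and
  \<open>sqrt (l N)\<close>. For \<open>\<sigma> = 0\<close>, where the classical theorem does not apply, both sides are concentrated
  at \<open>0\<close>.
\<close>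

lemma (in prob_space) central_limit_along_sequence:
  fixes As :: "nat \<Rightarrow> 'a \<Rightarrow> real" and A :: "'a \<Rightarrow> real" and k :: "nat \<Rightarrow> nat" and l :: "nat \<Rightarrow> real"
  assumes ind: "indep_vars (\<lambda>_. borel) As {1..}"
    and A[measurable]: "A \<in> borel_measurable M" and i2: "integrable M (\<lambda>x. (A x)\<^sup>2)"
    and law: "\<And>j. 1 \<le> j \<Longrightarrow> distr M borel (As j) = distr M borel A"
    and \<sigma>: "0 \<le> \<sigma>" "variance A = \<sigma>\<^sup>2"
    and P: "prob_space P" and X: "distributed P lborel X std_normal_density"
    and l: "filterlim l at_top sequentially" and \<kappa>: "0 < \<kappa>" "(\<lambda>N. k N / l N) \<longlonglongrightarrow> \<kappa>"
  shows "weak_conv_m (\<lambda>N. distr M borel (\<lambda>\<omega>. (\<Sum>j=1..k N. expectation A - As j \<omega>) / sqrt (l N)))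
     (distr P borel (\<lambda>\<omega>. \<sigma> * sqrt \<kappa> * X \<omega>))"
proof -
  interpret P: prob_space P by (rule P)
  define m where "m = expectation A"
  have As[measurable]: "As j \<in> borel_measurable M" if "1 \<le> j" for j
    using ind that by (auto simp: indep_vars_def)
  have X'[measurable]: "X \<in> borel_measurable P" using X by (auto simp: distributed_def)
  have lawX: "distr P borel X = std_normal_distribution"
    using X unfolding distributed_def by (metis distr_cong sets_lborel)
  have i1: "integrable M A" by (rule square_integrable_imp_integrable[OF _ i2]) simp
  have tr: "expectation (\<lambda>x. f (As j x)) = expectation (\<lambda>x. f (A x))"
      "integrable M (\<lambda>x. f (As j x)) = integrable M (\<lambda>x. f (A x))"
    if "1 \<le> j" and [measurable]: "f \<in> borel_measurable borel" for f :: "real \<Rightarrow> real" and j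
    using law[OF that(1)] integral_distr[of "As j" M borel f] integral_distr[of A M borel f]
      integrable_distr_eq[of "As j" M borel f] integrable_distr_eq[of A M borel f] that(1) by simp_all
  show ?thesis
  proof (cases "\<sigma> = 0")
    case True
    have "AE x in M. As j x = m" if "1 \<le> j" for j
    proof -
      have "integrable M (\<lambda>x. (A x - m)\<^sup>2)" using i1 i2 by (simp add: power2_diff)
      then have "integrable M (\<lambda>x. (As j x - m)\<^sup>2)" using tr(2)[OF that, of "\<lambda>y. (y - m)\<^sup>2"] by simp
      moreover have "expectation (\<lambda>x. (As j x - m)\<^sup>2) = 0"
        using tr(1)[OF that, of "\<lambda>y. (y - m)\<^sup>2"] True \<sigma>(2) by (simp add: m_def)
      ultimately have "AE x in M. (As j x - m)\<^sup>2 = 0"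
        using integral_nonneg_eq_0_iff_AE[of M "\<lambda>x. (As j x - m)\<^sup>2"] by simp
      then show ?thesis by simp
    qed
    then have all: "AE x in M. \<forall>j\<in>{1..k N}. As j x = m" for N
      by (intro AE_finite_allI) auto
    have z: "AE x in M. (\<Sum>j=1..k N. m - As j x) / sqrt (l N) = 0" for N
      using all[of N] by eventually_elim simp
    have meas[measurable]: "(\<lambda>x. (\<Sum>j=1..k N. m - As j x) / sqrt (l N)) \<in> borel_measurable M" for N
      by measurable
    have "distr M borel (\<lambda>x. (\<Sum>j=1..k N. m - As j x) / sqrt (l N)) = distr M borel (\<lambda>_. 0)" for N
      by (intro distr_cong_AE refl z) auto
    moreover have "distr M borel (\<lambda>_. 0::real) = distr P borel (\<lambda>_. 0)"
    proof (rule measure_eqI)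
      fix B :: "real set" assume "B \<in> sets (distr M borel (\<lambda>_. 0))"
      then have "B \<in> sets borel" by simp
      then show "emeasure (distr M borel (\<lambda>_. 0)) B = emeasure (distr P borel (\<lambda>_. 0)) B"
        by (cases "0 \<in> B") (simp_all add: emeasure_distr emeasure_space_1 P.emeasure_space_1)
    qed simp
    ultimately show ?thesis
      using True by (simp add: m_def weak_conv_m_def weak_conv_def)
  next
    case False
    then have \<sigma>0: "0 < \<sigma>" using \<sigma> by simp
    have ind': "indep_vars (\<lambda>_. borel) (\<lambda>i x. - As (Suc i) x) UNIV"
    proof -
      have "indep_vars (\<lambda>_. borel) (\<lambda>i. As (Suc i)) UNIV"
        by (rule indep_vars_reindex[OF ind]) auto
      then show ?thesis by (rule indep_vars_compose2) simp
    qed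
    define F where "F n = cdf (distr M borel (\<lambda>x. (\<Sum>i<n. - As (Suc i) x - (- m)) / sqrt (n * \<sigma>\<^sup>2)))" for n
    have "weak_conv_m (\<lambda>n. distr M borel (\<lambda>x. (\<Sum>i<n. - As (Suc i) x - (- m)) / sqrt (n * \<sigma>\<^sup>2)))
        std_normal_distribution"
    proof (rule central_limit_theorem[OF ind' _ \<sigma>0])
      fix n
      show "expectation (\<lambda>x. - As (Suc n) x) = - m"
        using tr(1)[of "Suc n" "\<lambda>y. - y"] by (simp add: m_def)
      then show "variance (\<lambda>x. - As (Suc n) x) = \<sigma>\<^sup>2"
        using tr(1)[of "Suc n" "\<lambda>y. (m - y)\<^sup>2"] \<sigma>(2) by (simp add: m_def power2_commute add.commute)
      show "integrable M (\<lambda>x. (- As (Suc n) x)\<^sup>2)"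
        using tr(2)[of "Suc n" "\<lambda>y. y\<^sup>2"] i2 by simp
      have "distr M borel (\<lambda>x. - As (Suc n) x) = distr (distr M borel (As (Suc n))) borel uminus"
        by (subst distr_distr) (auto simp: comp_def)
      then show "distr M borel (\<lambda>x. - As (Suc n) x) = distr (distr M borel A) borel uminus"
        by (simp add: law)
    qed
    then have lim: "(\<lambda>n. F n x) \<longlonglongrightarrow> cdf std_normal_distribution x" for x
      unfolding weak_conv_m_def weak_conv_def F_def by (auto simp: isCont_cdf_std_normal)
    have mono: "mono (F n)" for n
    proof -
      interpret D: real_distribution "distr M borel (\<lambda>x. (\<Sum>i<n. - As (Suc i) x - (- m)) / sqrt (n * \<sigma>\<^sup>2))"
        by (rule real_distribution_distr) simp
      show ?thesis unfolding F_def by (intro monoI D.cdf_nondecreasing)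
    qed
    have "filterlim (\<lambda>N. k N / l N * l N) at_top sequentially"
      by (rule filterlim_tendsto_pos_mult_at_top[OF \<kappa>(2,1) l])
    moreover have lpos: "\<forall>\<^sub>F N in sequentially. 0 < l N"
      using l by (simp add: filterlim_at_top_dense)
    then have "\<forall>\<^sub>F N in sequentially. k N / l N * l N = real (k N)"
      by eventually_elim simp
    ultimately have "filterlim (\<lambda>N. real (k N)) at_top sequentially"
      by (simp cong: filterlim_cong)
    then have k: "filterlim k sequentially sequentially"
      by (simp add: filterlim_real_sequentially filterlim_sequentially_iff_filterlim_real)
    have kpos: "\<forall>\<^sub>F N in sequentially. 0 < k N"
      by (rule eventually_compose_filterlim[OF eventually_gt_at_top k])
    show ?thesis
      unfolding weak_conv_m_def weak_conv_def
    proof (intro allI impI)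
      fix x
      define yN where "yN N = x / (\<sigma> * sqrt (k N / l N))" for N
      have "yN \<longlonglongrightarrow> x / (\<sigma> * sqrt \<kappa>)"
        unfolding yN_def using \<sigma>0 \<kappa> by (intro tendsto_intros) auto
      then have "(\<lambda>N. F (k N) (yN N)) \<longlonglongrightarrow> cdf std_normal_distribution (x / (\<sigma> * sqrt \<kappa>))"
        by (intro tendsto_mono_moving_argument[OF mono lim isCont_cdf_std_normal k])
      also have "cdf std_normal_distribution (x / (\<sigma> * sqrt \<kappa>)) = cdf (distr P borel (\<lambda>\<omega>. \<sigma> * sqrt \<kappa> * X \<omega>)) x"
      proof -
        have "cdf (distr P borel (\<lambda>\<omega>. \<sigma> * sqrt \<kappa> * X \<omega>)) x = measure P {\<omega>\<in>space P. \<sigma> * sqrt \<kappa> * X \<omega> \<le> x}"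
          by (simp add: cdf_def measure_distr vimage_def Int_def conj_commute)
        also have "\<dots> = measure P {\<omega>\<in>space P. X \<omega> \<le> x / (\<sigma> * sqrt \<kappa>)}"
          using \<sigma>0 \<kappa> by (simp add: pos_le_divide_eq mult_ac)
        also have "\<dots> = cdf (distr P borel X) (x / (\<sigma> * sqrt \<kappa>))"
          by (simp add: cdf_def measure_distr vimage_def Int_def conj_commute)
        finally show ?thesis by (simp add: lawX)
      qed
      finally have "(\<lambda>N. F (k N) (yN N)) \<longlonglongrightarrow> cdf (distr P borel (\<lambda>\<omega>. \<sigma> * sqrt \<kappa> * X \<omega>)) x" .
      moreover have "\<forall>\<^sub>F N in sequentially. F (k N) (yN N) =
          cdf (distr M borel (\<lambda>\<omega>. (\<Sum>j=1..k N. expectation A - As j \<omega>) / sqrt (l N))) x"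
        using lpos kpos
      proof eventually_elim
        case (elim N)
        have eq: "(\<Sum>i<k N. - As (Suc i) \<omega> - (- m)) = (\<Sum>j=1..k N. m - As j \<omega>)" for \<omega>
          by (simp add: sum.atLeast1_atMost_eq)
        have "F (k N) (yN N) = prob {\<omega>\<in>space M. (\<Sum>j=1..k N. m - As j \<omega>) / sqrt (k N * \<sigma>\<^sup>2) \<le> yN N}"
          unfolding F_def eq by (simp add: cdf_def measure_distr vimage_def Int_def conj_commute)
        also have "\<dots> = prob {\<omega>\<in>space M. (\<Sum>j=1..k N. m - As j \<omega>) / sqrt (l N) \<le> x}"
        proof -
          have "s / sqrt (k N * \<sigma>\<^sup>2) \<le> yN N \<longleftrightarrow> s / sqrt (l N) \<le> x" for s
            using elim \<sigma>0 unfolding yN_def by (simp add: real_sqrt_mult real_sqrt_divide field_simps)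
          then show ?thesis by simp
        qed
        also have "\<dots> = cdf (distr M borel (\<lambda>\<omega>. (\<Sum>j=1..k N. m - As j \<omega>) / sqrt (l N))) x"
          by (simp add: cdf_def measure_distr vimage_def Int_def conj_commute)
        finally show ?case by (simp add: m_def)
      qed
      ultimately show "(\<lambda>N. cdf (distr M borel (\<lambda>\<omega>. (\<Sum>j=1..k N. expectation A - As j \<omega>) / sqrt (l N))) x)
          \<longlonglongrightarrow> cdf (distr P borel (\<lambda>\<omega>. \<sigma> * sqrt \<kappa> * X \<omega>)) x"
        by (rule Lim_transform_eventually)
    qed
  qed
qed

section \<open>Lindley's recursion and the steady state\<close>

lemma Max_const_plus:
  fixes f :: "'i \<Rightarrow> real"
  assumes "finite I" "I \<noteq> {}"
  shows "(MAX i\<in>I. f i + c) = (MAX i\<in>I. f i) + c"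
proof -
  have "(\<lambda>i. f i + c) ` I = (\<lambda>x. x + c) ` (f ` I)" by auto
  moreover have "mono (\<lambda>x. x + c)" by (simp add: mono_def)
  ultimately show ?thesis using assms mono_Max_commute[of "\<lambda>x. x + c" "f ` I"] by simp
qed

text \<open>
  Unrolling the recursion writes the waiting time as the maximum of the walk read backwards from
  the current task. The service time of a task is paired with the interarrival time of the next one,
  whence the two different shifts.
\<close>

lemma waiting_time_eq_Max:
  "waiting_time s a (Suc n) = (MAX k\<in>{0..n}. \<Sum>j=1..k. s (Suc n - j) - a (Suc (Suc n) - j))"
proof (induction n)
  case 0
  show ?case by simp
next
  case (Suc n)
  define t where "t n k = (\<Sum>j=1..k. s (Suc n - j) - a (Suc (Suc n) - j))" for n k
  have step: "t (Suc n) (Suc k) = t n k + (s (Suc n) - a (Suc (Suc n)))" for k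
  proof -
    have "t (Suc n) (Suc k) = (s (Suc n) - a (Suc (Suc n))) +
        (\<Sum>j=Suc 1..Suc k. s (Suc (Suc n) - j) - a (Suc (Suc (Suc n)) - j))"
      unfolding t_def by (subst sum.atLeast_Suc_atMost) auto
    then show ?thesis unfolding t_def by (subst (asm) sum.shift_bounds_cl_Suc_ivl) simp
  qed
  have "{0..Suc n} = insert 0 (Suc ` {0..n})" by (auto simp: image_Suc_atLeastAtMost)
  then have "t (Suc n) ` {0..Suc n} = insert (t (Suc n) 0) ((\<lambda>k. t (Suc n) (Suc k)) ` {0..n})"
    by (simp only: image_insert image_image)
  also have "\<dots> = insert 0 ((\<lambda>k. t n k + (s (Suc n) - a (Suc (Suc n)))) ` {0..n})"
    by (simp only: step) (simp add: t_def)
  finally have "Max (t (Suc n) ` {0..Suc n}) = max 0 (MAX k\<in>{0..n}. t n k + (s (Suc n) - a (Suc (Suc n))))"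
    by simp
  also have "\<dots> = waiting_time s a (Suc (Suc n))"
    using Max_const_plus[of "{0..n}" "t n" "s (Suc n) - a (Suc (Suc n))"] Suc.IH[folded t_def]
    by simp
  finally show ?case unfolding t_def by simp
qed

lemma continuous_on_Max_coordinates:
  fixes I :: "'i set"
  assumes "finite I" "I \<noteq> {}"
  shows "continuous_on UNIV (\<lambda>w::'i \<Rightarrow> real. MAX i\<in>I. w i)"
  using assms
proof (induction I rule: finite_ne_induct)
  case (insert i I)
  have "(\<lambda>w::'i \<Rightarrow> real. MAX i\<in>insert i I. w i) = (\<lambda>w. max (w i) (MAX i\<in>I. w i))"
    using insert by simp
  then show ?case
    using insert by (auto intro!: continuous_on_max)
qed simp

text \<open>
  The family of all service and interarrival times is independent, so its finite-dimensional laws are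
  product measures and do not change under a permutation of the tasks.
\<close>

locale fork_join_input = prob_space M for M :: "'a measure" +
  fixes Ss :: "nat \<Rightarrow> nat \<Rightarrow> 'a \<Rightarrow> real" and As :: "nat \<Rightarrow> 'a \<Rightarrow> real"
    and S A :: "'a \<Rightarrow> real"
  assumes ind: "indep_vars (\<lambda>_. borel) (case_sum (\<lambda>(i, j). Ss i j) As) (({1..} \<times> {1..}) <+> {1..})"
    and lawS: "\<And>i j. 1 \<le> i \<Longrightarrow> 1 \<le> j \<Longrightarrow> distr M borel (Ss i j) = distr M borel S"
    and lawA: "\<And>j. 1 \<le> j \<Longrightarrow> distr M borel (As j) = distr M borel A"
begin

lemma measurable_service [measurable]: "1 \<le> i \<Longrightarrow> 1 \<le> j \<Longrightarrow> Ss i j \<in> borel_measurable M"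
  using ind unfolding indep_vars_def by (auto dest!: bspec[of _ _ "Inl (i, j)"])

lemma measurable_arrival [measurable]: "1 \<le> j \<Longrightarrow> As j \<in> borel_measurable M"
  using ind unfolding indep_vars_def by (auto dest!: bspec[of _ _ "Inr j"])

text \<open>
  Time reversal. The reversed and the original family of times have the same product law, and
  both maxima are the same function of the respective family. The equality holds jointly in the queues
  since the reversal acts on the task index alone and thus keeps the interarrival times shared.
\<close>

lemma distr_max_waiting_time:
  assumes "1 \<le> N" "1 \<le> n"
  shows "distr M borel (\<lambda>\<omega>. MAX i\<in>{1..N}. waiting_time (\<lambda>j. Ss i j \<omega>) (\<lambda>j. As j \<omega>) (Suc n)) =
    distr M borel (\<lambda>\<omega>. MAX i\<in>{1..N}. MAX k\<in>{0..n}. \<Sum>j=1..k. Ss i j \<omega> - As j \<omega>)"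
proof -
  let ?X = "case_sum (\<lambda>(i, j). Ss i j) As"
  let ?K = "({1..} \<times> {1..}) <+> {1..} :: (nat \<times> nat + nat) set"
  define I :: "(nat \<times> nat + nat) set" where "I = ({1..N} \<times> {1..n}) <+> {1..n}"
  \<comment> \<open>The reversal. The interarrival times are shifted by one because the recursion ends with the
    interarrival time of task \<open>n + 1\<close> and does not use the first one.\<close>
  define p :: "nat \<times> nat + nat \<Rightarrow> nat \<times> nat + nat" where
    "p = case_sum (\<lambda>(i, j). Inl (i, Suc n - j)) (\<lambda>j. Inr (Suc (Suc n) - j))"
  define \<nu> where "\<nu> = case_sum (\<lambda>_::nat \<times> nat. distr M borel S) (\<lambda>_::nat. distr M borel A)"
  define h where "h z = (MAX i\<in>{1..N}. MAX k\<in>{0..n}. \<Sum>j=1..k. z (Inl (i, j)) - z (Inr j))"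
    for z :: "nat \<times> nat + nat \<Rightarrow> real"
  have I: "I \<noteq> {}" "I \<subseteq> ?K" using assms by (auto simp: I_def)
  have p: "inj_on p I" "p ` I \<subseteq> ?K"
    by (auto simp: p_def I_def inj_on_def)
  have law: "distr M borel (?X i) = \<nu> i" if "i \<in> ?K" for i
    using that lawS lawA by (auto simp: \<nu>_def)
  have \<nu>p: "\<nu> (p i) = \<nu> i" for i by (auto simp: \<nu>_def p_def split: sum.split)
  have lawp: "distr M borel (?X (p i)) = \<nu> i" if "i \<in> I" for i
  proof -
    have "p i \<in> ?K" using p(2) that by blast
    from law[OF this] show ?thesis by (simp only: \<nu>p)
  qed
  have "distr M (PiM I (\<lambda>_. borel)) (\<lambda>\<omega>. \<lambda>i\<in>I. ?X i \<omega>) = PiM I \<nu>"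
    using I law by (intro distr_indep_vars_eq_PiM indep_vars_subset[OF ind]) auto
  moreover have "distr M (PiM I (\<lambda>_. borel)) (\<lambda>\<omega>. \<lambda>i\<in>I. ?X (p i) \<omega>) = PiM I \<nu>"
    by (intro distr_indep_vars_eq_PiM indep_vars_reindex[OF ind] I(1) p lawp)
  ultimately have eq: "distr M (PiM I (\<lambda>_. borel)) (\<lambda>\<omega>. \<lambda>i\<in>I. ?X (p i) \<omega>) =
      distr M (PiM I (\<lambda>_. borel)) (\<lambda>\<omega>. \<lambda>i\<in>I. ?X i \<omega>)" by simp
  have comp: "(\<lambda>z. z (Inl (i, j)) - z (Inr j)) \<in> borel_measurable (PiM I (\<lambda>_. borel :: real measure))"
    if "1 \<le> i" "i \<le> N" "1 \<le> j" "j \<le> n" for i j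
    using that by (intro borel_measurable_diff measurable_component_singleton) (auto simp: I_def)
  have h: "h \<in> borel_measurable (PiM I (\<lambda>_. borel))"
    unfolding h_def by (intro borel_measurable_Max borel_measurable_sum comp) auto
  have rv: "(\<lambda>\<omega>. \<lambda>i\<in>I. ?X (f i) \<omega>) \<in> measurable M (PiM I (\<lambda>_. borel))"
    if "f ` I \<subseteq> ?K" for f
    using that ind by (intro measurable_restrict) (auto simp: indep_vars_def)
  have "distr M borel (\<lambda>\<omega>. h (\<lambda>i\<in>I. ?X (p i) \<omega>)) = distr (distr M (PiM I (\<lambda>_. borel)) (\<lambda>\<omega>. \<lambda>i\<in>I. ?X (p i) \<omega>)) borel h"
    using distr_distr[OF h rv[of p]] p by (simp add: comp_def)
  also have "\<dots> = distr M borel (\<lambda>\<omega>. h (\<lambda>i\<in>I. ?X i \<omega>))"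
    unfolding eq using distr_distr[OF h rv[of "\<lambda>i. i"]] I by (simp add: comp_def)
  also have "(\<lambda>\<omega>. h (\<lambda>i\<in>I. ?X i \<omega>)) = (\<lambda>\<omega>. MAX i\<in>{1..N}. MAX k\<in>{0..n}. \<Sum>j=1..k. Ss i j \<omega> - As j \<omega>)"
    unfolding h_def
    by (intro ext arg_cong[where f = Max] image_cong refl sum.cong) (auto simp: I_def)
  also have "(\<lambda>\<omega>. h (\<lambda>i\<in>I. ?X (p i) \<omega>)) =
      (\<lambda>\<omega>. MAX i\<in>{1..N}. waiting_time (\<lambda>j. Ss i j \<omega>) (\<lambda>j. As j \<omega>) (Suc n))"
    unfolding h_def waiting_time_eq_Max
    by (intro ext arg_cong[where f = Max] image_cong refl sum.cong) (auto simp: I_def p_def)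
  finally show ?thesis .
qed

lemma measurable_max_random_walk [measurable]:
  "(\<lambda>\<omega>. MAX i\<in>{1..N}. MAX k\<in>{0..n}. \<Sum>j=1..k. Ss i j \<omega> - As j \<omega>) \<in> borel_measurable M"
  by (intro borel_measurable_Max borel_measurable_sum borel_measurable_diff) auto

context
  fixes N :: nat and Q :: "'b measure" and W :: "nat \<Rightarrow> 'b \<Rightarrow> real"
  assumes N: "1 \<le> N" and steady: "steady_state_waiting_times M Ss As N Q W"
begin

text \<open>
  The bounded continuous test function \<open>cts_step a b\<close> falls from \<open>1\<close> at \<open>a\<close> to \<open>0\<close> at \<open>b\<close>; applied to
  the maximum of the coordinates it turns convergence of the vectors of waiting times into estimates of
  distribution functions.
\<close>

lemma steady_state_cts_step_tendsto:
  assumes "a < b"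
  shows "(\<lambda>n. expectation (\<lambda>\<omega>. cts_step a b (MAX i\<in>{1..N}. MAX k\<in>{0..Suc n}. \<Sum>j=1..k. Ss i j \<omega> - As j \<omega>)))
    \<longlonglongrightarrow> integral\<^sup>L Q (\<lambda>\<omega>. cts_step a b (MAX i\<in>{1..N}. W i \<omega>))"
proof -
  define f where "f w = cts_step a b (MAX i\<in>{1..N}. w i)" for w :: "nat \<Rightarrow> real"
  have cont: "continuous_on UNIV (cts_step a b)"
    by (rule uniformly_continuous_imp_continuous[OF cts_step_uniformly_continuous[OF assms]])
  then have "continuous_on UNIV f"
    unfolding f_def using N
    by (intro continuous_on_compose2[OF cont continuous_on_Max_coordinates]) auto
  moreover have "bounded (range f)"
    using assms unfolding f_def bounded_iff by (intro exI[of _ 1]) (auto simp: cts_step_def)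
  ultimately have lim: "(\<lambda>n. expectation (\<lambda>\<omega>. f (\<lambda>i\<in>{1..N}. waiting_time (\<lambda>j. Ss i j \<omega>) (\<lambda>j. As j \<omega>) n)))
      \<longlonglongrightarrow> integral\<^sup>L Q (\<lambda>\<omega>. f (\<lambda>i\<in>{1..N}. W i \<omega>))"
    using steady unfolding steady_state_waiting_times_def conv_in_distribution_def by blast
  have restr: "f (\<lambda>i\<in>{1..N}. w i) = cts_step a b (MAX i\<in>{1..N}. w i)" for w
    unfolding f_def by (intro arg_cong[where f = "\<lambda>x. cts_step a b (Max x)"] image_cong) auto
  have meas: "cts_step a b \<in> borel_measurable borel"
    using cont by (rule borel_measurable_continuous_onI)
  have E: "expectation (\<lambda>\<omega>. cts_step a b (MAX i\<in>{1..N}. waiting_time (\<lambda>j. Ss i j \<omega>) (\<lambda>j. As j \<omega>) (Suc (Suc n)))) =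
     expectation (\<lambda>\<omega>. cts_step a b (MAX i\<in>{1..N}. MAX k\<in>{0..Suc n}. \<Sum>j=1..k. Ss i j \<omega> - As j \<omega>))" for n
  proof -
    have "(\<lambda>\<omega>. MAX i\<in>{1..N}. waiting_time (\<lambda>j. Ss i j \<omega>) (\<lambda>j. As j \<omega>) (Suc (Suc n))) \<in> borel_measurable M"
      unfolding waiting_time_eq_Max
      by (intro borel_measurable_Max borel_measurable_sum borel_measurable_diff) auto
    then show ?thesis
      using distr_max_waiting_time[OF N, of "Suc n"] meas
      by (subst (1 2) integral_distr[symmetric, where N = borel and f = "cts_step a b"]) auto
  qed
  have "(\<lambda>n. expectation (\<lambda>\<omega>. f (\<lambda>i\<in>{1..N}. waiting_time (\<lambda>j. Ss i j \<omega>) (\<lambda>j. As j \<omega>) (n + 2))))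
      \<longlonglongrightarrow> integral\<^sup>L Q (\<lambda>\<omega>. f (\<lambda>i\<in>{1..N}. W i \<omega>))"
    by (rule LIMSEQ_ignore_initial_segment[OF lim])
  then show ?thesis
    by (simp only: restr E add_2_eq_Suc')
qed

text \<open>
  The finite horizon maxima increase with the horizon. A lower bound on their distribution functions
  must therefore be uniform in \<open>n\<close>, while a single time \<open>k\<close> gives an upper bound. Passing to the
  limit with a step function costs the gap between \<open>a\<close> and \<open>b\<close>.
\<close>

lemma
  assumes "a < b"
  shows steady_state_cdf_ge:
    "(\<And>n. c \<le> prob {\<omega>\<in>space M. \<forall>i\<in>{1..N}. \<forall>k\<in>{0..n}. (\<Sum>j=1..k. Ss i j \<omega> - As j \<omega>) \<le> a}) \<Longrightarrow>
      c \<le> cdf (distr Q borel (\<lambda>w. MAX i\<in>{1..N}. W i w)) b"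
    and steady_state_cdf_le:
    "cdf (distr Q borel (\<lambda>w. MAX i\<in>{1..N}. W i w)) a \<le>
      prob {\<omega>\<in>space M. \<forall>i\<in>{1..N}. (\<Sum>j=1..k. Ss i j \<omega> - As j \<omega>) \<le> b}"
proof -
  interpret Q: prob_space Q using steady unfolding steady_state_waiting_times_def by simp
  have "W i \<in> borel_measurable Q" if "i \<in> {1..N}" for i
    using steady that unfolding steady_state_waiting_times_def by blast
  then have Wmax[measurable]: "(\<lambda>w. MAX i\<in>{1..N}. W i w) \<in> borel_measurable Q"
    by (intro borel_measurable_Max) (rule finite_atLeastAtMost)
  let ?Y = "\<lambda>n \<omega>. MAX i\<in>{1..N}. MAX k\<in>{0..n}. \<Sum>j=1..k. Ss i j \<omega> - As j \<omega>"
  let ?D = "distr Q borel (\<lambda>w. MAX i\<in>{1..N}. W i w)"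
  interpret D: real_distribution ?D by (rule Q.real_distribution_distr[OF Wmax])
  interpret Y: real_distribution "distr M borel (?Y n)" for n
    by (rule real_distribution_distr[OF measurable_max_random_walk])
  have meas: "cts_step a b \<in> borel_measurable borel"
    by (intro borel_measurable_continuous_onI uniformly_continuous_imp_continuous
        cts_step_uniformly_continuous assms)
  have lim: "(\<lambda>n. integral\<^sup>L (distr M borel (?Y (Suc n))) (cts_step a b)) \<longlonglongrightarrow> integral\<^sup>L ?D (cts_step a b)"
    using steady_state_cts_step_tendsto[OF assms] meas by (simp add: integral_distr del: One_nat_def)
  have cdfY: "cdf (distr M borel (?Y n)) x =
      prob {\<omega>\<in>space M. \<forall>i\<in>{1..N}. \<forall>k\<in>{0..n}. (\<Sum>j=1..k. Ss i j \<omega> - As j \<omega>) \<le> x}" for n x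
  proof -
    have "cdf (distr M borel (?Y n)) x = prob (?Y n -` {..x} \<inter> space M)"
      unfolding cdf_def by (rule measure_distr) auto
    also have "?Y n -` {..x} \<inter> space M =
        {\<omega>\<in>space M. \<forall>i\<in>{1..N}. \<forall>k\<in>{0..n}. (\<Sum>j=1..k. Ss i j \<omega> - As j \<omega>) \<le> x}"
      using N by (auto simp: Max_le_iff)
    finally show ?thesis .
  qed
  show "c \<le> cdf ?D b"
    if "\<And>n. c \<le> prob {\<omega>\<in>space M. \<forall>i\<in>{1..N}. \<forall>k\<in>{0..n}. (\<Sum>j=1..k. Ss i j \<omega> - As j \<omega>) \<le> a}"
  proof -
    have "c \<le> integral\<^sup>L (distr M borel (?Y (Suc n))) (cts_step a b)" for n
      using that[of "Suc n"] Y.cdf_cts_step(1)[OF assms, of "Suc n"] unfolding cdfY by simp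
    then have "c \<le> integral\<^sup>L ?D (cts_step a b)"
      by (intro LIMSEQ_le_const[OF lim]) auto
    also have "\<dots> \<le> cdf ?D b" by (rule D.cdf_cts_step(2)[OF assms])
    finally show ?thesis .
  qed
  show "cdf ?D a \<le> prob {\<omega>\<in>space M. \<forall>i\<in>{1..N}. (\<Sum>j=1..k. Ss i j \<omega> - As j \<omega>) \<le> b}"
  proof -
    have "integral\<^sup>L (distr M borel (?Y (Suc n))) (cts_step a b) \<le>
        prob {\<omega>\<in>space M. \<forall>i\<in>{1..N}. (\<Sum>j=1..k. Ss i j \<omega> - As j \<omega>) \<le> b}" if "k \<le> n" for n
    proof -
      have "integral\<^sup>L (distr M borel (?Y (Suc n))) (cts_step a b) \<le> cdf (distr M borel (?Y (Suc n))) b"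
        by (rule Y.cdf_cts_step(2)[OF assms])
      also have "\<dots> \<le> prob {\<omega>\<in>space M. \<forall>i\<in>{1..N}. (\<Sum>j=1..k. Ss i j \<omega> - As j \<omega>) \<le> b}"
        unfolding cdfY using that by (intro finite_measure_mono) auto
      finally show ?thesis .
    qed
    then have "integral\<^sup>L ?D (cts_step a b) \<le> prob {\<omega>\<in>space M. \<forall>i\<in>{1..N}. (\<Sum>j=1..k. Ss i j \<omega> - As j \<omega>) \<le> b}"
      by (intro LIMSEQ_le_const2[OF lim]) auto
    with D.cdf_cts_step(1)[OF assms] show ?thesis by simp
  qed
qed

end

end

section \<open>The service and arrival random walks\<close>

text \<open>
  The data of the queue, with \<open>m\<close> for the mean interarrival time and the interior condition on \<open>\<gamma>\<close>
  in the form of two exponential moments.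
\<close>

locale fork_join_queue = fork_join_input M Ss As S A
  for M :: "'a measure" and Ss :: "nat \<Rightarrow> nat \<Rightarrow> 'a \<Rightarrow> real" and As :: "nat \<Rightarrow> 'a \<Rightarrow> real"
    and S A :: "'a \<Rightarrow> real" +
  fixes m \<gamma> r :: real
  assumes S[measurable]: "S \<in> borel_measurable M" and A[measurable]: "A \<in> borel_measurable M"
    and S_nonneg: "AE \<omega> in M. 0 \<le> S \<omega>" and A_nonneg: "AE \<omega> in M. 0 \<le> A \<omega>"
    and A_square: "integrable M (\<lambda>\<omega>. (A \<omega>)\<^sup>2)"
    and mean_A: "expectation A = m"
    and stable: "expectation (\<lambda>\<omega>. S \<omega> - m) < 0"
    and \<gamma>: "0 < \<gamma>" and r: "0 < r"
    and exp_S: "integrable M (\<lambda>\<omega>. exp ((\<gamma> + r) * (S \<omega> - m)))" "integrable M (\<lambda>\<omega>. exp ((\<gamma> - r) * (S \<omega> - m)))"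
    and root: "expectation (\<lambda>\<omega>. exp (\<gamma> * (S \<omega> - m))) = 1"
begin

definition mgf :: "real \<Rightarrow> real" where "mgf \<theta> = expectation (\<lambda>\<omega>. exp (\<theta> * (S \<omega> - m)))"

text \<open>
  The derivative \<open>\<Lambda>'(\<gamma>)\<close>, which is the mean of \<open>S - m\<close> under the tilted law.
\<close>

definition v :: real where "v = expectation (\<lambda>\<omega>. (S \<omega> - m) * exp (\<gamma> * (S \<omega> - m)))"

definition service_walk :: "nat \<Rightarrow> nat \<Rightarrow> 'a \<Rightarrow> real" where
  "service_walk i k \<omega> = (\<Sum>j=1..k. Ss i j \<omega> - m)"

text \<open>
  The sign is such that long interarrival times make the walk small: queue \<open>i\<close> is driven by
  \<open>service_walk i k + arrival_walk k\<close>.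
\<close>

definition arrival_walk :: "nat \<Rightarrow> 'a \<Rightarrow> real" where
  "arrival_walk k \<omega> = (\<Sum>j=1..k. m - As j \<omega>)"

lemma service_walk_measurable[measurable]: "1 \<le> i \<Longrightarrow> service_walk i k \<in> borel_measurable M"
  unfolding service_walk_def by measurable

lemma arrival_walk_measurable[measurable]: "arrival_walk k \<in> borel_measurable M"
  unfolding arrival_walk_def by measurable

lemma walk_eq: "(\<Sum>j=1..k. Ss i j \<omega> - As j \<omega>) = service_walk i k \<omega> + arrival_walk k \<omega>"
  unfolding service_walk_def arrival_walk_def by (simp add: sum.distrib[symmetric])

lemma service_law:
  assumes "1 \<le> i" "1 \<le> j" and [measurable]: "f \<in> borel_measurable borel"
  shows "expectation (\<lambda>\<omega>. f (Ss i j \<omega>)) = expectation (\<lambda>\<omega>. f (S \<omega>) :: real)"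
    and "integrable M (\<lambda>\<omega>. f (Ss i j \<omega>)) = integrable M (\<lambda>\<omega>. f (S \<omega>))"
  using lawS[OF assms(1,2)] integral_distr[of "Ss i j" M borel f] integral_distr[of S M borel f]
    integrable_distr_eq[of "Ss i j" M borel f] integrable_distr_eq[of S M borel f] assms(1,2) by simp_all

lemma arrival_law:
  assumes "1 \<le> j" and [measurable]: "f \<in> borel_measurable borel"
  shows "expectation (\<lambda>\<omega>. f (As j \<omega>)) = expectation (\<lambda>\<omega>. f (A \<omega>) :: real)"
    and "integrable M (\<lambda>\<omega>. f (As j \<omega>)) = integrable M (\<lambda>\<omega>. f (A \<omega>))"
  using lawA[OF assms(1)] integral_distr[of "As j" M borel f] integral_distr[of A M borel f]
    integrable_distr_eq[of "As j" M borel f] integrable_distr_eq[of A M borel f] assms(1) by simp_all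

lemma indep_services:
  assumes "1 \<le> i"
  shows "indep_vars (\<lambda>_. borel) (\<lambda>j \<omega>. Ss i j \<omega> - m) {1..k}"
proof -
  have "indep_vars (\<lambda>_. borel) (\<lambda>j. case_sum (\<lambda>(i, j). Ss i j) As (Inl (i, j))) {1..k}"
    using assms by (intro indep_vars_reindex[OF ind]) (auto simp: inj_on_def)
  then have "indep_vars (\<lambda>_. borel) (Ss i) {1..k}" by simp
  then show ?thesis by (rule indep_vars_compose2) simp
qed

lemma indep_arrivals: "indep_vars (\<lambda>_. borel) As {1..}"
proof -
  have "indep_vars (\<lambda>_. borel) (\<lambda>j. case_sum (\<lambda>(i, j). Ss i j) As (Inr j)) {1..}"
    by (intro indep_vars_reindex[OF ind]) (auto simp: inj_on_def)
  then show ?thesis by simp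
qed

lemma exp_S_integrable: "\<bar>h\<bar> \<le> r \<Longrightarrow> integrable M (\<lambda>\<omega>. exp ((\<gamma> + h) * (S \<omega> - m)))"
  by (rule integrable_exp_tilt[where Y = "\<lambda>\<omega>. S \<omega> - m", OF _ r exp_S]) auto

lemma service_chernoff:
  assumes "1 \<le> i" "0 \<le> \<theta>" "integrable M (\<lambda>\<omega>. exp (\<theta> * (S \<omega> - m)))"
  shows "prob {\<omega>\<in>space M. y \<le> service_walk i k \<omega>} \<le> exp (- \<theta> * y) * mgf \<theta> ^ k"
proof -
  have "prob {\<omega>\<in>space M. y \<le> (\<Sum>j=1..k. Ss i j \<omega> - m)} \<le> exp (- \<theta> * y) * mgf \<theta> ^ card {1..k}"
  proof (rule chernoff_bound_indep_sum[OF _ indep_services[OF assms(1)] assms(2)])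
    fix j assume "j \<in> {1..k}"
    then have j: "1 \<le> j" by simp
    show "integrable M (\<lambda>\<omega>. exp (\<theta> * (Ss i j \<omega> - m)))"
      using service_law(2)[OF assms(1) j, of "\<lambda>s. exp (\<theta> * (s - m))"] assms(3) by simp
    show "expectation (\<lambda>\<omega>. exp (\<theta> * (Ss i j \<omega> - m))) \<le> mgf \<theta>"
      using service_law(1)[OF assms(1) j, of "\<lambda>s. exp (\<theta> * (s - m))"] by (simp add: mgf_def)
  qed simp
  then show ?thesis by (simp add: service_walk_def)
qed

definition second_moment_A :: real where "second_moment_A = expectation (\<lambda>\<omega>. (A \<omega>)\<^sup>2)"

lemma second_moment_A_nonneg: "0 \<le> second_moment_A" unfolding second_moment_A_def by simp

text \<open>
  Only increases of the walk are bounded; they come from short interarrival times.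
\<close>

lemma arrival_chernoff:
  assumes "l \<le> k" "0 \<le> \<theta>"
  shows "prob {\<omega>\<in>space M. t \<le> arrival_walk k \<omega> - arrival_walk l \<omega>} \<le>
    exp (- \<theta> * t + second_moment_A * \<theta>\<^sup>2 * (real k - real l))"
proof -
  have "arrival_walk k \<omega> - arrival_walk l \<omega> = (\<Sum>j\<in>{l<..k}. m - As j \<omega>)" for \<omega>
  proof -
    have eq: "{1..k} = {1..l} \<union> {l<..k}" using assms(1) by auto
    have "(\<Sum>j\<in>{1..k}. m - As j \<omega>) = (\<Sum>j\<in>{1..l}. m - As j \<omega>) + (\<Sum>j\<in>{l<..k}. m - As j \<omega>)"
      unfolding eq by (rule sum.union_disjoint) auto
    then show ?thesis unfolding arrival_walk_def by simp
  qed
  moreover have "prob {\<omega>\<in>space M. t \<le> (\<Sum>j\<in>{l<..k}. m - As j \<omega>)} \<le>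
      exp (- \<theta> * t) * exp (\<theta>\<^sup>2 * second_moment_A) ^ card {l<..k}"
  proof (rule chernoff_bound_indep_sum[OF _ _ assms(2)])
    have "indep_vars (\<lambda>_. borel) As {l<..k}"
      by (rule indep_vars_subset[OF indep_arrivals]) auto
    then show "indep_vars (\<lambda>_. borel) (\<lambda>j \<omega>. m - As j \<omega>) {l<..k}"
      by (rule indep_vars_compose2) simp
    fix j assume "j \<in> {l<..k}"
    then have j: "1 \<le> j" by simp
    have eq: "exp (\<theta> * (m - y)) = exp (- \<theta> * (y - m))" for y by (simp add: algebra_simps)
    show "integrable M (\<lambda>\<omega>. exp (\<theta> * (m - As j \<omega>)))"
      using arrival_law(2)[OF j, of "\<lambda>s. exp (- \<theta> * (s - m))"]
        exp_neg_centered_le(1)[OF A A_nonneg A_square assms(2)] by (simp add: mean_A eq)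
    show "expectation (\<lambda>\<omega>. exp (\<theta> * (m - As j \<omega>))) \<le> exp (\<theta>\<^sup>2 * second_moment_A)"
      using arrival_law(1)[OF j, of "\<lambda>s. exp (- \<theta> * (s - m))"]
        exp_neg_centered_le(2)[OF A A_nonneg A_square assms(2)] by (simp add: mean_A eq second_moment_A_def)
  qed simp
  moreover have "exp (- \<theta> * t) * exp (\<theta>\<^sup>2 * second_moment_A) ^ card {l<..k} = exp (- \<theta> * t + second_moment_A * \<theta>\<^sup>2 * (real k - real l))"
    using assms(1) by (simp add: exp_of_nat_mult[symmetric] exp_add[symmetric] of_nat_diff algebra_simps)
  ultimately show ?thesis by simp
qed

lemma v_pos: "0 < v"
  unfolding v_def
proof (rule tilted_mean_pos[OF _ \<gamma> root _ stable])
  show "integrable M (\<lambda>\<omega>. (S \<omega> - m) * exp (\<gamma> * (S \<omega> - m)))"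
    by (rule integrable_times_exp_tilt[where Y = "\<lambda>\<omega>. S \<omega> - m", OF _ r exp_S]) auto
qed simp

lemma mgf_near_root:
  obtains C where "0 < C" "\<And>h. \<bar>h\<bar> \<le> r / 2 \<Longrightarrow> mgf (\<gamma> + h) \<le> exp (v * h + C * h\<^sup>2)"
proof -
  obtain C where "0 < C" and C: "\<And>h. \<bar>h\<bar> \<le> r / 2 \<Longrightarrow> \<bar>mgf (\<gamma> + h) - 1 - h * v\<bar> \<le> C * h\<^sup>2"
    using mgf_quadratic_bound[where Y = "\<lambda>\<omega>. S \<omega> - m", OF _ r exp_S] root
    unfolding mgf_def v_def by auto
  have "mgf (\<gamma> + h) \<le> exp (v * h + C * h\<^sup>2)" if "\<bar>h\<bar> \<le> r / 2" for h
  proof -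
    have "mgf (\<gamma> + h) \<le> 1 + (v * h + C * h\<^sup>2)" using C[OF that] by (simp add: mult.commute)
    also have "\<dots> \<le> exp (v * h + C * h\<^sup>2)" by (rule exp_ge_add_one_self)
    finally show ?thesis .
  qed
  with \<open>0 < C\<close> show ?thesis by (rule that)
qed

text \<open>
  The negative drift \<open>-\<mu>\<close> is split evenly between the two walks. At \<open>\<theta> = 0\<close> the moment generating
  function of \<open>S - m\<close> has slope \<open>-\<mu>\<close>, so a small \<open>\<theta>\<close> beats both quadratic error terms.
\<close>

lemma exponential_decay:
  obtains \<delta> d where "0 < \<delta>" "0 < d"
    "\<And>i k. 1 \<le> i \<Longrightarrow> prob {\<omega>\<in>space M. - \<delta> * k \<le> service_walk i k \<omega>} \<le> exp (- d * k)"
    "\<And>k. prob {\<omega>\<in>space M. \<delta> * k \<le> arrival_walk k \<omega>} \<le> exp (- d * k)"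
proof -
  define \<mu> where "\<mu> = - expectation (\<lambda>\<omega>. S \<omega> - m)"
  have \<mu>: "0 < \<mu>" using stable by (simp add: \<mu>_def)
  have i1: "integrable M (\<lambda>\<omega>. exp ((0 + \<gamma>) * (S \<omega> - m)))"
    using exp_S_integrable[of 0] r by simp
  have i2: "integrable M (\<lambda>\<omega>. exp ((0 - \<gamma>) * (S \<omega> - m)))"
  proof (rule integrable_const_bound[where B = "exp (\<gamma> * m)"])
    show "AE \<omega> in M. norm (exp ((0 - \<gamma>) * (S \<omega> - m))) \<le> exp (\<gamma> * m)"
      using S_nonneg by eventually_elim (use \<gamma> in \<open>simp add: algebra_simps\<close>)
  qed simp
  have Ym: "(\<lambda>\<omega>. S \<omega> - m) \<in> borel_measurable M" by simp
  note tilt0 = mgf_quadratic_bound[OF Ym \<gamma> i1 i2] integrable_exp_tilt[OF Ym \<gamma> i1 i2]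
  obtain C0 where "0 < C0" and C0: "\<And>h. \<bar>h\<bar> \<le> \<gamma> / 2 \<Longrightarrow> \<bar>mgf h - 1 + h * \<mu>\<bar> \<le> C0 * h\<^sup>2"
    using tilt0(1) unfolding mgf_def \<mu>_def by (auto simp: prob_space)
  define C1 where "C1 = C0 + second_moment_A"
  have C1: "0 < C1" "C0 \<le> C1" "second_moment_A \<le> C1" using \<open>0 < C0\<close> second_moment_A_nonneg by (auto simp: C1_def)
  \<comment> \<open>Within the range of the expansion at \<open>0\<close>, and such that each quadratic term is at most
    \<open>\<theta> \<mu> / 4\<close>, half of the linear gain \<open>\<theta> \<mu> / 2\<close>.\<close>
  define \<theta> where "\<theta> = min (\<gamma> / 2) (\<mu> / (4 * C1))"
  have \<theta>: "0 < \<theta>" "\<theta> \<le> \<gamma> / 2" "C1 * \<theta> \<le> \<mu> / 4"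
    using \<gamma> \<mu> C1 by (auto simp: \<theta>_def min_def field_simps)
  define d where "d = \<theta> * \<mu> / 4"
  have q: "C0 * \<theta>\<^sup>2 \<le> \<theta> * \<mu> / 4" "second_moment_A * \<theta>\<^sup>2 \<le> \<theta> * \<mu> / 4"
  proof -
    have "C1 * \<theta>\<^sup>2 \<le> \<theta> * \<mu> / 4"
      using mult_left_mono[OF \<theta>(3), of \<theta>] \<theta>(1) by (simp add: power2_eq_square mult_ac)
    moreover have "C0 * \<theta>\<^sup>2 \<le> C1 * \<theta>\<^sup>2" "second_moment_A * \<theta>\<^sup>2 \<le> C1 * \<theta>\<^sup>2"
      using C1 by (intro mult_right_mono; simp)+
    ultimately show "C0 * \<theta>\<^sup>2 \<le> \<theta> * \<mu> / 4" "second_moment_A * \<theta>\<^sup>2 \<le> \<theta> * \<mu> / 4" by linarith+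
  qed
  show ?thesis
  proof (rule that[of "\<mu> / 2" d])
    show "0 < \<mu> / 2" "0 < d" using \<mu> \<theta> by (auto simp: d_def)
  next
    fix i k :: nat assume i: "1 \<le> i"
    have "mgf \<theta> - 1 + \<theta> * \<mu> \<le> C0 * \<theta>\<^sup>2" using abs_le_D1[OF C0[of \<theta>]] \<theta> by simp
    then have "mgf \<theta> \<le> 1 + (- \<theta> * \<mu> + \<theta> * \<mu> / 4)"
      using q(1) unfolding mult_minus_left by linarith
    also have "\<dots> \<le> exp (- \<theta> * \<mu> + \<theta> * \<mu> / 4)" by (rule exp_ge_add_one_self)
    finally have "mgf \<theta> ^ k \<le> exp (- \<theta> * \<mu> + \<theta> * \<mu> / 4) ^ k"
      by (intro power_mono) (auto simp: mgf_def)
    also have "\<dots> = exp (k * (- \<theta> * \<mu> + \<theta> * \<mu> / 4))" by (rule exp_of_nat_mult[symmetric])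
    finally have "exp (- \<theta> * (- (\<mu> / 2) * k)) * mgf \<theta> ^ k \<le>
        exp (- \<theta> * (- (\<mu> / 2) * k)) * exp (k * (- \<theta> * \<mu> + \<theta> * \<mu> / 4))"
      by (intro mult_left_mono) auto
    also have "\<dots> = exp (- d * k)"
      unfolding exp_add[symmetric] d_def by (rule arg_cong[where f = exp]) (simp add: field_simps)
    finally show "prob {\<omega>\<in>space M. - (\<mu> / 2) * k \<le> service_walk i k \<omega>} \<le> exp (- d * k)"
      using service_chernoff[OF i, of \<theta> "- (\<mu> / 2) * k" k] tilt0(2)[of \<theta>] \<theta> by simp
  next
    fix k :: nat
    have "second_moment_A * \<theta>\<^sup>2 * (real k - real 0) \<le> \<theta> * \<mu> / 4 * k"
      using mult_right_mono[OF q(2), of "real k"] by simp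
    then have "- \<theta> * (\<mu> / 2 * k) + second_moment_A * \<theta>\<^sup>2 * (real k - real 0) \<le> - \<theta> * (\<mu> / 2 * k) + \<theta> * \<mu> / 4 * k"
      by (rule add_left_mono)
    also have "\<dots> = - d * k" by (simp add: d_def field_simps)
    finally have "exp (- \<theta> * (\<mu> / 2 * k) + second_moment_A * \<theta>\<^sup>2 * (real k - real 0)) \<le> exp (- d * k)" by simp
    moreover have "prob {\<omega>\<in>space M. \<mu> / 2 * k \<le> arrival_walk k \<omega>} \<le>
        exp (- \<theta> * (\<mu> / 2 * k) + second_moment_A * \<theta>\<^sup>2 * (real k - real 0))"
    proof -
      have "arrival_walk 0 \<omega> = 0" for \<omega> by (simp add: arrival_walk_def)
      then show ?thesis using arrival_chernoff[of 0 k \<theta> "\<mu> / 2 * k"] \<theta>(1) by simp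
    qed
    ultimately show "prob {\<omega>\<in>space M. \<mu> / 2 * k \<le> arrival_walk k \<omega>} \<le> exp (- d * k)"
      by linarith
  qed
qed

end

section \<open>No late, early or large excursions\<close>

lemma (in prob_space) prob_exists_le:
  fixes b :: real
  assumes "finite I" "\<And>i. i \<in> I \<Longrightarrow> {\<omega>\<in>space M. P i \<omega>} \<in> events"
    and "\<And>i. i \<in> I \<Longrightarrow> prob {\<omega>\<in>space M. P i \<omega>} \<le> b"
  shows "prob {\<omega>\<in>space M. \<exists>i\<in>I. P i \<omega>} \<le> card I * b"
proof -
  have "{\<omega>\<in>space M. \<exists>i\<in>I. P i \<omega>} = (\<Union>i\<in>I. {\<omega>\<in>space M. P i \<omega>})" by auto
  then have "prob {\<omega>\<in>space M. \<exists>i\<in>I. P i \<omega>} \<le> (\<Sum>i\<in>I. prob {\<omega>\<in>space M. P i \<omega>})"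
    using assms(1,2) by (auto intro!: finite_measure_subadditive_finite)
  also have "\<dots> \<le> (\<Sum>i\<in>I. b)" by (intro sum_mono assms(3))
  finally show ?thesis by simp
qed

lemma finite_nat_le_real [simp]: "finite {k::nat. real k \<le> x}"
  by (rule finite_subset[of _ "{..nat \<lfloor>x\<rfloor>}"]) (auto simp: le_nat_floor)

lemma card_nat_le_real: "0 \<le> x \<Longrightarrow> real (card {k::nat. real k \<le> x}) \<le> x + 1"
proof -
  assume "0 \<le> x"
  have "card {k::nat. real k \<le> x} \<le> card {..nat \<lfloor>x\<rfloor>}"
    by (intro card_mono) (auto simp: le_nat_floor)
  then have "real (card {k::nat. real k \<le> x}) \<le> real (nat \<lfloor>x\<rfloor>) + 1" by simp
  also have "real (nat \<lfloor>x\<rfloor>) \<le> x" using \<open>0 \<le> x\<close> by (simp add: of_nat_nat)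
  finally show ?thesis by simp
qed

lemma ln_nat_at_top: "filterlim (\<lambda>N. ln (real N)) at_top sequentially"
  by (rule filterlim_compose[OF ln_at_top filterlim_real_sequentially])

text \<open>
  All error probabilities are bounded by explicit functions of \<open>L = ln N\<close>, which are studied as
  \<open>L\<close> runs through the reals.
\<close>

lemma tendsto_zero_ln_bound:
  fixes p :: "nat \<Rightarrow> real" and f :: "real \<Rightarrow> real"
  assumes "(f \<longlongrightarrow> 0) at_top" "\<And>N. 0 \<le> p N"
    and "\<forall>\<^sub>F L in at_top. \<forall>N\<ge>1. ln (real N) = L \<longrightarrow> p N \<le> f L"
  shows "p \<longlonglongrightarrow> 0"
proof (rule tendsto_sandwich[of "\<lambda>_. 0" p sequentially "\<lambda>N. f (ln (real N))"])
  show "(\<lambda>N. f (ln (real N))) \<longlonglongrightarrow> 0" by (rule filterlim_compose[OF assms(1) ln_nat_at_top])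
  have "\<forall>\<^sub>F N in sequentially. \<forall>N'\<ge>1. ln (real N') = ln (real N) \<longrightarrow> p N' \<le> f (ln (real N))"
    by (rule eventually_compose_filterlim[OF assms(3) ln_nat_at_top])
  moreover have "\<forall>\<^sub>F N in sequentially. (1::nat) \<le> N" by (rule eventually_ge_at_top)
  ultimately show "\<forall>\<^sub>F N in sequentially. p N \<le> f (ln (real N))"
    by eventually_elim auto
qed (use assms(2) in auto)

lemma crude_bound_vanishes:
  fixes c K :: real
  assumes "0 < K" "0 \<le> c"
  shows "((\<lambda>L::real. (K*L+1) * exp (- (L powr (-1/2)) * L powr (3/5) + c * (L powr (-1/2))\<^sup>2 * (K*L))) \<longlongrightarrow> 0) at_top"
proof (cases "c = 0")
  case True
  then show ?thesis using assms by simp real_asymp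
next
  case False
  then have "0 < c" using assms by simp
  then show ?thesis using assms by real_asymp
qed

lemma window_bound_vanishes:
  fixes c K \<eta> :: real
  assumes "0 < K" "0 < \<eta>" "0 \<le> c"
  shows "((\<lambda>L::real. (K*L+1) * exp (- (L powr (-9/20)) * (\<eta> * sqrt L) + c * (L powr (-9/20))\<^sup>2 * (2 * L powr (9/10) + 1))) \<longlongrightarrow> 0) at_top"
proof (cases "c = 0")
  case True
  then show ?thesis using assms by simp real_asymp
next
  case False
  then have "0 < c" using assms by simp
  then show ?thesis using assms by real_asymp
qed

text \<open>
  The two exponents belong to the tilts \<open>\<gamma> + h\<close> and \<open>\<gamma> - h\<close>, with \<open>h\<close> equal to \<open>L\<close> to the power
  \<open>-3/20\<close>, for times before and after the window.
\<close>

lemma off_window_bounds_vanish: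
  fixes C K v \<gamma> :: real
  assumes "0 < K" "0 < C" "0 < v" "0 < \<gamma>"
  shows "((\<lambda>L::real. exp L * (K * L + 1) * exp (L powr (-3/20) * (L / \<gamma> - v * L powr (9/10)) + C * (L powr (-3/20))\<^sup>2 * (K*L)
      - (\<gamma> + L powr (-3/20)) * (L / \<gamma> - 2 * L powr (3/5)))) \<longlongrightarrow> 0) at_top"
    and "((\<lambda>L::real. exp L * (K * L + 1) * exp (- (L powr (-3/20)) * (L / \<gamma> + v * L powr (9/10)) + C * (L powr (-3/20))\<^sup>2 * (K*L)
      - (\<gamma> - L powr (-3/20)) * (L / \<gamma> - 2 * L powr (3/5)))) \<longlongrightarrow> 0) at_top"
  using assms by real_asymp+

context fork_join_queue
begin

text \<open>
  The geometric tail beyond time \<open>K ln N\<close> with \<open>K = 2/d\<close> is of order \<open>1/N\<^sup>2\<close>, which survives the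
  union over \<open>N\<close> queues. The bound does not depend on the horizon \<open>n\<close>.
\<close>

lemma late_crossings_negligible:
  obtains K e where "0 < K" "e \<longlonglongrightarrow> 0"
    "\<And>N n. 1 \<le> N \<Longrightarrow> prob {\<omega>\<in>space M. \<exists>k\<in>{k\<in>{0..n}. K * ln N < k}. \<exists>i\<in>{1..N}. 0 < service_walk i k \<omega> + arrival_walk k \<omega>} \<le> e N"
proof -
  obtain \<delta> d where \<delta>d: "0 < \<delta>" "0 < d"
    "\<And>i k. 1 \<le> i \<Longrightarrow> prob {\<omega>\<in>space M. - \<delta> * k \<le> service_walk i k \<omega>} \<le> exp (- d * k)"
    "\<And>k. prob {\<omega>\<in>space M. \<delta> * k \<le> arrival_walk k \<omega>} \<le> exp (- d * k)"
    by (rule exponential_decay) (rule that)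
  define K where "K = 2 / d"
  define f where "f L = (exp L + 1) * (exp (- 2 * L) / (1 - exp (- d)))" for L :: real
  have "(f \<longlongrightarrow> 0) at_top" unfolding f_def using \<delta>d(2) by real_asymp
  then have lim: "(\<lambda>N. f (ln (real N))) \<longlonglongrightarrow> 0" by (rule filterlim_compose[OF _ ln_nat_at_top])
  show ?thesis
  proof (rule that[of K, OF _ lim])
    show "0 < K" using \<delta>d by (simp add: K_def)
    fix N n :: nat assume N: "1 \<le> N"
    let ?L = "ln (real N)"
    let ?I = "{k\<in>{0..n}. K * ?L < k}"
    have single: "prob {\<omega>\<in>space M. \<exists>i\<in>{1..N}. 0 < service_walk i k \<omega> + arrival_walk k \<omega>} \<le> (N + 1) * exp (- d * k)" for k
    proof -
      let ?X = "{\<omega>\<in>space M. \<exists>i\<in>{1..N}. - \<delta> * k \<le> service_walk i k \<omega>}" and ?R = "{\<omega>\<in>space M. \<delta> * k \<le> arrival_walk k \<omega>}"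
      have sets: "?X \<in> events" "?R \<in> events"
        by (intro sets.sets_Collect_finite_Ex finite_atLeastAtMost) measurable
      have "prob {\<omega>\<in>space M. \<exists>i\<in>{1..N}. 0 < service_walk i k \<omega> + arrival_walk k \<omega>} \<le> prob (?X \<union> ?R)"
      proof (intro finite_measure_mono subsetI sets.Un sets)
        fix \<omega> assume "\<omega> \<in> {\<omega>\<in>space M. \<exists>i\<in>{1..N}. 0 < service_walk i k \<omega> + arrival_walk k \<omega>}"
        then obtain i where i: "\<omega> \<in> space M" "i \<in> {1..N}" "0 < service_walk i k \<omega> + arrival_walk k \<omega>" by blast
        then have "- \<delta> * k \<le> service_walk i k \<omega> \<or> \<delta> * k \<le> arrival_walk k \<omega>" by linarith
        with i show "\<omega> \<in> ?X \<union> ?R" by blast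
      qed
      also have "\<dots> \<le> prob ?X + prob ?R" by (rule measure_Un_le[OF sets])
      also have "\<dots> \<le> card {1..N} * exp (- d * k) + exp (- d * k)"
      proof (intro add_mono prob_exists_le[OF finite_atLeastAtMost])
        show "prob ?R \<le> exp (- d * k)" by (rule \<delta>d(4))
        fix i assume i: "i \<in> {1..N}"
        then show "prob {\<omega>\<in>space M. - \<delta> * k \<le> service_walk i k \<omega>} \<le> exp (- d * k)"
          by (intro \<delta>d(3)) simp
        have [measurable]: "service_walk i k \<in> borel_measurable M"
          using i by (intro service_walk_measurable) simp
        show "{\<omega>\<in>space M. - \<delta> * k \<le> service_walk i k \<omega>} \<in> events" by measurable
      qed
      finally show ?thesis by (simp add: distrib_right)
    qed
    have single_events: "{\<omega>\<in>space M. \<exists>i\<in>{1..N}. 0 < service_walk i k \<omega> + arrival_walk k \<omega>} \<in> events" for k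
      by (intro sets.sets_Collect_finite_Ex finite_atLeastAtMost) measurable
    have "{\<omega>\<in>space M. \<exists>k\<in>?I. \<exists>i\<in>{1..N}. 0 < service_walk i k \<omega> + arrival_walk k \<omega>}
        = (\<Union>k\<in>?I. {\<omega>\<in>space M. \<exists>i\<in>{1..N}. 0 < service_walk i k \<omega> + arrival_walk k \<omega>})"
      by blast
    then have "prob {\<omega>\<in>space M. \<exists>k\<in>?I. \<exists>i\<in>{1..N}. 0 < service_walk i k \<omega> + arrival_walk k \<omega>}
        \<le> (\<Sum>k\<in>?I. prob {\<omega>\<in>space M. \<exists>i\<in>{1..N}. 0 < service_walk i k \<omega> + arrival_walk k \<omega>})"
      using single_events
      by (simp only:) (intro finite_measure_subadditive_finite, auto)
    also have "\<dots> \<le> (\<Sum>k\<in>?I. (N + 1) * exp (- d * k))" by (intro sum_mono single)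
    also have "\<dots> = (N + 1) * (\<Sum>k\<in>?I. exp (- d * k))" by (simp add: sum_distrib_left)
    also have "\<dots> \<le> (N + 1) * (exp (- 2 * ?L) / (1 - exp (- d)))"
    proof (intro mult_left_mono)
      define k1 where "k1 = nat \<lceil>K * ?L\<rceil>"
      have "0 \<le> K * ?L" using \<open>0 < K\<close> N by simp
      have k1: "K * ?L \<le> k1" unfolding k1_def by (simp add: real_nat_ceiling_ge)
      have q: "0 < exp (- d)" "exp (- d) < 1" using \<delta>d(2) by auto
      have "?I \<subseteq> {k1..n}" by (auto simp: k1_def ceiling_le_iff nat_le_iff)
      then have "(\<Sum>k\<in>?I. exp (- d * k)) \<le> (\<Sum>k=k1..n. exp (- d * k))"
        by (intro sum_mono2) auto
      also have "\<dots> = (\<Sum>k=k1..n. exp (- d) ^ k)"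
        by (intro sum.cong refl) (simp add: exp_of_nat_mult[symmetric] mult.commute)
      also have "\<dots> \<le> exp (- d) ^ k1 / (1 - exp (- d))"
      proof (cases "n < k1")
        case True
        then show ?thesis using q by simp
      next
        case False
        then have "(\<Sum>k=k1..n. exp (- d) ^ k) = (exp (- d) ^ k1 - exp (- d) ^ Suc n) / (1 - exp (- d))"
          using q by (subst sum_gp) auto
        also have "\<dots> \<le> exp (- d) ^ k1 / (1 - exp (- d))"
          using q by (intro divide_right_mono) auto
        finally show ?thesis .
      qed
      also have "exp (- d) ^ k1 = exp (- d * k1)"
        by (simp add: exp_of_nat_mult[symmetric] mult.commute)
      also have "exp (- d * k1) / (1 - exp (- d)) \<le> exp (- 2 * ?L) / (1 - exp (- d))"
        using mult_left_mono[OF k1, of d] \<delta>d(2) q by (intro divide_right_mono) (auto simp: K_def)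
      finally show "(\<Sum>k\<in>?I. exp (- d * k)) \<le> exp (- 2 * ?L) / (1 - exp (- d))" .
    qed simp
    also have "\<dots> = f ?L" unfolding f_def using N by simp
    finally show "prob {\<omega>\<in>space M. \<exists>k\<in>?I. \<exists>i\<in>{1..N}. 0 < service_walk i k \<omega> + arrival_walk k \<omega>} \<le> f ?L" .
  qed
qed

text \<open>
  Up to times of order \<open>L\<close> the walk does not rise to \<open>L\<close> to the power \<open>3/5\<close>: the exponent \<open>3/5 > 1/2\<close>
  leaves enough room for a union bound over the times, with \<open>\<theta>\<close> equal to \<open>L\<close> to the power \<open>-1/2\<close>.
\<close>

lemma arrival_walk_crude_bound:
  assumes "0 < K"
  shows "(\<lambda>N. prob {\<omega>\<in>space M. \<exists>k\<in>{k. real k \<le> K * ln N}. ln N powr (3/5) \<le> arrival_walk k \<omega>}) \<longlonglongrightarrow> 0"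
proof (rule tendsto_zero_ln_bound)
  let ?f = "\<lambda>L::real. (K*L+1) * exp (- (L powr (-1/2)) * L powr (3/5) + second_moment_A * (L powr (-1/2))\<^sup>2 * (K*L))"
  show "(?f \<longlongrightarrow> 0) at_top" by (rule crude_bound_vanishes[OF assms second_moment_A_nonneg])
  show "\<forall>\<^sub>F L in at_top. \<forall>N\<ge>1. ln (real N) = L \<longrightarrow>
     prob {\<omega>\<in>space M. \<exists>k\<in>{k. real k \<le> K * ln N}. ln N powr (3/5) \<le> arrival_walk k \<omega>} \<le> ?f L"
    using eventually_gt_at_top[of 0]
  proof (eventually_elim, intro allI impI)
    fix L :: real and N :: nat assume L: "0 < L" "ln (real N) = L"
    let ?b = "exp (- (L powr (-1/2)) * L powr (3/5) + second_moment_A * (L powr (-1/2))\<^sup>2 * (K*L))"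
    have "prob {\<omega>\<in>space M. \<exists>k\<in>{k. real k \<le> K * L}. L powr (3/5) \<le> arrival_walk k \<omega>}
        \<le> card {k. real k \<le> K * L} * ?b"
    proof (rule prob_exists_le)
      fix k assume "k \<in> {k. real k \<le> K * L}"
      then have k: "real k \<le> K * L" by simp
      have "prob {\<omega>\<in>space M. L powr (3/5) \<le> arrival_walk k \<omega> - arrival_walk 0 \<omega>}
         \<le> exp (- (L powr (-1/2)) * L powr (3/5) + second_moment_A * (L powr (-1/2))\<^sup>2 * (real k - real 0))"
        by (rule arrival_chernoff) auto
      also have "\<dots> \<le> ?b" using k second_moment_A_nonneg by (simp add: mult_left_mono)
      finally show "prob {\<omega>\<in>space M. L powr (3/5) \<le> arrival_walk k \<omega>} \<le> ?b"
        by (simp add: arrival_walk_def)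
    qed auto
    also have "\<dots> \<le> (K * L + 1) * ?b"
      using assms L by (intro mult_right_mono card_nat_le_real) auto
    finally show "prob {\<omega>\<in>space M. \<exists>k\<in>{k. real k \<le> K * ln N}. ln N powr (3/5) \<le> arrival_walk k \<omega>} \<le> ?f L"
      using L(2) by simp
  qed
qed simp

text \<open>
  The half-width, \<open>L\<close> to the power \<open>9/10\<close>, has to satisfy two demands: it is \<open>o(L)\<close>, so that the arrival
  walk hardly moves across the window, and it is large enough for service walks off the
  window to miss the level by more than the crude bound on the arrival walk.
\<close>

definition window :: "real \<Rightarrow> nat set" where
  "window L = {k. \<bar>real k - L / (\<gamma> * v)\<bar> \<le> L powr (9/10)}"

text \<open>
  For small \<open>L\<close>, when the left end of the window is negative, this is \<open>0\<close>.
\<close>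

definition window_start :: "real \<Rightarrow> nat" where
  "window_start L = nat \<lfloor>L / (\<gamma> * v) - L powr (9/10)\<rfloor>"

text \<open>
  Rises are measured from the left end of the window because only upward increments have an
  exponential bound. Over at most \<open>2 L\<^bsup>9/10\<^esup> + 1\<close> steps a rise by \<open>\<eta> sqrt L\<close> has a probability that is
  exponentially small in \<open>L\<close> to the power \<open>1/20\<close>, with \<open>\<theta>\<close> equal to \<open>L\<close> to the power \<open>-9/20\<close>.
\<close>

lemma arrival_walk_flat_on_window:
  assumes "0 < \<eta>"
  shows "(\<lambda>N. prob {\<omega>\<in>space M. \<exists>k\<in>window (ln N). \<eta> * sqrt (ln N) \<le>
    arrival_walk k \<omega> - arrival_walk (window_start (ln N)) \<omega>}) \<longlonglongrightarrow> 0"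
proof (rule tendsto_zero_ln_bound)
  define K where "K = 1 / (\<gamma> * v) + 1"
  have K: "0 < K" using \<gamma> v_pos by (simp add: K_def add_pos_pos)
  let ?f = "\<lambda>L::real. (K*L+1) * exp (- (L powr (-9/20)) * (\<eta> * sqrt L) + second_moment_A * (L powr (-9/20))\<^sup>2 * (2 * L powr (9/10) + 1))"
  show "(?f \<longlongrightarrow> 0) at_top" by (rule window_bound_vanishes[OF K assms second_moment_A_nonneg])
  show "\<forall>\<^sub>F L in at_top. \<forall>N\<ge>1. ln (real N) = L \<longrightarrow>
     prob {\<omega>\<in>space M. \<exists>k\<in>window (ln N). \<eta> * sqrt (ln N) \<le>
       arrival_walk k \<omega> - arrival_walk (window_start (ln N)) \<omega>} \<le> ?f L"
    using eventually_ge_at_top[of 1]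
  proof (eventually_elim, intro allI impI)
    fix L :: real and N :: nat assume L: "1 \<le> L" "ln (real N) = L"
    let ?b = "exp (- (L powr (-9/20)) * (\<eta> * sqrt L) + second_moment_A * (L powr (-9/20))\<^sup>2 * (2 * L powr (9/10) + 1))"
    have "L powr (9/10) \<le> L powr 1" using L by (intro powr_mono) auto
    then have sub: "window L \<subseteq> {k. real k \<le> K * L}"
      using L by (auto simp: window_def K_def algebra_simps)
    then have fin: "finite (window L)" by (rule finite_subset) simp
    have "prob {\<omega>\<in>space M. \<exists>k\<in>window L. \<eta> * sqrt L \<le> arrival_walk k \<omega> - arrival_walk (window_start L) \<omega>}
        \<le> card (window L) * ?b"
    proof (rule prob_exists_le[OF fin])
      fix k assume "k \<in> window L"
      then have k: "L / (\<gamma> * v) - L powr (9/10) \<le> k" "k \<le> L / (\<gamma> * v) + L powr (9/10)"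
        by (auto simp: window_def abs_le_iff)
      then have le: "window_start L \<le> k" unfolding window_start_def by linarith
      have "L / (\<gamma> * v) - L powr (9/10) - 1 \<le> window_start L" unfolding window_start_def by linarith
      then have d: "real k - real (window_start L) \<le> 2 * L powr (9/10) + 1" using k(2) by linarith
      have "prob {\<omega>\<in>space M. \<eta> * sqrt L \<le> arrival_walk k \<omega> - arrival_walk (window_start L) \<omega>}
         \<le> exp (- (L powr (-9/20)) * (\<eta> * sqrt L) + second_moment_A * (L powr (-9/20))\<^sup>2 * (real k - real (window_start L)))"
        by (rule arrival_chernoff[OF le]) auto
      also have "\<dots> \<le> ?b" using mult_left_mono[OF d, of "second_moment_A * (L powr (-9/20))\<^sup>2"] second_moment_A_nonneg by simp
      finally show "prob {\<omega>\<in>space M. \<eta> * sqrt L \<le> arrival_walk k \<omega> - arrival_walk (window_start L) \<omega>} \<le> ?b" .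
    qed auto
    also have "\<dots> \<le> (K * L + 1) * ?b"
    proof (rule mult_right_mono)
      have "real (card (window L)) \<le> real (card {k. real k \<le> K * L})"
        using card_mono[OF _ sub] by simp
      also have "\<dots> \<le> K * L + 1" using K L by (intro card_nat_le_real) auto
      finally show "real (card (window L)) \<le> K * L + 1" .
    qed simp
    finally show "prob {\<omega>\<in>space M. \<exists>k\<in>window (ln N). \<eta> * sqrt (ln N) \<le>
       arrival_walk k \<omega> - arrival_walk (window_start (ln N)) \<omega>} \<le> ?f L"
      using L(2) by simp
  qed
qed simp

text \<open>
  The factor \<open>exp L\<close> is the number of queues and \<open>K L + 1\<close> bounds the number of times.
\<close>

lemma service_walk_union_bound:
  assumes K: "0 < K" and J: "\<And>L. J L \<subseteq> {k::nat. real k \<le> K * L}" and b: "\<And>L. 0 \<le> b L"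
    and lim: "((\<lambda>L. exp L * (K * L + 1) * b L) \<longlongrightarrow> 0) at_top"
    and le: "\<forall>\<^sub>F L in at_top. \<forall>i\<ge>1. \<forall>k\<in>J L. prob {\<omega>\<in>space M. y L \<le> service_walk i k \<omega>} \<le> b L"
  shows "(\<lambda>N. prob {\<omega>\<in>space M. \<exists>k\<in>J (ln N). \<exists>i\<in>{1..N}. y (ln N) \<le> service_walk i k \<omega>}) \<longlonglongrightarrow> 0"
proof (rule tendsto_zero_ln_bound[OF lim])
  show "\<forall>\<^sub>F L in at_top. \<forall>N\<ge>1. ln (real N) = L \<longrightarrow>
     prob {\<omega>\<in>space M. \<exists>k\<in>J (ln N). \<exists>i\<in>{1..N}. y (ln N) \<le> service_walk i k \<omega>} \<le> exp L * (K * L + 1) * b L"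
    using eventually_gt_at_top[of 0] le
  proof (eventually_elim, intro allI impI)
    fix L :: real and N :: nat
    assume L: "0 < L" "\<forall>i\<ge>1. \<forall>k\<in>J L. prob {\<omega>\<in>space M. y L \<le> service_walk i k \<omega>} \<le> b L"
      and N: "1 \<le> N" "ln (real N) = L"
    have fin: "finite (J L)" by (rule finite_subset[OF J]) simp
    have "prob {\<omega>\<in>space M. \<exists>k\<in>J L. \<exists>i\<in>{1..N}. y L \<le> service_walk i k \<omega>} \<le> card (J L) * (card {1..N} * b L)"
    proof (rule prob_exists_le[OF fin])
      fix k assume "k \<in> J L"
      then show "prob {\<omega>\<in>space M. \<exists>i\<in>{1..N}. y L \<le> service_walk i k \<omega>} \<le> card {1..N} * b L"
        using L(2) by (intro prob_exists_le[OF finite_atLeastAtMost]) simp_all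
    qed simp
    also have "\<dots> \<le> (K * L + 1) * (exp L * b L)"
    proof (rule mult_mono)
      have "real (card (J L)) \<le> real (card {k. real k \<le> K * L})"
        using card_mono[OF _ J] by simp
      also have "\<dots> \<le> K * L + 1" using K L by (intro card_nat_le_real) auto
      finally show "real (card (J L)) \<le> K * L + 1" .
      show "real (card {1..N}) * b L \<le> exp L * b L" using N by auto
    qed (use K L b in auto)
    finally show "prob {\<omega>\<in>space M. \<exists>k\<in>J (ln N). \<exists>i\<in>{1..N}. y (ln N) \<le> service_walk i k \<omega>} \<le> exp L * (K * L + 1) * b L"
      using N(2) by (simp add: mult_ac)
  qed
qed simp

text \<open>
  At \<open>\<theta> = \<gamma>\<close> Chernoff's bound does not depend on the time \<open>k\<close>, and the factor \<open>exp L\<close> from the union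
  over the queues cancels exactly against \<open>exp (-\<gamma> L/\<gamma>)\<close>.
\<close>

lemma service_walk_level:
  assumes "0 < K" "0 < \<eta>"
  shows "(\<lambda>N. prob {\<omega>\<in>space M. \<exists>k\<in>{k. real k \<le> K * ln N}. \<exists>i\<in>{1..N}.
    ln N / \<gamma> + \<eta> * sqrt (ln N) \<le> service_walk i k \<omega>}) \<longlonglongrightarrow> 0"
proof (rule service_walk_union_bound[where b = "\<lambda>L. exp (- \<gamma> * (L / \<gamma> + \<eta> * sqrt L))"
      and y = "\<lambda>L. L / \<gamma> + \<eta> * sqrt L", OF assms(1)])
  show "((\<lambda>L. exp L * (K * L + 1) * exp (- \<gamma> * (L / \<gamma> + \<eta> * sqrt L))) \<longlongrightarrow> 0) at_top"
    using assms \<gamma> by real_asymp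
  have "mgf \<gamma> = 1" using root by (simp add: mgf_def)
  then have "prob {\<omega>\<in>space M. y \<le> service_walk i k \<omega>} \<le> exp (- \<gamma> * y)" if "1 \<le> i" for i k y
    using service_chernoff[OF that, of \<gamma> y k] \<gamma> exp_S_integrable[of 0] r by simp
  then show "\<forall>\<^sub>F L in at_top. \<forall>i\<ge>1. \<forall>k\<in>{k. real k \<le> K * L}.
    prob {\<omega>\<in>space M. L / \<gamma> + \<eta> * sqrt L \<le> service_walk i k \<omega>} \<le> exp (- \<gamma> * (L / \<gamma> + \<eta> * sqrt L))"
    by simp
qed auto

text \<open>
  Replacing \<open>\<gamma>\<close> by \<open>\<gamma> + h\<close> changes the exponent of Chernoff's bound by \<open>h (k v - y) + O(h\<^sup>2 k)\<close>. Before
  the window \<open>k v - y\<close> is negative and \<open>h > 0\<close> gains, after it \<open>h < 0\<close> does. With \<open>|h|\<close> equal to \<open>L\<close> to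
  the power \<open>-3/20\<close> the gain is of order \<open>L\<close> to the power \<open>9/10 - 3/20 = 3/4\<close>, which dominates the
  quadratic error of order \<open>L\<close> to the power \<open>1 - 6/20 = 7/10\<close> and the term \<open>2 L\<^bsup>3/5\<^esup>\<close>.
\<close>

lemma service_walk_off_window:
  assumes "0 < K"
  shows "(\<lambda>N. prob {\<omega>\<in>space M. \<exists>k\<in>{k. real k \<le> K * ln N} - window (ln N). \<exists>i\<in>{1..N}.
    ln N / \<gamma> - 2 * ln N powr (3/5) \<le> service_walk i k \<omega>}) \<longlonglongrightarrow> 0"
proof -
  obtain C where "0 < C" and C: "\<And>h. \<bar>h\<bar> \<le> r / 2 \<Longrightarrow> mgf (\<gamma> + h) \<le> exp (v * h + C * h\<^sup>2)"
    by (rule mgf_near_root) (rule that)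
  define b1 where "b1 L = exp (L powr (-3/20) * (L / \<gamma> - v * L powr (9/10)) + C * (L powr (-3/20))\<^sup>2 * (K*L)
      - (\<gamma> + L powr (-3/20)) * (L / \<gamma> - 2 * L powr (3/5)))" for L :: real
  define b2 where "b2 L = exp (- (L powr (-3/20)) * (L / \<gamma> + v * L powr (9/10)) + C * (L powr (-3/20))\<^sup>2 * (K*L)
      - (\<gamma> - L powr (-3/20)) * (L / \<gamma> - 2 * L powr (3/5)))" for L :: real
  have lim1: "((\<lambda>L. exp L * (K * L + 1) * b1 L) \<longlongrightarrow> 0) at_top"
    unfolding b1_def by (rule off_window_bounds_vanish(1)[OF assms \<open>0 < C\<close> v_pos \<gamma>])
  have lim2: "((\<lambda>L. exp L * (K * L + 1) * b2 L) \<longlongrightarrow> 0) at_top"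
    unfolding b2_def by (rule off_window_bounds_vanish(2)[OF assms \<open>0 < C\<close> v_pos \<gamma>])
  have chernoff: "prob {\<omega>\<in>space M. y \<le> service_walk i k \<omega>} \<le> exp (h * (k * v) + C * h\<^sup>2 * k - (\<gamma> + h) * y)"
    if "1 \<le> i" "\<bar>h\<bar> \<le> r / 2" "\<bar>h\<bar> \<le> \<gamma>" for i k y h
  proof -
    have "prob {\<omega>\<in>space M. y \<le> service_walk i k \<omega>} \<le> exp (- (\<gamma> + h) * y) * mgf (\<gamma> + h) ^ k"
      using that r by (intro service_chernoff exp_S_integrable) auto
    also have "\<dots> \<le> exp (- (\<gamma> + h) * y) * exp (v * h + C * h\<^sup>2) ^ k"
      by (intro mult_left_mono power_mono C that) (auto simp: mgf_def)
    also have "\<dots> = exp (h * (k * v) + C * h\<^sup>2 * k - (\<gamma> + h) * y)"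
      by (simp add: exp_of_nat_mult[symmetric] exp_add[symmetric] algebra_simps)
    finally show ?thesis .
  qed
  show ?thesis
  proof (rule service_walk_union_bound[where b = "\<lambda>L. b1 L + b2 L"
      and y = "\<lambda>L. L / \<gamma> - 2 * L powr (3/5)" and J = "\<lambda>L. {k. real k \<le> K * L} - window L", OF assms])
    show "((\<lambda>L. exp L * (K * L + 1) * (b1 L + b2 L)) \<longlongrightarrow> 0) at_top"
      using tendsto_add[OF lim1 lim2] by (simp add: distrib_left)
    have "\<forall>\<^sub>F L::real in at_top. L powr (-3/20) \<le> r / 2" using r by real_asymp
    moreover have "\<forall>\<^sub>F L::real in at_top. L powr (-3/20) \<le> \<gamma>" using \<gamma> by real_asymp
    ultimately show "\<forall>\<^sub>F L in at_top. \<forall>i\<ge>1. \<forall>k\<in>{k. real k \<le> K * L} - window L.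
      prob {\<omega>\<in>space M. L / \<gamma> - 2 * L powr (3/5) \<le> service_walk i k \<omega>} \<le> b1 L + b2 L"
    proof (eventually_elim, intro allI impI ballI)
      fix L :: real and i k :: nat
      assume h: "L powr (-3/20) \<le> r / 2" "L powr (-3/20) \<le> \<gamma>" and i: "1 \<le> i"
        and k: "k \<in> {k. real k \<le> K * L} - window L"
      let ?h = "L powr (-3/20)" and ?y = "L / \<gamma> - 2 * L powr (3/5)"
      have sq: "C * ?h\<^sup>2 * k \<le> C * ?h\<^sup>2 * (K * L)"
        using k \<open>0 < C\<close> by (intro mult_left_mono) auto
      have Lv: "v * (L / (\<gamma> * v)) = L / \<gamma>" using v_pos by simp
      have pos: "0 \<le> b1 L" "0 \<le> b2 L" by (auto simp: b1_def b2_def)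
      have "L powr (9/10) < \<bar>real k - L / (\<gamma> * v)\<bar>" using k by (simp add: window_def)
      then consider "real k \<le> L / (\<gamma> * v) - L powr (9/10)" | "L / (\<gamma> * v) + L powr (9/10) \<le> real k"
        by linarith
      then show "prob {\<omega>\<in>space M. ?y \<le> service_walk i k \<omega>} \<le> b1 L + b2 L"
      proof cases
        case 1
        have "k * v \<le> L / \<gamma> - v * L powr (9/10)"
          using mult_left_mono[OF 1, of v] v_pos Lv by (simp add: right_diff_distrib mult.commute)
        then have "?h * (k * v) \<le> ?h * (L / \<gamma> - v * L powr (9/10))" by (intro mult_left_mono) auto
        then have "exp (?h * (k * v) + C * ?h\<^sup>2 * k - (\<gamma> + ?h) * ?y) \<le> b1 L"
          unfolding b1_def using sq by simp
        moreover have "prob {\<omega>\<in>space M. ?y \<le> service_walk i k \<omega>} \<le> exp (?h * (k * v) + C * ?h\<^sup>2 * k - (\<gamma> + ?h) * ?y)"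
          by (rule chernoff[OF i]) (use h in auto)
        ultimately show ?thesis using pos by linarith
      next
        case 2
        have "L / \<gamma> + v * L powr (9/10) \<le> k * v"
          using mult_left_mono[OF 2, of v] v_pos Lv by (simp add: distrib_left mult.commute)
        then have "?h * (L / \<gamma> + v * L powr (9/10)) \<le> ?h * (k * v)" by (intro mult_left_mono) auto
        then have "exp (- ?h * (k * v) + C * (- ?h)\<^sup>2 * k - (\<gamma> + - ?h) * ?y) \<le> b2 L"
          unfolding b2_def using sq by simp
        moreover have "prob {\<omega>\<in>space M. ?y \<le> service_walk i k \<omega>} \<le> exp (- ?h * (k * v) + C * (- ?h)\<^sup>2 * k - (\<gamma> + - ?h) * ?y)"
          by (rule chernoff[OF i]) (use h in auto)
        ultimately show ?thesis using pos by linarith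
      qed
    qed
  qed (auto simp: b1_def b2_def add_nonneg_nonneg)
qed

end

context fork_join_queue
begin

lemma finite_window: "finite (window L)"
proof (rule finite_subset)
  show "window L \<subseteq> {k. real k \<le> L / (\<gamma> * v) + L powr (9/10)}" by (auto simp: window_def)
qed simp

text \<open>
  If the arrival walk is small at the left end of the window, then a walk above the level forces one
  of five rare events: a late crossing, a large arrival walk, a rise of the arrival walk inside the
  window, an excessive service walk, or a service walk that is high off the window.
\<close>

lemma upper_deviation:
  assumes \<eta>: "0 < \<eta>"
  obtains e where "e \<longlonglongrightarrow> 0"
    "\<forall>\<^sub>F N in sequentially. \<forall>n.
      prob {\<omega>\<in>space M. arrival_walk (window_start (ln N)) \<omega> \<le> (x - 2 * \<eta>) * sqrt (ln N)} - e N
      \<le> prob {\<omega>\<in>space M. \<forall>i\<in>{1..N}. \<forall>k\<in>{0..n}. (\<Sum>j=1..k. Ss i j \<omega> - As j \<omega>) \<le> ln N / \<gamma> + x * sqrt (ln N)}"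
proof -
  obtain K e1 where K: "0 < K" and e1: "e1 \<longlonglongrightarrow> 0"
    and late: "\<And>N n. 1 \<le> N \<Longrightarrow> prob {\<omega>\<in>space M. \<exists>k\<in>{k\<in>{0..n}. K * ln N < k}. \<exists>i\<in>{1..N}. 0 < service_walk i k \<omega> + arrival_walk k \<omega>} \<le> e1 N"
    by (rule late_crossings_negligible) (rule that)
  define J where "J N = {k::nat. real k \<le> K * ln (real N)}" for N :: nat
  define B1 where "B1 N n = {\<omega>\<in>space M. \<exists>k\<in>{k\<in>{0..n}. K * ln N < k}. \<exists>i\<in>{1..N}. 0 < service_walk i k \<omega> + arrival_walk k \<omega>}" for N n :: nat
  define B2 where "B2 N = {\<omega>\<in>space M. \<exists>k\<in>J N. ln N powr (3/5) \<le> arrival_walk k \<omega>}" for N :: nat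
  define B3 where "B3 N = {\<omega>\<in>space M. \<exists>k\<in>window (ln N). \<eta> * sqrt (ln N) \<le>
    arrival_walk k \<omega> - arrival_walk (window_start (ln N)) \<omega>}" for N :: nat
  define B4 where "B4 N = {\<omega>\<in>space M. \<exists>k\<in>J N. \<exists>i\<in>{1..N}. ln N / \<gamma> + \<eta> * sqrt (ln N) \<le> service_walk i k \<omega>}" for N :: nat
  define B5 where "B5 N = {\<omega>\<in>space M. \<exists>k\<in>J N - window (ln N). \<exists>i\<in>{1..N}.
    ln N / \<gamma> - 2 * ln N powr (3/5) \<le> service_walk i k \<omega>}" for N :: nat
  define e where "e N = e1 N + (prob (B2 N) + (prob (B3 N) + (prob (B4 N) + prob (B5 N))))" for N
  have fin: "finite (J N)" for N by (simp add: J_def)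
  have sets: "B1 N n \<in> events" "B2 N \<in> events" "B3 N \<in> events" "B4 N \<in> events" "B5 N \<in> events" for N n
    unfolding B1_def B2_def B3_def B4_def B5_def
    by (intro sets.sets_Collect_finite_Ex fin finite_window finite_Diff finite_atLeastAtMost; measurable; fail)+
  have "e \<longlonglongrightarrow> 0 + (0 + (0 + (0 + 0)))"
    unfolding e_def B2_def B3_def B4_def B5_def J_def
    by (intro tendsto_add e1 arrival_walk_crude_bound arrival_walk_flat_on_window service_walk_level
        service_walk_off_window K \<eta>)
  then have e: "e \<longlonglongrightarrow> 0" by simp
  have "\<forall>\<^sub>F L::real in at_top. 0 \<le> L / \<gamma> + x * sqrt L" using \<gamma> by real_asymp
  moreover have "\<forall>\<^sub>F L::real in at_top. - x * sqrt L \<le> L powr (3/5)" by real_asymp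
  ultimately have "\<forall>\<^sub>F L::real in at_top. 0 \<le> L / \<gamma> + x * sqrt L \<and> - x * sqrt L \<le> L powr (3/5)"
    by eventually_elim simp
  then have "\<forall>\<^sub>F N in sequentially. 0 \<le> ln (real N) / \<gamma> + x * sqrt (ln N) \<and> - x * sqrt (ln N) \<le> ln N powr (3/5)"
    by (rule eventually_compose_filterlim[OF _ ln_nat_at_top])
  moreover have "\<forall>\<^sub>F N in sequentially. (1::nat) \<le> N" by (rule eventually_ge_at_top)
  ultimately have "\<forall>\<^sub>F N in sequentially. \<forall>n.
      prob {\<omega>\<in>space M. arrival_walk (window_start (ln N)) \<omega> \<le> (x - 2 * \<eta>) * sqrt (ln N)} - e N
      \<le> prob {\<omega>\<in>space M. \<forall>i\<in>{1..N}. \<forall>k\<in>{0..n}. (\<Sum>j=1..k. Ss i j \<omega> - As j \<omega>) \<le> ln N / \<gamma> + x * sqrt (ln N)}"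
  proof (eventually_elim, intro allI)
    fix N n :: nat
    assume h: "0 \<le> ln (real N) / \<gamma> + x * sqrt (ln N) \<and> - x * sqrt (ln N) \<le> ln N powr (3/5)" and N: "1 \<le> N"
    let ?L = "ln (real N)"
    let ?E = "{\<omega>\<in>space M. arrival_walk (window_start ?L) \<omega> \<le> (x - 2 * \<eta>) * sqrt ?L}"
    let ?G = "{\<omega>\<in>space M. \<forall>i\<in>{1..N}. \<forall>k\<in>{0..n}. (\<Sum>j=1..k. Ss i j \<omega> - As j \<omega>) \<le> ?L / \<gamma> + x * sqrt ?L}"
    have sub: "?E \<subseteq> ?G \<union> (B1 N n \<union> (B2 N \<union> (B3 N \<union> (B4 N \<union> B5 N))))"
    proof
      fix \<omega> assume w: "\<omega> \<in> ?E"
      show "\<omega> \<in> ?G \<union> (B1 N n \<union> (B2 N \<union> (B3 N \<union> (B4 N \<union> B5 N))))"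
      proof (rule ccontr)
        assume "\<not> ?thesis"
        then have not_B: "\<omega> \<notin> ?G" "\<omega> \<notin> B1 N n" "\<omega> \<notin> B2 N" "\<omega> \<notin> B3 N" "\<omega> \<notin> B4 N" "\<omega> \<notin> B5 N" by auto
        have sp: "\<omega> \<in> space M" using w by simp
        obtain i k where i: "i \<in> {1..N}" and k: "k \<in> {0..n}"
          and gt: "?L / \<gamma> + x * sqrt ?L < service_walk i k \<omega> + arrival_walk k \<omega>"
          using not_B(1) sp unfolding walk_eq[symmetric] by (auto simp: not_le)
        have "k \<in> J N"
        proof (rule ccontr)
          assume "k \<notin> J N"
          then have "k \<in> {k\<in>{0..n}. K * ln N < k}" using k by (auto simp: J_def)
          then show False using not_B(2) sp i gt h unfolding B1_def by force
        qed
        show False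
        proof (cases "k \<in> window ?L")
          case False
          have "service_walk i k \<omega> < ?L / \<gamma> - 2 * ?L powr (3/5)"
            using not_B(6) sp i \<open>k \<in> J N\<close> False unfolding B5_def by (auto simp: not_le)
          moreover have "arrival_walk k \<omega> < ?L powr (3/5)"
            using not_B(3) sp \<open>k \<in> J N\<close> unfolding B2_def by (auto simp: not_le)
          ultimately show False using gt h by linarith
        next
          case True
          have "service_walk i k \<omega> < ?L / \<gamma> + \<eta> * sqrt ?L"
            using not_B(5) sp i \<open>k \<in> J N\<close> unfolding B4_def by (auto simp: not_le)
          moreover have "arrival_walk k \<omega> - arrival_walk (window_start ?L) \<omega> < \<eta> * sqrt ?L"
            using not_B(4) sp True unfolding B3_def by (auto simp: not_le)
          moreover have "arrival_walk (window_start ?L) \<omega> \<le> x * sqrt ?L - 2 * (\<eta> * sqrt ?L)"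
            using w by (simp add: left_diff_distrib)
          ultimately show False using gt by linarith
        qed
      qed
    qed
    have G: "?G \<in> events"
      unfolding walk_eq by (intro sets.sets_Collect_finite_All finite_atLeastAtMost; measurable; fail)
    have "prob ?E \<le> prob (?G \<union> (B1 N n \<union> (B2 N \<union> (B3 N \<union> (B4 N \<union> B5 N)))))"
      by (rule finite_measure_mono[OF sub]) (intro sets.Un G sets)
    also have "\<dots> \<le> prob ?G + (prob (B1 N n) + (prob (B2 N) + (prob (B3 N) + (prob (B4 N) + prob (B5 N)))))"
      by (intro order.trans[OF measure_Un_le] add_mono order.refl sets.Un G sets)
    also have "\<dots> \<le> prob ?G + e N"
      using late[OF N, of n] unfolding e_def B1_def by simp
    finally show "prob ?E - e N \<le> prob ?G" by simp
  qed
  with e show ?thesis by (rule that)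
qed

end

section \<open>Some queue reaches the level at the typical time\<close>

context fork_join_queue
begin

text \<open>
  The typical time at which the maximum over the queues is attained.
\<close>

definition peak :: "real \<Rightarrow> nat" where "peak L = nat \<lfloor>L / (\<gamma> * v)\<rfloor>"

definition \<nu> :: "real measure" where "\<nu> = distr M borel (\<lambda>\<omega>. S \<omega> - m)"

lemma prob_service_walk_eq_PiM:
  assumes "1 \<le> i" "1 \<le> k"
  shows "prob {\<omega>\<in>space M. y \<le> service_walk i k \<omega>} =
    measure (PiM {1..k} (\<lambda>_. \<nu>)) {z \<in> space (PiM {1..k} (\<lambda>_. \<nu>)). y \<le> (\<Sum>j=1..k. z j)}"
proof -
  have sets_eq: "sets (PiM {1..k} (\<lambda>_. \<nu>)) = sets (PiM {1..k} (\<lambda>_. borel))"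
    by (intro sets_PiM_cong) (auto simp: \<nu>_def)
  have sp: "space (PiM {1..k} (\<lambda>_. \<nu>)) = space (PiM {1..k} (\<lambda>_. borel))"
    by (rule sets_eq_imp_space_eq[OF sets_eq])
  have law: "distr M borel (\<lambda>\<omega>. Ss i j \<omega> - m) = \<nu>" if "1 \<le> j" for j
  proof -
    have "distr M borel (\<lambda>\<omega>. Ss i j \<omega> - m) = distr (distr M borel (Ss i j)) borel (\<lambda>y. y - m)"
      using assms(1) that by (subst distr_distr) (auto simp: comp_def)
    also have "\<dots> = distr (distr M borel S) borel (\<lambda>y. y - m)" using assms(1) that by (simp add: lawS)
    also have "\<dots> = \<nu>" unfolding \<nu>_def by (subst distr_distr) (auto simp: comp_def)
    finally show ?thesis .
  qed
  let ?Z = "\<lambda>\<omega>. \<lambda>j\<in>{1..k}. Ss i j \<omega> - m"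
  let ?H = "{z \<in> space (PiM {1..k} (\<lambda>_. borel)). y \<le> (\<Sum>j=1..k. z j)}"
  have eq: "PiM {1..k} (\<lambda>_. \<nu>) = distr M (PiM {1..k} (\<lambda>_. borel)) ?Z"
    by (rule distr_indep_vars_eq_PiM[symmetric, OF _ indep_services[OF assms(1)]]) (use assms law in auto)
  have "?H \<in> sets (PiM {1..k} (\<lambda>_. borel :: real measure))" by measurable
  moreover have "?Z \<in> measurable M (PiM {1..k} (\<lambda>_. borel))"
    using assms by (intro measurable_restrict) auto
  ultimately have "measure (distr M (PiM {1..k} (\<lambda>_. borel)) ?Z) ?H = prob (?Z -` ?H \<inter> space M)"
    by (intro measure_distr)
  then have "measure (PiM {1..k} (\<lambda>_. \<nu>)) {z \<in> space (PiM {1..k} (\<lambda>_. \<nu>)). y \<le> (\<Sum>j=1..k. z j)} =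
     prob (?Z -` ?H \<inter> space M)"
    unfolding sp unfolding eq .
  also have "?Z -` ?H \<inter> space M
     = {\<omega>\<in>space M. y \<le> service_walk i k \<omega>}"
    by (auto simp: space_PiM service_walk_def)
  finally show ?thesis by simp
qed

lemma service_walk_large_deviation_lower_bound:
  assumes "0 < a" "a < b"
  shows "\<exists>p>0. \<forall>\<^sub>F k in sequentially. \<forall>i\<ge>1. p * exp (- \<gamma> * (k * v - a * sqrt k)) \<le>
    prob {\<omega>\<in>space M. k * v - b * sqrt k \<le> service_walk i k \<omega>}"
proof -
  have Ym: "(\<lambda>\<omega>. S \<omega> - m) \<in> borel_measurable M" by simp
  have "\<exists>p>0. \<forall>\<^sub>F k in sequentially. p * exp (- \<gamma> * (k * v - a * sqrt k)) \<le>
     measure (PiM {1..k} (\<lambda>_. \<nu>)) {z \<in> space (PiM {1..k} (\<lambda>_. \<nu>)). k * v - b * sqrt k \<le> (\<Sum>j=1..k. z j)}"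
  proof (rule tilted_large_deviation_lower_bound[OF _ _ \<gamma> _ _ _ _ _ assms])
    show "prob_space \<nu>" unfolding \<nu>_def by (rule prob_space_distr) simp
    show "sets \<nu> = sets borel" by (simp add: \<nu>_def)
    show "integral\<^sup>L \<nu> (\<lambda>y. exp (\<gamma> * y)) = 1" unfolding \<nu>_def by (subst integral_distr) (auto simp: root)
    show "integrable \<nu> (\<lambda>y. y * exp (\<gamma> * y))" "integrable \<nu> (\<lambda>y. y\<^sup>2 * exp (\<gamma> * y))"
      unfolding \<nu>_def
      using integrable_times_exp_tilt[OF Ym r exp_S] integrable_square_times_exp_tilt[OF Ym r exp_S]
      by (simp_all add: integrable_distr_eq)
    show "v = integral\<^sup>L \<nu> (\<lambda>y. y * exp (\<gamma> * y))" unfolding \<nu>_def by (subst integral_distr) (auto simp: v_def)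
    show "\<not> (AE y in \<nu>. y = v)"
    proof
      assume "AE y in \<nu>. y = v"
      then have "AE \<omega> in M. S \<omega> - m = v" unfolding \<nu>_def by (subst (asm) AE_distr_iff) auto
      then have "expectation (\<lambda>\<omega>. S \<omega> - m) = expectation (\<lambda>_. v)" by (intro integral_cong_AE) auto
      then show False using stable v_pos by (simp add: prob_space)
    qed
  qed
  then obtain p where "0 < p" and ev: "\<forall>\<^sub>F k in sequentially. p * exp (- \<gamma> * (k * v - a * sqrt k)) \<le>
     measure (PiM {1..k} (\<lambda>_. \<nu>)) {z \<in> space (PiM {1..k} (\<lambda>_. \<nu>)). k * v - b * sqrt k \<le> (\<Sum>j=1..k. z j)}"
    by blast
  have "\<forall>\<^sub>F k in sequentially. \<forall>i\<ge>1. p * exp (- \<gamma> * (k * v - a * sqrt k)) \<le>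
    prob {\<omega>\<in>space M. k * v - b * sqrt k \<le> service_walk i k \<omega>}"
    using ev eventually_ge_at_top[of "1::nat"]
  proof eventually_elim
    case (elim k)
    show ?case
    proof (intro allI impI)
      fix i :: nat assume "1 \<le> i"
      show "p * exp (- \<gamma> * (k * v - a * sqrt k)) \<le> prob {\<omega>\<in>space M. k * v - b * sqrt k \<le> service_walk i k \<omega>}"
        unfolding prob_service_walk_eq_PiM[OF \<open>1 \<le> i\<close> elim(2)] by (rule elim(1))
    qed
  qed
  with \<open>0 < p\<close> show ?thesis by blast
qed

lemma indep_service_walks: "indep_vars (\<lambda>_. borel) (\<lambda>i. service_walk i k) {1..N}"
proof -
  let ?X = "case_sum (\<lambda>(i, j). Ss i j) As"
  define I :: "nat \<Rightarrow> (nat \<times> nat + nat) set" where "I i = (\<lambda>j. Inl (i, j)) ` {1..k}" for i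
  have "indep_vars (\<lambda>i. PiM (I i) (\<lambda>_. borel)) (\<lambda>i \<omega>. \<lambda>x\<in>I i. ?X x \<omega>) {1..N}"
    by (rule indep_vars_restrict[OF ind]) (auto simp: I_def disjoint_family_on_def)
  then have "indep_vars (\<lambda>_. borel) (\<lambda>i \<omega>. \<Sum>j=1..k. (\<lambda>x\<in>I i. ?X x \<omega>) (Inl (i, j)) - m) {1..N}"
    by (rule indep_vars_compose2)
       (intro borel_measurable_sum borel_measurable_diff measurable_component_singleton, auto simp: I_def)
  also have "(\<lambda>i \<omega>. \<Sum>j=1..k. (\<lambda>x\<in>I i. ?X x \<omega>) (Inl (i, j)) - m) = (\<lambda>i. service_walk i k)"
    unfolding service_walk_def by (intro ext sum.cong) (auto simp: I_def)
  finally show ?thesis .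
qed

lemma prob_all_service_walks_le:
  assumes "1 \<le> N" and q: "\<And>i. 1 \<le> i \<Longrightarrow> q \<le> prob {\<omega>\<in>space M. t < service_walk i k \<omega>}"
  shows "prob {\<omega>\<in>space M. \<forall>i\<in>{1..N}. service_walk i k \<omega> \<le> t} \<le> exp (- (N * q))"
proof -
  have "prob (\<Inter>i\<in>{1..N}. service_walk i k -` {..t} \<inter> space M) = (\<Prod>i\<in>{1..N}. prob (service_walk i k -` {..t} \<inter> space M))"
    using assms(1) by (intro indep_varsD_finite[OF indep_service_walks]) auto
  also have "\<dots> \<le> (\<Prod>i\<in>{1..N}. exp (- q))"
  proof (intro prod_mono conjI)
    fix i assume i: "i \<in> {1..N}"
    have "prob (service_walk i k -` {..t} \<inter> space M) = 1 - prob {\<omega>\<in>space M. t < service_walk i k \<omega>}"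
    proof -
      have "service_walk i k -` {..t} \<inter> space M = space M - {\<omega>\<in>space M. t < service_walk i k \<omega>}" by auto
      moreover have [measurable]: "service_walk i k \<in> borel_measurable M"
        using i by (intro service_walk_measurable) simp
      then have "{\<omega>\<in>space M. t < service_walk i k \<omega>} \<in> events" by measurable
      ultimately show ?thesis by (simp add: prob_compl)
    qed
    also have "\<dots> \<le> 1 + (- q)" using q[of i] i by simp
    also have "\<dots> \<le> exp (- q)" by (rule exp_ge_add_one_self)
    finally show "prob (service_walk i k -` {..t} \<inter> space M) \<le> exp (- q)" .
  qed simp
  also have "\<dots> = exp (- (N * q))" by (simp add: exp_of_nat_mult[symmetric])
  also have "(\<Inter>i\<in>{1..N}. service_walk i k -` {..t} \<inter> space M) = {\<omega>\<in>space M. \<forall>i\<in>{1..N}. service_walk i k \<omega> \<le> t}"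
    using assms(1) by auto
  finally show ?thesis .
qed

text \<open>
  At time \<open>peak L\<close> one has \<open>k v \<approx> L/\<gamma>\<close>, and the sharp lower bound gives each queue a probability of at
  least \<open>p exp (\<gamma> a sqrt k) / N\<close> to be above \<open>L/\<gamma> - \<eta> sqrt L\<close>. Independence of the \<open>N\<close>
  queues does the rest.
\<close>

lemma some_service_walk_reaches_level:
  assumes \<eta>: "0 < \<eta>"
  shows "(\<lambda>N. prob {\<omega>\<in>space M. \<forall>i\<in>{1..N}. service_walk i (peak (ln N)) \<omega> \<le> ln N / \<gamma> - \<eta> * sqrt (ln N)}) \<longlonglongrightarrow> 0"
proof -
  define w where "w = v"
  have w: "0 < w" using v_pos by (simp add: w_def)
  \<comment> \<open>Chosen so that \<open>b sqrt (L / (\<gamma> w))\<close> is \<open>\<eta> / 2 * sqrt L\<close>; the other half of \<open>\<eta> sqrt L\<close>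
    absorbs the rounding error in \<open>peak\<close>.\<close>
  define b where "b = \<eta> / 2 * sqrt (\<gamma> * w)"
  have b: "0 < b" using \<eta> \<gamma> w by (simp add: b_def)
  obtain p where p: "0 < p" and ev: "\<forall>\<^sub>F k in sequentially. \<forall>i\<ge>1. p * exp (- \<gamma> * (k * w - b / 2 * sqrt k)) \<le>
    prob {\<omega>\<in>space M. k * w - b * sqrt k \<le> service_walk i k \<omega>}"
    using service_walk_large_deviation_lower_bound[of "b / 2" b] b unfolding w_def by auto
  have peak: "filterlim peak sequentially at_top"
  proof -
    have "filterlim (\<lambda>L::real. L / (\<gamma> * w)) at_top at_top" using \<gamma> w by real_asymp
    then show ?thesis
      unfolding peak_def w_def
      by (intro filterlim_compose[OF filterlim_nat_sequentially] filterlim_compose[OF filterlim_floor_sequentially])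
  qed
  show ?thesis
  proof (rule tendsto_zero_ln_bound)
    show "((\<lambda>L. exp (- (p * exp (\<gamma> * (b / 2) * sqrt (L / (\<gamma> * w) - 1))))) \<longlongrightarrow> 0) at_top"
      using p \<gamma> w b by real_asymp
    have "\<forall>\<^sub>F L::real in at_top. w < \<eta> / 2 * sqrt L" using \<eta> w by real_asymp
    then show "\<forall>\<^sub>F L in at_top. \<forall>N\<ge>1. ln (real N) = L \<longrightarrow>
      prob {\<omega>\<in>space M. \<forall>i\<in>{1..N}. service_walk i (peak (ln N)) \<omega> \<le> ln N / \<gamma> - \<eta> * sqrt (ln N)}
        \<le> exp (- (p * exp (\<gamma> * (b / 2) * sqrt (L / (\<gamma> * w) - 1))))"
      using eventually_compose_filterlim[OF ev peak] eventually_gt_at_top[of 0]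
    proof (eventually_elim, intro allI impI)
      fix L :: real and N :: nat
      assume small: "w < \<eta> / 2 * sqrt L"
        and pk: "\<forall>i\<ge>1. p * exp (- \<gamma> * (peak L * w - b / 2 * sqrt (peak L))) \<le>
          prob {\<omega>\<in>space M. peak L * w - b * sqrt (peak L) \<le> service_walk i (peak L) \<omega>}"
        and L: "0 < L" and N: "1 \<le> N" "ln (real N) = L"
      let ?k = "peak L" and ?t = "L / \<gamma> - \<eta> * sqrt L"
      have gw: "0 < \<gamma> * w" using \<gamma> w by simp
      have q0: "0 \<le> L / (\<gamma> * w)" using L gw by simp
      have k: "real ?k \<le> L / (\<gamma> * w)" "L / (\<gamma> * w) - 1 \<le> real ?k"
        using q0 unfolding peak_def w_def[symmetric] by linarith+
      have kw: "?k * w \<le> L / \<gamma>" "L / \<gamma> - w \<le> ?k * w"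
        using mult_right_mono[OF k(1), of w] mult_right_mono[OF k(2), of w] w
        by (simp_all add: left_diff_distrib)
      have "b * sqrt ?k \<le> b * sqrt (L / (\<gamma> * w))" using b k(1) by (intro mult_left_mono) auto
      also have "\<dots> = \<eta> / 2 * sqrt L" using \<gamma> w by (simp add: b_def real_sqrt_divide)
      finally have t: "?t < ?k * w - b * sqrt ?k" using kw(2) small by linarith
      define q where "q = p * exp (- \<gamma> * (?k * w - b / 2 * sqrt ?k))"
      have "q \<le> prob {\<omega>\<in>space M. ?t < service_walk i ?k \<omega>}" if "1 \<le> i" for i
      proof -
        have "q \<le> prob {\<omega>\<in>space M. ?k * w - b * sqrt ?k \<le> service_walk i ?k \<omega>}"
          using pk that unfolding q_def by blast
        also have "\<dots> \<le> prob {\<omega>\<in>space M. ?t < service_walk i ?k \<omega>}"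
          using t that by (intro finite_measure_mono) auto
        finally show ?thesis .
      qed
      from prob_all_service_walks_le[OF N(1) this]
      have "prob {\<omega>\<in>space M. \<forall>i\<in>{1..N}. service_walk i ?k \<omega> \<le> ?t} \<le> exp (- (N * q))" .
      also have "\<dots> \<le> exp (- (p * exp (\<gamma> * (b / 2) * sqrt (L / (\<gamma> * w) - 1))))"
      proof -
        have "exp L = real N" using N(1) by (simp flip: N(2))
        then have "N * q = p * (exp L * exp (- \<gamma> * (?k * w - b / 2 * sqrt ?k)))"
          by (simp add: q_def)
        also have "exp L * exp (- \<gamma> * (?k * w - b / 2 * sqrt ?k)) = exp (L - \<gamma> * (?k * w - b / 2 * sqrt ?k))"
          unfolding exp_add[symmetric] by simp
        finally have "N * q = p * exp (L - \<gamma> * (?k * w - b / 2 * sqrt ?k))" .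
        moreover have "\<gamma> * (b / 2) * sqrt (L / (\<gamma> * w) - 1) \<le> L - \<gamma> * (?k * w - b / 2 * sqrt ?k)"
        proof -
          have "\<gamma> * (?k * w) \<le> L" using mult_left_mono[OF kw(1), of \<gamma>] \<gamma> by simp
          moreover have "\<gamma> * (b / 2) * sqrt (L / (\<gamma> * w) - 1) \<le> \<gamma> * (b / 2) * sqrt ?k"
            using k(2) \<gamma> b by (intro mult_left_mono) auto
          ultimately show ?thesis by (simp add: right_diff_distrib mult.assoc)
        qed
        ultimately show ?thesis using p by simp
      qed
      finally show "prob {\<omega>\<in>space M. \<forall>i\<in>{1..N}. service_walk i (peak (ln N)) \<omega> \<le> ln N / \<gamma> - \<eta> * sqrt (ln N)}
        \<le> exp (- (p * exp (\<gamma> * (b / 2) * sqrt (L / (\<gamma> * w) - 1))))" unfolding N(2) .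
    qed
  qed simp
qed

lemma lower_deviation:
  assumes \<eta>: "0 < \<eta>"
  obtains e where "e \<longlonglongrightarrow> 0"
    "\<And>N::nat. prob {\<omega>\<in>space M. \<forall>i\<in>{1..N}. (\<Sum>j=1..peak (ln N). Ss i j \<omega> - As j \<omega>) \<le> ln N / \<gamma> + x * sqrt (ln N)}
      \<le> prob {\<omega>\<in>space M. arrival_walk (peak (ln N)) \<omega> \<le> (x + \<eta>) * sqrt (ln N)} + e N"
proof (rule that[OF some_service_walk_reaches_level[OF \<eta>]])
  fix N :: nat
  let ?L = "ln (real N)"
  let ?k = "peak ?L"
  have sets: "{\<omega>\<in>space M. arrival_walk ?k \<omega> \<le> (x + \<eta>) * sqrt ?L} \<in> events"
    "{\<omega>\<in>space M. \<forall>i\<in>{1..N}. service_walk i ?k \<omega> \<le> ?L / \<gamma> - \<eta> * sqrt ?L} \<in> events"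
    by measurable
  have "prob {\<omega>\<in>space M. \<forall>i\<in>{1..N}. (\<Sum>j=1..?k. Ss i j \<omega> - As j \<omega>) \<le> ?L / \<gamma> + x * sqrt ?L}
    \<le> prob ({\<omega>\<in>space M. arrival_walk ?k \<omega> \<le> (x + \<eta>) * sqrt ?L} \<union>
        {\<omega>\<in>space M. \<forall>i\<in>{1..N}. service_walk i ?k \<omega> \<le> ?L / \<gamma> - \<eta> * sqrt ?L})"
  proof (intro finite_measure_mono subsetI sets.Un sets)
    fix \<omega> assume w: "\<omega> \<in> {\<omega>\<in>space M. \<forall>i\<in>{1..N}. (\<Sum>j=1..?k. Ss i j \<omega> - As j \<omega>) \<le> ?L / \<gamma> + x * sqrt ?L}"
    show "\<omega> \<in> {\<omega>\<in>space M. arrival_walk ?k \<omega> \<le> (x + \<eta>) * sqrt ?L} \<union>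
        {\<omega>\<in>space M. \<forall>i\<in>{1..N}. service_walk i ?k \<omega> \<le> ?L / \<gamma> - \<eta> * sqrt ?L}"
    proof (cases "arrival_walk ?k \<omega> \<le> (x + \<eta>) * sqrt ?L")
      case False
      have "service_walk i ?k \<omega> \<le> ?L / \<gamma> - \<eta> * sqrt ?L" if "i \<in> {1..N}" for i
      proof -
        have "service_walk i ?k \<omega> + arrival_walk ?k \<omega> \<le> ?L / \<gamma> + x * sqrt ?L"
          using w that unfolding walk_eq by blast
        then show ?thesis using False by (simp add: distrib_right)
      qed
      then show ?thesis using w by simp
    qed (use w in simp)
  qed
  also have "\<dots> \<le> prob {\<omega>\<in>space M. arrival_walk ?k \<omega> \<le> (x + \<eta>) * sqrt ?L} +
        prob {\<omega>\<in>space M. \<forall>i\<in>{1..N}. service_walk i ?k \<omega> \<le> ?L / \<gamma> - \<eta> * sqrt ?L}"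
    by (rule measure_Un_le[OF sets])
  finally show "prob {\<omega>\<in>space M. \<forall>i\<in>{1..N}. (\<Sum>j=1..?k. Ss i j \<omega> - As j \<omega>) \<le> ?L / \<gamma> + x * sqrt ?L}
    \<le> prob {\<omega>\<in>space M. arrival_walk ?k \<omega> \<le> (x + \<eta>) * sqrt ?L} +
        prob {\<omega>\<in>space M. \<forall>i\<in>{1..N}. service_walk i ?k \<omega> \<le> ?L / \<gamma> - \<eta> * sqrt ?L}" .
qed

end

section \<open>The limit theorem\<close>

lemma nat_floor_ratio_tendsto:
  fixes f :: "real \<Rightarrow> real"
  assumes lim: "((\<lambda>L. f L / L) \<longlongrightarrow> \<kappa>) at_top" and \<kappa>: "0 < \<kappa>"
  shows "((\<lambda>L. real (nat \<lfloor>f L\<rfloor>) / L) \<longlongrightarrow> \<kappa>) at_top"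
proof (rule tendsto_sandwich[of "\<lambda>L. f L / L - 1 / L" _ _ "\<lambda>L. f L / L"])
  have ev: "\<forall>\<^sub>F L in at_top. 0 < L \<and> 0 < f L"
    using order_tendstoD(1)[OF lim \<kappa>] eventually_gt_at_top[of 0]
    by eventually_elim (auto simp: zero_less_divide_iff)
  then show "\<forall>\<^sub>F L in at_top. f L / L - 1 / L \<le> real (nat \<lfloor>f L\<rfloor>) / L"
  proof eventually_elim
    case (elim L)
    have "f L - 1 \<le> real (nat \<lfloor>f L\<rfloor>)" by linarith
    then show ?case using elim by (simp add: divide_right_mono flip: diff_divide_distrib)
  qed
  show "\<forall>\<^sub>F L in at_top. real (nat \<lfloor>f L\<rfloor>) / L \<le> f L / L"
    using ev by eventually_elim (auto intro!: divide_right_mono simp: of_nat_nat)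
  have "((\<lambda>L::real. 1 / L) \<longlongrightarrow> 0) at_top" by real_asymp
  from tendsto_diff[OF lim this] show "((\<lambda>L. f L / L - 1 / L) \<longlongrightarrow> \<kappa>) at_top" by simp
qed (rule lim)

context fork_join_queue
begin

lemma arrival_walk_clt:
  assumes \<sigma>: "0 \<le> \<sigma>" "variance A = \<sigma>\<^sup>2"
    and P: "prob_space P" and X: "distributed P lborel X std_normal_density"
    and k: "((\<lambda>L. real (k L) / L) \<longlongrightarrow> 1 / (\<gamma> * v)) at_top"
  shows "weak_conv_m (\<lambda>N. distr M borel (\<lambda>\<omega>. arrival_walk (k (ln (real N))) \<omega> / sqrt (ln (real N))))
     (distr P borel (\<lambda>\<omega>. \<sigma> / sqrt (v * \<gamma>) * X \<omega>))"
proof -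
  have "\<sigma> * sqrt (1 / (\<gamma> * v)) = \<sigma> / sqrt (v * \<gamma>)" by (simp add: real_sqrt_divide mult.commute)
  then show ?thesis
    using central_limit_along_sequence[OF indep_arrivals A A_square lawA \<sigma> P X ln_nat_at_top,
        of "1 / (\<gamma> * v)" "\<lambda>N. k (ln (real N))"] \<gamma> v_pos filterlim_compose[OF k ln_nat_at_top]
    unfolding arrival_walk_def mean_A by simp
qed

text \<open>
  Up to a shift of the argument and a vanishing error, the distribution function of the normalised
  maximum lies between those of the normalised arrival walk at the two times \<open>window_start\<close> and
  \<open>peak\<close>. Both times are asymptotic to
  \<open>ln N / (\<gamma> v)\<close>, hence the two bounds have the same normal limit.
\<close>

lemma steady_state_maximum_clt:
  assumes \<sigma>: "0 \<le> \<sigma>" "variance A = \<sigma>\<^sup>2"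
    and P: "prob_space P" and X: "distributed P lborel X std_normal_density"
    and steady: "\<And>N. 1 \<le> N \<Longrightarrow> steady_state_waiting_times M Ss As N (Q N) (W N)"
  shows "weak_conv_m
    (\<lambda>N. distr (Q N) borel
       (\<lambda>\<omega>. ((MAX i\<in>{1..N}. W N i \<omega>) - 1 / \<gamma> * ln (real N)) / sqrt (ln (real N))))
    (distr P borel (\<lambda>\<omega>. \<sigma> / sqrt (v * \<gamma>) * X \<omega>))"
proof -
  interpret P: prob_space P by (rule P)
  have [measurable]: "X \<in> borel_measurable P" using X by (auto simp: distributed_def)
  define F where "F N = distr (Q N) borel (\<lambda>\<omega>. MAX i\<in>{1..N}. W N i \<omega>)" for N
  define G where "G N = distr (Q N) borel
       (\<lambda>\<omega>. ((MAX i\<in>{1..N}. W N i \<omega>) - 1 / \<gamma> * ln (real N)) / sqrt (ln (real N)))" for N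
  define R where "R k N = distr M borel (\<lambda>\<omega>. arrival_walk (k (ln (real N))) \<omega> / sqrt (ln (real N)))"
    for k :: "real \<Rightarrow> nat" and N :: nat
  have big: "\<forall>\<^sub>F N in sequentially. 2 \<le> (N::nat)" by (rule eventually_ge_at_top)
  have cdf_G: "cdf (G N) x = cdf (F N) (ln N / \<gamma> + x * sqrt (ln N))" if N: "2 \<le> N" for N x
  proof -
    have "W N i \<in> borel_measurable (Q N)" if "i \<in> {1..N}" for i
      using steady[of N] that N unfolding steady_state_waiting_times_def by auto
    then have meas[measurable]: "(\<lambda>\<omega>. MAX i\<in>{1..N}. W N i \<omega>) \<in> borel_measurable (Q N)"
      by (intro borel_measurable_Max) (rule finite_atLeastAtMost)
    have "0 < sqrt (ln (real N))" using N by simp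
    then have iff: "(y - 1 / \<gamma> * ln (real N)) / sqrt (ln (real N)) \<le> x \<longleftrightarrow> y \<le> ln N / \<gamma> + x * sqrt (ln N)" for y
      by (simp add: pos_divide_le_eq algebra_simps)
    have "cdf (G N) x = measure (Q N) ((\<lambda>\<omega>. ((MAX i\<in>{1..N}. W N i \<omega>) - 1 / \<gamma> * ln (real N)) / sqrt (ln (real N))) -` {..x} \<inter> space (Q N))"
      unfolding cdf_def G_def
      by (rule measure_distr) (intro borel_measurable_divide borel_measurable_diff meas borel_measurable_const, simp)
    also have "\<dots> = measure (Q N) ((\<lambda>\<omega>. MAX i\<in>{1..N}. W N i \<omega>) -` {..ln N / \<gamma> + x * sqrt (ln N)} \<inter> space (Q N))"
      by (rule arg_cong[where f = "measure (Q N)"]) (simp only: vimage_def atMost_iff iff mem_Collect_eq)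
    also have "\<dots> = cdf (F N) (ln N / \<gamma> + x * sqrt (ln N))"
      unfolding cdf_def F_def by (rule measure_distr[OF meas, symmetric]) simp
    finally show ?thesis .
  qed
  have cdf_R: "cdf (R k N) x = prob {\<omega>\<in>space M. arrival_walk (k (ln (real N))) \<omega> \<le> x * sqrt (ln (real N))}"
    if N: "2 \<le> N" for k N x
  proof -
    have "cdf (R k N) x = prob ((\<lambda>\<omega>. arrival_walk (k (ln (real N))) \<omega> / sqrt (ln (real N))) -` {..x} \<inter> space M)"
      unfolding cdf_def R_def by (rule measure_distr) auto
    also have "(\<lambda>\<omega>. arrival_walk (k (ln (real N))) \<omega> / sqrt (ln (real N))) -` {..x} \<inter> space M
        = {\<omega>\<in>space M. arrival_walk (k (ln (real N))) \<omega> \<le> x * sqrt (ln (real N))}"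
    proof -
      have "0 < sqrt (ln (real N))" using N by simp
      then show ?thesis by (auto simp: pos_divide_le_eq)
    qed
    finally show ?thesis .
  qed
  show ?thesis
    unfolding G_def[symmetric]
  proof (rule weak_conv_m_sandwich)
    show "real_distribution (distr P borel (\<lambda>\<omega>. \<sigma> / sqrt (v * \<gamma>) * X \<omega>))"
      by (rule P.real_distribution_distr) simp
    have pos: "0 < 1 / (\<gamma> * v)" using \<gamma> v_pos by simp
    have "((\<lambda>L. (L / a) / L) \<longlongrightarrow> inverse a) at_top"
        "((\<lambda>L. (L / a - L powr (9/10)) / L) \<longlongrightarrow> inverse a) at_top"
      if "0 < a" for a :: real
      using that by real_asymp+
    from this[of "\<gamma> * v"] have "((\<lambda>L. (L / (\<gamma> * v)) / L) \<longlongrightarrow> 1 / (\<gamma> * v)) at_top"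
        "((\<lambda>L. (L / (\<gamma> * v) - L powr (9/10)) / L) \<longlongrightarrow> 1 / (\<gamma> * v)) at_top"
      using \<gamma> v_pos by (simp_all add: inverse_eq_divide)
    from this[THEN nat_floor_ratio_tendsto, OF pos]
    have ratio: "((\<lambda>L. real (peak L) / L) \<longlongrightarrow> 1 / (\<gamma> * v)) at_top"
        "((\<lambda>L. real (window_start L) / L) \<longlongrightarrow> 1 / (\<gamma> * v)) at_top"
      unfolding peak_def window_start_def .
    show "weak_conv_m (R window_start) (distr P borel (\<lambda>\<omega>. \<sigma> / sqrt (v * \<gamma>) * X \<omega>))"
      unfolding R_def by (rule arrival_walk_clt[OF \<sigma> P X ratio(2)])
    show "weak_conv_m (R peak) (distr P borel (\<lambda>\<omega>. \<sigma> / sqrt (v * \<gamma>) * X \<omega>))"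
      unfolding R_def by (rule arrival_walk_clt[OF \<sigma> P X ratio(1)])
  next
    fix x \<eta> :: real assume \<eta>: "0 < \<eta>"
    \<comment> \<open>A third of \<open>\<eta>\<close> pays for the step function, two thirds for the deviation bound.\<close>
    then have "0 < \<eta> / 3" by simp
    then obtain e where e: "e \<longlonglongrightarrow> 0" and ev: "\<forall>\<^sub>F N in sequentially. \<forall>n.
      prob {\<omega>\<in>space M. arrival_walk (window_start (ln N)) \<omega> \<le> ((x - \<eta> / 3) - 2 * (\<eta> / 3)) * sqrt (ln N)} - e N
      \<le> prob {\<omega>\<in>space M. \<forall>i\<in>{1..N}. \<forall>k\<in>{0..n}. (\<Sum>j=1..k. Ss i j \<omega> - As j \<omega>) \<le> ln N / \<gamma> + (x - \<eta> / 3) * sqrt (ln N)}"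
      by (rule upper_deviation) (rule that)
    from ev big have "\<forall>\<^sub>F N in sequentially. cdf (R window_start N) (x - \<eta>) - e N \<le> cdf (G N) x"
    proof eventually_elim
      case (elim N)
      have "(x - \<eta> / 3) * sqrt (ln N) < x * sqrt (ln N)"
        using \<eta> elim(2) by (intro mult_strict_right_mono) auto
      then have less: "ln N / \<gamma> + (x - \<eta> / 3) * sqrt (ln N) < ln N / \<gamma> + x * sqrt (ln N)" by simp
      have "cdf (R window_start N) (x - \<eta>) - e N \<le> cdf (F N) (ln N / \<gamma> + x * sqrt (ln N))"
        unfolding F_def
      proof (rule steady_state_cdf_ge[OF _ steady less])
        show "1 \<le> N" "1 \<le> N" using elim(2) by auto
        fix n
        have "x - \<eta> / 3 - 2 * (\<eta> / 3) = x - \<eta>" by simp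
        then show "cdf (R window_start N) (x - \<eta>) - e N
          \<le> prob {\<omega>\<in>space M. \<forall>i\<in>{1..N}. \<forall>k\<in>{0..n}. (\<Sum>j=1..k. Ss i j \<omega> - As j \<omega>) \<le> ln N / \<gamma> + (x - \<eta> / 3) * sqrt (ln N)}"
          using elim(1)[rule_format, of n] unfolding cdf_R[OF elim(2)] by (simp only:)
      qed
      then show ?case using cdf_G[OF elim(2)] by simp
    qed
    with e show "\<exists>e. e \<longlonglongrightarrow> 0 \<and> (\<forall>\<^sub>F N in sequentially. cdf (R window_start N) (x - \<eta>) - e N \<le> cdf (G N) x)"
      by blast
  next
    fix x \<eta> :: real assume \<eta>: "0 < \<eta>"
    then have "0 < \<eta> / 2" by simp
    then obtain e where e: "e \<longlonglongrightarrow> 0" and le: "\<And>N::nat. prob {\<omega>\<in>space M. \<forall>i\<in>{1..N}. (\<Sum>j=1..peak (ln N). Ss i j \<omega> - As j \<omega>) \<le> ln N / \<gamma> + (x + \<eta> / 2) * sqrt (ln N)}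
      \<le> prob {\<omega>\<in>space M. arrival_walk (peak (ln N)) \<omega> \<le> ((x + \<eta> / 2) + \<eta> / 2) * sqrt (ln N)} + e N"
      by (rule lower_deviation) (rule that)
    from big have "\<forall>\<^sub>F N in sequentially. cdf (G N) x \<le> cdf (R peak N) (x + \<eta>) + e N"
    proof eventually_elim
      case (elim N)
      have "x * sqrt (ln N) < (x + \<eta> / 2) * sqrt (ln N)"
        using \<eta> elim by (intro mult_strict_right_mono) auto
      then have less: "ln N / \<gamma> + x * sqrt (ln N) < ln N / \<gamma> + (x + \<eta> / 2) * sqrt (ln N)" by simp
      have N: "1 \<le> N" using elim by simp
      have "cdf (G N) x \<le> prob {\<omega>\<in>space M. \<forall>i\<in>{1..N}. (\<Sum>j=1..peak (ln N). Ss i j \<omega> - As j \<omega>) \<le> ln N / \<gamma> + (x + \<eta> / 2) * sqrt (ln N)}"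
        unfolding cdf_G[OF elim] F_def by (rule steady_state_cdf_le[OF N steady[OF N] less])
      also have "\<dots> \<le> cdf (R peak N) (x + \<eta>) + e N"
        using le[of N] unfolding cdf_R[OF elim] by (simp add: add.assoc)
      finally show ?case .
    qed
    with e show "\<exists>e. e \<longlonglongrightarrow> 0 \<and> (\<forall>\<^sub>F N in sequentially. cdf (G N) x \<le> cdf (R peak N) (x + \<eta>) + e N)"
      by blast
  qed
qed

end

text \<open>
  Near an interior point of its domain the extended logarithmic moment generating function is the
  logarithm of a finite integral. As \<open>E exp (\<gamma> Y) = 1\<close>, its derivative at \<open>\<gamma>\<close> is that of the moment
  generating function.
\<close>

lemma (in prob_space) log_mgf_root:
  fixes Y :: "'a \<Rightarrow> real"
  assumes [measurable]: "Y \<in> borel_measurable M" and root: "log_mgf M Y \<gamma> = 0"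
    and "\<gamma> \<in> interior {\<theta>. log_mgf M Y \<theta> < \<infinity>}"
  obtains r where "0 < r" "integrable M (\<lambda>\<omega>. exp ((\<gamma> + r) * Y \<omega>))" "integrable M (\<lambda>\<omega>. exp ((\<gamma> - r) * Y \<omega>))"
    "expectation (\<lambda>\<omega>. exp (\<gamma> * Y \<omega>)) = 1"
    "deriv (\<lambda>\<theta>. real_of_ereal (log_mgf M Y \<theta>)) \<gamma> = expectation (\<lambda>\<omega>. Y \<omega> * exp (\<gamma> * Y \<omega>))"
proof -
  obtain r0 where r0: "0 < r0" and ball: "ball \<gamma> r0 \<subseteq> {\<theta>. log_mgf M Y \<theta> < \<infinity>}"
    using assms(3) by (auto simp: mem_interior)
  have int: "integrable M (\<lambda>\<omega>. exp (\<theta> * Y \<omega>))" if "\<theta> \<in> ball \<gamma> r0" for \<theta>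
    using subsetD[OF ball that] by (auto simp: log_mgf_def split: if_splits)
  define r where "r = r0 / 2"
  have r: "0 < r" using r0 by (simp add: r_def)
  have int_r: "integrable M (\<lambda>\<omega>. exp ((\<gamma> + r) * Y \<omega>))" "integrable M (\<lambda>\<omega>. exp ((\<gamma> - r) * Y \<omega>))"
    using r0 by (auto intro!: int simp: r_def dist_real_def)
  have i0: "integrable M (\<lambda>\<omega>. exp (\<gamma> * Y \<omega>))" using r0 by (intro int) auto
  have pos: "0 < expectation (\<lambda>\<omega>. exp (\<gamma> * Y \<omega>))"
  proof -
    have "expectation (\<lambda>\<omega>. exp (\<gamma> * Y \<omega>)) \<noteq> 0"
    proof
      assume "expectation (\<lambda>\<omega>. exp (\<gamma> * Y \<omega>)) = 0"
      then have "AE \<omega> in M. exp (\<gamma> * Y \<omega>) = 0" using integral_nonneg_eq_0_iff_AE[OF i0] by simp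
      then show False by simp
    qed
    moreover have "0 \<le> expectation (\<lambda>\<omega>. exp (\<gamma> * Y \<omega>))" by simp
    ultimately show ?thesis by linarith
  qed
  have one: "expectation (\<lambda>\<omega>. exp (\<gamma> * Y \<omega>)) = 1"
    using root i0 pos by (simp add: log_mgf_def ln_eq_zero_iff)
  have "((\<lambda>\<theta>. ln (expectation (\<lambda>\<omega>. exp (\<theta> * Y \<omega>)))) has_field_derivative
      expectation (\<lambda>\<omega>. Y \<omega> * exp (\<gamma> * Y \<omega>))) (at \<gamma>)"
    using DERIV_chain2[OF DERIV_ln mgf_has_derivative[OF assms(1) r int_r]] one by simp
  then have "((\<lambda>\<theta>. real_of_ereal (log_mgf M Y \<theta>)) has_field_derivative
      expectation (\<lambda>\<omega>. Y \<omega> * exp (\<gamma> * Y \<omega>))) (at \<gamma>)"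
    by (rule has_field_derivative_transform_within_open[where S = "ball \<gamma> r0"])
       (use r0 int in \<open>auto simp: log_mgf_def\<close>)
  then have "deriv (\<lambda>\<theta>. real_of_ereal (log_mgf M Y \<theta>)) \<gamma> = expectation (\<lambda>\<omega>. Y \<omega> * exp (\<gamma> * Y \<omega>))"
    by (rule DERIV_imp_deriv)
  then show ?thesis by (rule that[OF r int_r one])
qed

theorem theorem1:
  fixes M :: "'a measure"
    and Ss :: "nat \<Rightarrow> nat \<Rightarrow> 'a \<Rightarrow> real" and As :: "nat \<Rightarrow> 'a \<Rightarrow> real"
    and S A :: "'a \<Rightarrow> real"
    and lam \<sigma>\<^sub>A \<mu> \<gamma> :: real
    and \<Lambda> :: "real \<Rightarrow> ereal"
    and Q :: "nat \<Rightarrow> 'b measure" and W :: "nat \<Rightarrow> nat \<Rightarrow> 'b \<Rightarrow> real"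
    and P :: "'c measure" and X :: "'c \<Rightarrow> real"
  assumes "prob_space M"
    and indep: "prob_space.indep_vars M (\<lambda>_. borel)
          (case_sum (\<lambda>(i, j). Ss i j) As) (({1..} \<times> {1..}) <+> {1..})"
    and "S \<in> borel_measurable M" and "A \<in> borel_measurable M"
    and "\<And>i j. 1 \<le> i \<Longrightarrow> 1 \<le> j \<Longrightarrow> distr M borel (Ss i j) = distr M borel S"
    and "\<And>j. 1 \<le> j \<Longrightarrow> distr M borel (As j) = distr M borel A"
    and "\<And>i j. 1 \<le> i \<Longrightarrow> 1 \<le> j \<Longrightarrow> AE \<omega> in M. 0 \<le> Ss i j \<omega>"
    and "\<And>j. 1 \<le> j \<Longrightarrow> AE \<omega> in M. 0 \<le> As j \<omega>"
    and "0 < lam" and "prob_space.expectation M A = 1 / lam"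
    and "integrable M (\<lambda>\<omega>. (A \<omega>)\<^sup>2)"
    and "0 \<le> \<sigma>\<^sub>A" and "prob_space.variance M A = \<sigma>\<^sub>A\<^sup>2"
    and "0 < \<mu>"
    and "prob_space.expectation M (\<lambda>\<omega>. S \<omega> - A \<omega>) = - \<mu>"
    and \<Lambda>: "\<And>\<theta>. \<Lambda> \<theta> = log_mgf M (\<lambda>\<omega>. S \<omega> - 1 / lam) \<theta>"
    and "0 < \<gamma>" and "\<Lambda> \<gamma> = 0" and "\<gamma> \<in> interior {\<theta>. \<Lambda> \<theta> < \<infinity>}"
    and "\<And>N. 1 \<le> N \<Longrightarrow> steady_state_waiting_times M Ss As N (Q N) (W N)"
    and "prob_space P" and "distributed P lborel X std_normal_density"
  shows "weak_conv_m
    (\<lambda>N. distr (Q N) borel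
       (\<lambda>\<omega>. ((MAX i\<in>{1..N}. W N i \<omega>) - 1 / \<gamma> * ln (real N)) / sqrt (ln (real N))))
    (distr P borel
       (\<lambda>\<omega>. \<sigma>\<^sub>A / sqrt (deriv (\<lambda>\<theta>. real_of_ereal (\<Lambda> \<theta>)) \<gamma> * \<gamma>) * X \<omega>))"
proof -
  interpret prob_space M by fact
  note [measurable] = assms(3,4)
  interpret fork_join_input M Ss As S A
    by unfold_locales (fact assms)+
  have Ym: "(\<lambda>\<omega>. S \<omega> - 1 / lam) \<in> borel_measurable M" by simp
  obtain r where r: "0 < r" and int_r: "integrable M (\<lambda>\<omega>. exp ((\<gamma> + r) * (S \<omega> - 1 / lam)))"
      "integrable M (\<lambda>\<omega>. exp ((\<gamma> - r) * (S \<omega> - 1 / lam)))"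
    and one: "expectation (\<lambda>\<omega>. exp (\<gamma> * (S \<omega> - 1 / lam))) = 1"
    and deriv: "deriv (\<lambda>\<theta>. real_of_ereal (log_mgf M (\<lambda>\<omega>. S \<omega> - 1 / lam) \<theta>)) \<gamma>
        = expectation (\<lambda>\<omega>. (S \<omega> - 1 / lam) * exp (\<gamma> * (S \<omega> - 1 / lam)))"
    using \<open>\<Lambda> \<gamma> = 0\<close> \<open>\<gamma> \<in> interior _\<close> unfolding \<Lambda> by (rule log_mgf_root[OF Ym]) (rule that)
  have "AE x in distr M borel (Ss 1 1). 0 \<le> x"
    by (subst AE_distr_iff) (use assms(7) measurable_service in auto)
  then have "AE x in distr M borel S. 0 \<le> x" by (simp only: assms(5) order.refl)
  then have S_nonneg: "AE \<omega> in M. 0 \<le> S \<omega>" by (simp add: AE_distr_iff)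
  have "AE x in distr M borel (As 1). 0 \<le> x"
    by (subst AE_distr_iff) (use assms(8) measurable_arrival in auto)
  then have "AE x in distr M borel A. 0 \<le> x" by (simp only: assms(6) order.refl)
  then have A_nonneg: "AE \<omega> in M. 0 \<le> A \<omega>" by (simp add: AE_distr_iff)
  have A_int: "integrable M A"
    by (rule square_integrable_imp_integrable[OF _ \<open>integrable M (\<lambda>\<omega>. (A \<omega>)\<^sup>2)\<close>]) simp
  have diff_int: "integrable M (\<lambda>\<omega>. S \<omega> - A \<omega>)"
    using \<open>expectation (\<lambda>\<omega>. S \<omega> - A \<omega>) = - \<mu>\<close> \<open>0 < \<mu>\<close> not_integrable_integral_eq by fastforce
  have "integrable M (\<lambda>\<omega>. (S \<omega> - A \<omega>) + A \<omega>)" using diff_int A_int by (rule Bochner_Integration.integrable_add)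
  then have S_int: "integrable M S" by simp
  have "expectation (\<lambda>\<omega>. S \<omega> - 1 / lam) = - \<mu>"
    using assms(15) \<open>expectation A = 1 / lam\<close> S_int A_int by (simp add: prob_space)
  then have stable: "expectation (\<lambda>\<omega>. S \<omega> - 1 / lam) < 0" using \<open>0 < \<mu>\<close> by simp
  interpret fork_join_queue M Ss As S A "1 / lam" \<gamma> r
    by unfold_locales (fact assms S_nonneg A_nonneg stable r int_r one)+
  show ?thesis
    using steady_state_maximum_clt[OF assms(12,13,21,22,20)]
    unfolding \<Lambda> deriv v_def .
qed

end
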